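(* Let $a\in\mathbb{R}$, $\mu_1,\mu_2\in\mathbb{R}$, $\sigma_1,\sigma_2>0$ and $q>0$. Let $X$ be the unique strong solution of $$\mathrm{d} X_t=(\mu_1 \mathbf{1}_{\{X_t \le a\}}+\mu_2 \mathbf{1}_{\{X_t> a\}})\,\mathrm{d} t+(\sigma_1\mathbf{1}_{\{X_t\le a\}}+\sigma_2\mathbf{1}_{\{X_t> a\}})\,\mathrm{d} B_t ,$$ and let $e_q$ be an exponential random variable with rate $q$ independent of $X$. Then for any starting point $x\ge a$, on $\{z\ge a\}$ we have $$\mathbb{P}_{x}(X_{e_q}\in \mathrm{d} z)= \begin{cases} \dfrac{q e^{-\delta_2^- (z-a)}}{\sqrt{2q\sigma_2^2+\mu_2^2}}\left[e^{\delta_2^- (x-a)}+\dfrac{(\delta_2^--\delta_1^-)e^{-\delta_2^+(x-a)}}{\delta_2^++\delta_1^-}\right]\mathrm{d}z , & z\ge x\ge a,\\[2ex] \dfrac{q e^{-\delta_2^+(x-a)}}{\sqrt{2q\sigma_2^2+\mu_2^2}}\left[e^{\delta_2^+ (z-a)}+\dfrac{(\delta_2^--\delta_1^-)e^{-\delta_2^-(z-a)}}{\delta_2^++\delta_1^-}\right]\mathrm{d}z , & x\ge z\ge a. \end{cases}$$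
   Context: $B$ is a standard one-dimensional Brownian motion on a complete filtered probability space satisfying the usual conditions; $\mathbb{P}_x$ denotes the law under which $X_0=x$. It is known that the stochastic differential equation has a unique strong solution. For $i=1,2$, $$\delta_i^{+}:=\frac{\sqrt{2q\sigma_i^2+\mu_i^2}+\mu_i}{\sigma_i^2},\qquad \delta_i^{-}:=\frac{\sqrt{2q\sigma_i^2+\mu_i^2}-\mu_i}{\sigma_i^2}.$$ An identity $\mathbb{P}_x(X_{e_q}\in\mathrm{d}z)=f(z)\,\mathrm{d}z$ on a set of $z$ means that the law of $X_{e_q}$ restricted to that set is absolutely continuous with density $f$. Since $e_q$ is independent of $X$, $\mathbb{P}_{x}(X_{e_q}\in \mathrm{d}z)=\int_0^\infty qe^{-qt}\,\mathbb{P}_x(X_t\in \mathrm{d}z)\,\mathrm{d} t$. *)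

theory Defs
  imports "HOL-Probability.Probability"
begin

section \<open>Filtered probability spaces and Brownian motion\<close>

text \<open>
  Time is \<open>[0, \<infinity>)\<close>, embedded in \<^typ>\<open>real\<close>. The library locale \<^locale>\<open>filtration\<close> also mentions
  \<open>F t\<close> for \<open>t < 0\<close>; this is harmless, since a filtration on \<open>[0, \<infinity>)\<close> can be extended by \<open>F 0\<close>.
  Only the \<open>\<sigma>\<close>-algebra of \<open>F t\<close> matters, not the measure it carries.
\<close>

locale usual_filtered_prob_space =
  prob_space M + complete_measure M + filtration "space M" F
  for M :: "'a measure" and F :: "real \<Rightarrow> 'a measure" +
  assumes sets_F_subset: "0 \<le> t \<Longrightarrow> sets (F t) \<subseteq> sets M"
    and null_sets_in_F0: "null_sets M \<subseteq> sets (F 0)"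
    and right_continuous: "0 \<le> t \<Longrightarrow> sets (F t) = (\<Inter>s\<in>{t<..}. sets (F s))"

definition adapted :: "(real \<Rightarrow> 'a measure) \<Rightarrow> (real \<Rightarrow> 'a \<Rightarrow> real) \<Rightarrow> bool" where
  "adapted F X \<longleftrightarrow> (\<forall>t\<ge>0. X t \<in> borel_measurable (F t))"

definition progressively_measurable ::
  "(real \<Rightarrow> 'a measure) \<Rightarrow> (real \<Rightarrow> 'a \<Rightarrow> real) \<Rightarrow> bool" where
  "progressively_measurable F H \<longleftrightarrow>
    (\<forall>t\<ge>0. (\<lambda>(s, \<omega>). H s \<omega>) \<in> borel_measurable (restrict_space borel {0..t} \<Otimes>\<^sub>M F t))"

definition continuous_paths :: "'a measure \<Rightarrow> (real \<Rightarrow> 'a \<Rightarrow> real) \<Rightarrow> bool" where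
  "continuous_paths M X \<longleftrightarrow> (\<forall>\<omega>\<in>space M. continuous_on {0..} (\<lambda>t. X t \<omega>))"

definition brownian_motion ::
  "'a measure \<Rightarrow> (real \<Rightarrow> 'a measure) \<Rightarrow> (real \<Rightarrow> 'a \<Rightarrow> real) \<Rightarrow> bool" where
  "brownian_motion M F B \<longleftrightarrow>
    adapted F B \<and> continuous_paths M B \<and> (AE \<omega> in M. B 0 \<omega> = 0) \<and>
    (\<forall>s t. 0 \<le> s \<and> s < t \<longrightarrow>
      distributed M lborel (\<lambda>\<omega>. B t \<omega> - B s \<omega>) (normal_density 0 (sqrt (t - s))) \<and>
      prob_space.indep_set M (sets (F s))
        (sets (vimage_algebra (space M) (\<lambda>\<omega>. B t \<omega> - B s \<omega>) borel)))"

section \<open>The Ito integral\<close>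

text \<open>
  The list \<open>[(u\<^sub>1, v\<^sub>1, \<xi>\<^sub>1), \<dots>]\<close> encodes the simple process \<open>\<Sum>i. \<xi>\<^sub>i 1\<^bsub>(u\<^sub>i, v\<^sub>i]\<^esub>\<close>; the intervals
  may overlap.
\<close>

type_synonym 'a simple_proc = "(real \<times> real \<times> ('a \<Rightarrow> real)) list"

definition simple_proc_ok ::
  "'a measure \<Rightarrow> (real \<Rightarrow> 'a measure) \<Rightarrow> 'a simple_proc \<Rightarrow> bool" where
  "simple_proc_ok M F \<phi> \<longleftrightarrow>
    (\<forall>(u, v, \<xi>) \<in> set \<phi>. 0 \<le> u \<and> u \<le> v \<and> \<xi> \<in> borel_measurable (F u) \<and>
      (\<exists>C. \<forall>\<omega>\<in>space M. \<bar>\<xi> \<omega>\<bar> \<le> C))"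

definition simple_proc_val :: "'a simple_proc \<Rightarrow> real \<Rightarrow> 'a \<Rightarrow> real" where
  "simple_proc_val \<phi> s \<omega> = (\<Sum>(u, v, \<xi>)\<leftarrow>\<phi>. \<xi> \<omega> * indicator {u<..v} s)"

definition simple_proc_integral ::
  "(real \<Rightarrow> 'a \<Rightarrow> real) \<Rightarrow> 'a simple_proc \<Rightarrow> real \<Rightarrow> 'a \<Rightarrow> real" where
  "simple_proc_integral B \<phi> t \<omega> = (\<Sum>(u, v, \<xi>)\<leftarrow>\<phi>. \<xi> \<omega> * (B (min v t) \<omega> - B (min u t) \<omega>))"

text \<open>
  \<open>I\<close> is (a version of) \<open>\<integral>\<^sub>0\<^sup>t H\<^sub>s dB\<^sub>s\<close>: some sequence of simple processes converges
  to \<open>H\<close> in \<open>L\<^sup>2([0, t] \<times> M)\<close>, and their elementary integrals converge to \<open>I\<close> in \<open>L\<^sup>2(M)\<close>.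
  This is the \<open>L\<^sup>2\<close> theory, i.e. \<open>E \<integral>\<^sub>0\<^sup>t H\<^sub>s\<^sup>2 ds < \<infinity>\<close>; in particular it covers every bounded
  progressively measurable \<open>H\<close>, and no localisation is needed for bounded coefficients.
\<close>

definition has_ito_integral ::
  "'a measure \<Rightarrow> (real \<Rightarrow> 'a measure) \<Rightarrow> (real \<Rightarrow> 'a \<Rightarrow> real) \<Rightarrow>
    (real \<Rightarrow> 'a \<Rightarrow> real) \<Rightarrow> real \<Rightarrow> ('a \<Rightarrow> real) \<Rightarrow> bool" where
  "has_ito_integral M F B H t I \<longleftrightarrow>
    progressively_measurable F H \<and> I \<in> borel_measurable M \<and>
    (\<exists>\<phi> :: nat \<Rightarrow> 'a simple_proc.
      (\<forall>n. simple_proc_ok M F (\<phi> n)) \<and>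
      (\<lambda>n. \<integral>\<^sup>+\<omega>. (\<integral>\<^sup>+s\<in>{0..t}. ennreal ((H s \<omega> - simple_proc_val (\<phi> n) s \<omega>)\<^sup>2) \<partial>lborel) \<partial>M)
        \<longlonglongrightarrow> 0 \<and>
      (\<lambda>n. \<integral>\<^sup>+\<omega>. ennreal ((I \<omega> - simple_proc_integral B (\<phi> n) t \<omega>)\<^sup>2) \<partial>M) \<longlonglongrightarrow> 0)"

section \<open>Stochastic differential equations\<close>

text \<open>\<open>X\<close> solves \<open>dX\<^sub>t = b(X\<^sub>t) dt + \<sigma>(X\<^sub>t) dB\<^sub>t\<close>, \<open>X\<^sub>0 = x\<close>, on the given filtered space.\<close>

definition sde_solution ::
  "'a measure \<Rightarrow> (real \<Rightarrow> 'a measure) \<Rightarrow> (real \<Rightarrow> 'a \<Rightarrow> real) \<Rightarrow>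
    (real \<Rightarrow> real) \<Rightarrow> (real \<Rightarrow> real) \<Rightarrow> real \<Rightarrow> (real \<Rightarrow> 'a \<Rightarrow> real) \<Rightarrow> bool" where
  "sde_solution M F B b \<sigma> x X \<longleftrightarrow>
    adapted F X \<and> continuous_paths M X \<and> (AE \<omega> in M. X 0 \<omega> = x) \<and>
    (\<forall>t\<ge>0. (AE \<omega> in M. set_integrable lborel {0..t} (\<lambda>s. b (X s \<omega>))) \<and>
      (\<exists>I. has_ito_integral M F B (\<lambda>s \<omega>. \<sigma> (X s \<omega>)) t I \<and>
        (AE \<omega> in M. X t \<omega> = x + (LBINT s:{0..t}. b (X s \<omega>)) + I \<omega>)))"

definition augmented_natural_filtration ::
  "'a measure \<Rightarrow> (real \<Rightarrow> 'a \<Rightarrow> real) \<Rightarrow> real \<Rightarrow> 'a measure" where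
  "augmented_natural_filtration M B t =
    sigma (space M)
      ((\<Union>s\<in>{0..t}. {B s -` A \<inter> space M | A. A \<in> sets borel}) \<union> null_sets M)"

text \<open>
  A strong solution is moreover a functional of the driving noise: it is adapted to the completed
  filtration generated by \<open>B\<close> (the starting point is deterministic).
\<close>

definition strong_sde_solution ::
  "'a measure \<Rightarrow> (real \<Rightarrow> 'a measure) \<Rightarrow> (real \<Rightarrow> 'a \<Rightarrow> real) \<Rightarrow>
    (real \<Rightarrow> real) \<Rightarrow> (real \<Rightarrow> real) \<Rightarrow> real \<Rightarrow> (real \<Rightarrow> 'a \<Rightarrow> real) \<Rightarrow> bool" where
  "strong_sde_solution M F B b \<sigma> x X \<longleftrightarrow>
    sde_solution M F B b \<sigma> x X \<and> adapted (augmented_natural_filtration M B) X"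

section \<open>Laws with a density on a set\<close>

text \<open>
  \<open>P(Y \<in> dz) = f(z) dz\<close> on \<open>S\<close>: the counterpart of \<^const>\<open>distributed\<close> for the law restricted to \<open>S\<close>.
\<close>

definition has_density_on ::
  "'a measure \<Rightarrow> ('a \<Rightarrow> real) \<Rightarrow> real set \<Rightarrow> (real \<Rightarrow> real) \<Rightarrow> bool" where
  "has_density_on M Y S f \<longleftrightarrow>
    Y \<in> borel_measurable M \<and> f \<in> borel_measurable (restrict_space lborel S) \<and>
    (\<forall>z\<in>S. 0 \<le> f z) \<and>
    restrict_space (distr M lborel Y) S = density (restrict_space lborel S) (\<lambda>z. ennreal (f z))"

definition delta_plus :: "real \<Rightarrow> real \<Rightarrow> real \<Rightarrow> real" where
  "delta_plus q \<mu> \<sigma> = (sqrt (2 * q * \<sigma>\<^sup>2 + \<mu>\<^sup>2) + \<mu>) / \<sigma>\<^sup>2"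

definition delta_minus :: "real \<Rightarrow> real \<Rightarrow> real \<Rightarrow> real" where
  "delta_minus q \<mu> \<sigma> = (sqrt (2 * q * \<sigma>\<^sup>2 + \<mu>\<^sup>2) - \<mu>) / \<sigma>\<^sup>2"

end

theory Submission
  imports Defs
begin

text \<open>
  Let \<open>L\<close> be the generator. For smooth bounded \<open>v\<close>, a second order Taylor expansion over short time
  intervals and the moments of increments of the Ito integral give Dynkin's formula
  \<open>E v(X\<^sub>t) = v(x) + \<integral>\<^sub>0\<^sup>t E (L v)(X\<^sub>r) dr\<close>, and its Laplace transform is the resolvent equation
  \<open>E (q v - L v)(X\<^bsub>e\<^esub>) = q v(x)\<close>. It extends to \<open>C\<^sup>1\<close> functions \<open>v\<close> with one-sided second
  derivatives. Choosing for \<open>v\<close> the explicit solution of \<open>q v - L v = q 1\<^bsub>(z, \<infinity>)\<^esub>\<close> yields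
  \<open>P(X\<^bsub>e\<^esub> > z) = v(x)\<close>; differentiating in \<open>z\<close> gives the density on \<open>(a, \<infinity>)\<close>, and there is no
  atom at \<open>a\<close>.
\<close>

section \<open>Moments of elementary stochastic integrals\<close>

text \<open>The coefficients jump at \<open>a\<close>, so they cannot be frozen on a short interval.
  Only the derivatives of the test function are evaluated at the left endpoint \<open>s\<close>;
  \<open>b (X r)\<close> and \<open>\<sigma> (X r)\<close> stay under the time integral, and an
  isometry with an \<open>F s\<close>-measurable weight evaluates the quadratic term exactly. What
  remains has order (t - s)^(3/2), because \<open>v1\<close> and \<open>v2\<close> are Lipschitz and
  the increments have controlled moments up to order four.

  The explicit v has a second derivative that jumps at a and at z. An atom of the law at one of
  these points would make the value chosen there matter, so nothing may be neglected as a null set.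
  For the tails, left-hand second derivatives are used: they fit the coefficients at a, which are
  those of the lower half-line, and the value 0 of the indicator at z, so that the equation holds at
  every point. The atom at a needs a separate argument, because tails beyond points z \<ge> a only
  see (a, inf) while the claim concerns [a, inf).\<close>

locale filtered_brownian_motion = usual_filtered_prob_space M F
  for M :: "'a measure" and F +
  fixes B :: "real \<Rightarrow> 'a \<Rightarrow> real"
  assumes bm: "brownian_motion M F B"
begin

lemma measurable_F_M: "Y \<in> measurable (F s) N \<Longrightarrow> 0 \<le> s \<Longrightarrow> Y \<in> measurable M N"
  using sets_F_subset[of s] space_F[of s] measurable_mono[of N N "F s" M] by auto

lemma measurable_F_mono: "Y \<in> measurable (F s) N \<Longrightarrow> s \<le> t \<Longrightarrow> Y \<in> measurable (F t) N"
  using sets_F_mono[of s t] space_F[of s] space_F[of t] measurable_mono[of N N "F s" "F t"] by auto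

lemma B_measurable: "0 \<le> s \<Longrightarrow> s \<le> t \<Longrightarrow> B s \<in> borel_measurable (F t)"
  using bm measurable_F_mono[of "B s" s borel t] by (auto simp: brownian_motion_def adapted_def)

text \<open>\<open>brownian_motion\<close> states independence for the \<sigma>-algebra
  \<open>F s\<close>; it passes to \<open>Y\<close> because the \<sigma>-algebra generated by
  \<open>Y\<close> is contained in \<open>F s\<close>.\<close>

lemma indep_var_increment:
  assumes Y: "Y \<in> borel_measurable (F s)" and st: "0 \<le> s" "s < t"
  shows "indep_var borel Y borel (\<lambda>\<omega>. B t \<omega> - B s \<omega>)"
proof -
  let ?D = "\<lambda>\<omega>. B t \<omega> - B s \<omega>"
  have [measurable]: "Y \<in> borel_measurable M" "B t \<in> borel_measurable M" "B s \<in> borel_measurable M"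
    using Y st B_measurable measurable_F_M by (auto intro: measurable_F_M[of _ s] measurable_F_M[of _ t])
  have ind: "indep_set (sets (F s)) (sets (vimage_algebra (space M) ?D borel))"
    using bm st by (auto simp: brownian_motion_def)
  have 1: "sigma_sets (space M) {Y -` A \<inter> space M |A. A \<in> sets borel} \<subseteq> sets (F s)"
    using Y by (intro sets.sigma_sets_subset[of _ "F s", unfolded space_F])
      (auto dest: measurable_sets simp: space_F)
  have 2: "sigma_sets (space M) {?D -` A \<inter> space M |A. A \<in> sets borel}
      = sets (vimage_algebra (space M) ?D borel)"
    by (rule sets_vimage_algebra[symmetric])
  show ?thesis
    unfolding indep_var_eq 2
    using ind 1 unfolding indep_sets2_eq by (intro conjI) (measurable, blast+)
qed

text \<open>A weight known at time \<open>s\<close> factors out by independence, and the constants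
  are the moments of a centred normal law with variance \<open>t - s\<close>.\<close>

lemma increment_moment:
  assumes Y: "Y \<in> borel_measurable (F s)" "integrable M Y" and st: "0 \<le> s" "s \<le> t"
  shows integrable_mult_increment_power: "integrable M (\<lambda>\<omega>. Y \<omega> * (B t \<omega> - B s \<omega>) ^ k)"
    and "(\<integral>\<omega>. Y \<omega> * (B t \<omega> - B s \<omega>) ^ (2 * i + 1) \<partial>M) = 0"
    and "(\<integral>\<omega>. Y \<omega> * (B t \<omega> - B s \<omega>) ^ (2 * i) \<partial>M)
      = (\<integral>\<omega>. Y \<omega> \<partial>M) * (fact (2 * i) / (2 ^ i * fact i) * (t - s) ^ i)"
proof -
  let ?D = "\<lambda>\<omega>. B t \<omega> - B s \<omega>"
  have "integrable M (\<lambda>\<omega>. Y \<omega> * ?D \<omega> ^ k) \<and>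
    (\<integral>\<omega>. Y \<omega> * ?D \<omega> ^ (2 * i + 1) \<partial>M) = 0 \<and>
    (\<integral>\<omega>. Y \<omega> * ?D \<omega> ^ (2 * i) \<partial>M) = (\<integral>\<omega>. Y \<omega> \<partial>M) * (fact (2 * i) / (2 ^ i * fact i) * (t - s) ^ i)"
  \<comment> \<open>The increment has a normal density only for \<open>s < t\<close>. For
    \<open>s = t\<close> it is zero, and the formulas survive because
    \<open>0 ^ 0 = 1\<close>.\<close>
  proof (cases "s = t")
    case True
    then show ?thesis using Y by (cases k; cases i) auto
  next
    case False
    with st have lt: "s < t" "0 < sqrt (t - s)" by auto
    have dist: "distributed M lborel ?D (\<lambda>x. ennreal (normal_density 0 (sqrt (t - s)) x))"
      using bm lt st by (auto simp: brownian_motion_def)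
    have D: "integrable M (\<lambda>\<omega>. ?D \<omega> ^ k)" for k
      using distributed_integrable[OF dist, of "\<lambda>x. x ^ k"]
        integrable_normal_moment[OF lt(2), of 0 k] by simp
    have eq: "(\<integral>\<omega>. ?D \<omega> ^ k \<partial>M) = (\<integral>x. normal_density 0 (sqrt (t - s)) x * x ^ k \<partial>lborel)" for k
      using distributed_integral[OF dist, of "\<lambda>x. x ^ k"] by simp
    have ev: "(\<integral>\<omega>. ?D \<omega> ^ (2 * i) \<partial>M) = fact (2 * i) / (2 ^ i * fact i) * (t - s) ^ i"
      unfolding eq using integral_normal_moment_even[OF lt(2), of 0 i] lt
      by (simp add: field_simps power_divide)
    have od: "(\<integral>\<omega>. ?D \<omega> ^ (2 * i + 1) \<partial>M) = 0"
      unfolding eq using integral_normal_moment_odd[OF lt(2), of 0 i] by simp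
    have ind: "indep_var borel Y borel (\<lambda>\<omega>. ?D \<omega> ^ k)" for k
      using indep_var_compose[OF indep_var_increment[OF Y(1) st(1) lt(1)], of "\<lambda>x. x" borel "\<lambda>x. x ^ k" borel]
      by (simp add: comp_def)
    show ?thesis
      unfolding indep_var_lebesgue_integral[OF ind Y(2) D] ev od
      using indep_var_integrable[OF ind Y(2) D] by simp
  qed
  then show "integrable M (\<lambda>\<omega>. Y \<omega> * ?D \<omega> ^ k)"
    "(\<integral>\<omega>. Y \<omega> * ?D \<omega> ^ (2 * i + 1) \<partial>M) = 0"
    "(\<integral>\<omega>. Y \<omega> * ?D \<omega> ^ (2 * i) \<partial>M) = (\<integral>\<omega>. Y \<omega> \<partial>M) * (fact (2 * i) / (2 ^ i * fact i) * (t - s) ^ i)"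
    by auto
qed

end

text \<open>On a probability space the fourth moment controls the lower ones, by |f|^j \<le> 1 +
  |f|^4.\<close>

lemma (in prob_space) integrable_mult_power:
  fixes f Y :: "'a \<Rightarrow> real"
  assumes [measurable]: "f \<in> borel_measurable M" "Y \<in> borel_measurable M"
    and f: "integrable M (\<lambda>\<omega>. f \<omega> ^ 4)" and Y: "\<And>\<omega>. \<omega> \<in> space M \<Longrightarrow> \<bar>Y \<omega>\<bar> \<le> K" and j: "j \<le> 4"
  shows "integrable M (\<lambda>\<omega>. Y \<omega> * f \<omega> ^ j)"
proof (rule Bochner_Integration.integrable_bound[of _ "\<lambda>\<omega>. K * (1 + f \<omega> ^ 4)"])
  show "integrable M (\<lambda>\<omega>. K * (1 + f \<omega> ^ 4))" using f by simp
  show "AE \<omega> in M. norm (Y \<omega> * f \<omega> ^ j) \<le> norm (K * (1 + f \<omega> ^ 4))"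
  proof (rule AE_I2)
    fix \<omega> assume \<omega>: "\<omega> \<in> space M"
    have "\<bar>f \<omega>\<bar> ^ j \<le> 1 + \<bar>f \<omega>\<bar> ^ 4"
    proof (cases "\<bar>f \<omega>\<bar> \<le> 1")
      case True
      then have "\<bar>f \<omega>\<bar> ^ j \<le> 1" by (simp add: power_le_one)
      then show ?thesis by (simp add: add_increasing2)
    next
      case False
      then have "\<bar>f \<omega>\<bar> ^ j \<le> \<bar>f \<omega>\<bar> ^ 4" using j by (intro power_increasing) auto
      then show ?thesis by simp
    qed
    moreover have "0 \<le> K" using Y[OF \<omega>] by (meson abs_ge_zero order_trans)
    ultimately have "\<bar>Y \<omega>\<bar> * \<bar>f \<omega>\<bar> ^ j \<le> K * (1 + \<bar>f \<omega>\<bar> ^ 4)"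
      using Y[OF \<omega>] by (intro mult_mono) auto
    then show "norm (Y \<omega> * f \<omega> ^ j) \<le> norm (K * (1 + f \<omega> ^ 4))"
      using \<open>0 \<le> K\<close> by (simp add: abs_mult power_abs)
  qed
qed measurable

text \<open>In contrast to \<open>simple_proc_val\<close> the intervals are consecutive, hence
  disjoint for monotone \<open>\<tau>\<close>, so that squaring and clipping act on one value at a
  time.\<close>

definition step_process :: "(nat \<Rightarrow> real) \<Rightarrow> (nat \<Rightarrow> 'a \<Rightarrow> real) \<Rightarrow> nat \<Rightarrow> real \<Rightarrow> 'a \<Rightarrow> real" where
  "step_process \<tau> \<eta> n r \<omega> = (\<Sum>k<n. \<eta> k \<omega> * indicator {\<tau> k<..\<tau> (Suc k)} r)"

text \<open>Each \<open>r\<close> lies in at most one interval, so \<open>f\<close> meets a single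
  value; \<open>f 0 = 0\<close> takes care of the points outside all intervals.\<close>

lemma step_process_apply:
  assumes "mono \<tau>" "f 0 = 0"
  shows "f (step_process \<tau> \<eta> n r \<omega>) = step_process \<tau> (\<lambda>k \<omega>. f (\<eta> k \<omega>)) n r \<omega>"
proof (induction n)
  case 0
  then show ?case using assms by (simp add: step_process_def)
next
  case (Suc n)
  show ?case
  proof (cases "r \<in> {\<tau> n<..\<tau> (Suc n)}")
    case True
    then have "indicator {\<tau> k<..\<tau> (Suc k)} r = (0::real)" if "k < n" for k
      using monoD[OF assms(1), of "Suc k" n] that by (auto simp: indicator_def)
    then have "step_process \<tau> \<eta> n r \<omega> = 0" for \<eta> by (simp add: step_process_def)
    then show ?thesis using True by (simp add: step_process_def)
  next
    case False
    then show ?thesis using Suc by (simp add: step_process_def)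
  qed
qed

section \<open>Moments of integrals of step processes\<close>

context filtered_brownian_motion begin

lemma increment_moments:
  assumes Y: "Y \<in> borel_measurable (F s)" "integrable M Y" and st: "0 \<le> s" "s \<le> t"
  shows "(\<integral>\<omega>. Y \<omega> * (B t \<omega> - B s \<omega>) \<partial>M) = 0"
    and "(\<integral>\<omega>. Y \<omega> * (B t \<omega> - B s \<omega>) ^ 2 \<partial>M) = (\<integral>\<omega>. Y \<omega> \<partial>M) * (t - s)"
    and "(\<integral>\<omega>. Y \<omega> * (B t \<omega> - B s \<omega>) ^ 3 \<partial>M) = 0"
    and "(\<integral>\<omega>. Y \<omega> * (B t \<omega> - B s \<omega>) ^ 4 \<partial>M) = (\<integral>\<omega>. Y \<omega> \<partial>M) * (3 * (t - s)\<^sup>2)"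
    and "integrable M (\<lambda>\<omega>. Y \<omega> * (B t \<omega> - B s \<omega>))"
  using increment_moment(2)[OF assms, of 0] increment_moment(2)[OF assms, of 1]
    increment_moment(3)[OF assms, of 1] increment_moment(3)[OF assms, of 2]
    integrable_mult_increment_power[OF assms, of 1]
  by (simp_all add: fact_numeral numeral_3_eq_3)

text \<open>One bound \<open>C\<close> serves all values, since the moment estimates must not depend
  on the number of intervals.\<close>

definition adapted_partition :: "(nat \<Rightarrow> real) \<Rightarrow> (nat \<Rightarrow> 'a \<Rightarrow> real) \<Rightarrow> real \<Rightarrow> bool" where
  "adapted_partition \<tau> \<eta> C \<longleftrightarrow> mono \<tau> \<and> 0 \<le> \<tau> 0 \<and>
    (\<forall>k. \<eta> k \<in> borel_measurable (F (\<tau> k)) \<and> (\<forall>\<omega>\<in>space M. \<bar>\<eta> k \<omega>\<bar> \<le> C))"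

definition step_integral :: "(nat \<Rightarrow> real) \<Rightarrow> (nat \<Rightarrow> 'a \<Rightarrow> real) \<Rightarrow> nat \<Rightarrow> 'a \<Rightarrow> real" where
  "step_integral \<tau> \<eta> n \<omega> = (\<Sum>k<n. \<eta> k \<omega> * (B (\<tau> (Suc k)) \<omega> - B (\<tau> k) \<omega>))"

lemma adapted_partitionD:
  assumes "adapted_partition \<tau> \<eta> C"
  shows "\<tau> k \<le> \<tau> (Suc k)" "0 \<le> \<tau> k" "\<tau> 0 \<le> \<tau> k" "\<eta> k \<in> borel_measurable (F (\<tau> k))"
    "\<eta> k \<in> borel_measurable M" "\<omega> \<in> space M \<Longrightarrow> \<bar>\<eta> k \<omega>\<bar> \<le> C" "0 \<le> C"
proof -
  show *: "\<tau> k \<le> \<tau> (Suc k)" "\<tau> 0 \<le> \<tau> k" "\<eta> k \<in> borel_measurable (F (\<tau> k))"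
    "\<omega> \<in> space M \<Longrightarrow> \<bar>\<eta> k \<omega>\<bar> \<le> C"
    using assms by (auto simp: adapted_partition_def mono_def)
  show "0 \<le> \<tau> k" using *(2) assms by (auto simp: adapted_partition_def)
  then show "\<eta> k \<in> borel_measurable M" using *(3) measurable_F_M by blast
  obtain \<omega>' where "\<omega>' \<in> space M" using not_empty by blast
  then show "0 \<le> C" using assms by (force simp: adapted_partition_def)
qed

lemma step_integral_measurable:
  assumes "adapted_partition \<tau> \<eta> C"
  shows "step_integral \<tau> \<eta> n \<in> borel_measurable (F (\<tau> n))"
proof -
  note D = adapted_partitionD[OF assms]
  have *: "\<tau> k \<le> \<tau> n" "\<tau> (Suc k) \<le> \<tau> n" if "k < n" for k
    using assms that by (auto simp: adapted_partition_def mono_def)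
  have "(\<lambda>\<omega>. \<eta> k \<omega> * (B (\<tau> (Suc k)) \<omega> - B (\<tau> k) \<omega>)) \<in> borel_measurable (F (\<tau> n))" if "k < n" for k
    using *[OF that] D(2)[of k] D(2)[of "Suc k"] measurable_F_mono[OF D(4)]
    by (intro borel_measurable_times borel_measurable_diff B_measurable)
  then show ?thesis unfolding step_integral_def[abs_def] by (intro borel_measurable_sum) auto
qed

lemma step_integral_measurable_M:
  "adapted_partition \<tau> \<eta> C \<Longrightarrow> step_integral \<tau> \<eta> n \<in> borel_measurable M"
  using step_integral_measurable measurable_F_M adapted_partitionD(2) by blast

text \<open>Expand (S + \<eta> D)^4 over the last interval, with D the Brownian increment. Odd
  powers of D have mean zero, and with T = \<open>\<tau> n - \<tau> 0\<close> and h the new length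
  the rest is at most C^4 (3 T^2 + 6 T h + 3 h^2) = 3 C^4 (T + h)^2. Thus the Gaussian constant 3
  reproduces itself. The cross term needs the second moment, which is why both bounds share one
  induction.\<close>

lemma step_integral_moment4:
  assumes ad: "adapted_partition \<tau> \<eta> C"
  shows "integrable M (\<lambda>\<omega>. step_integral \<tau> \<eta> n \<omega> ^ 4) \<and>
    (\<integral>\<omega>. step_integral \<tau> \<eta> n \<omega> ^ 4 \<partial>M) \<le> 3 * C ^ 4 * (\<tau> n - \<tau> 0)\<^sup>2 \<and>
    (\<integral>\<omega>. step_integral \<tau> \<eta> n \<omega> ^ 2 \<partial>M) \<le> C\<^sup>2 * (\<tau> n - \<tau> 0)"
proof (induction n)
  case 0
  then show ?case by (simp add: step_integral_def)
next
  case (Suc n)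
  note D = adapted_partitionD[OF ad]
  let ?S = "step_integral \<tau> \<eta> n" and ?D = "\<lambda>\<omega>. B (\<tau> (Suc n)) \<omega> - B (\<tau> n) \<omega>"
  let ?h = "\<tau> (Suc n) - \<tau> n"
  note S = step_integral_measurable[OF ad, of n] step_integral_measurable_M[OF ad, of n]
  \<comment> \<open>Factors such as \<open>?S \<omega> ^ 0\<close> stay visible so that each summand
    is an instance of \<open>IM\<close> or \<open>IP\<close>.\<close>
  have e4: "step_integral \<tau> \<eta> (Suc n) \<omega> ^ 4 = ?S \<omega> ^ 4 + 4 * (\<eta> n \<omega> * ?S \<omega> ^ 3 * ?D \<omega>)
     + 6 * ((\<eta> n \<omega>)\<^sup>2 * ?S \<omega> ^ 2 * ?D \<omega> ^ 2) + 4 * (\<eta> n \<omega> ^ 3 * ?S \<omega> ^ 1 * ?D \<omega> ^ 3)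
     + \<eta> n \<omega> ^ 4 * ?S \<omega> ^ 0 * ?D \<omega> ^ 4" for \<omega>
    by (simp add: step_integral_def power4_eq_xxxx power2_eq_square power3_eq_cube algebra_simps)
  have e2: "step_integral \<tau> \<eta> (Suc n) \<omega> ^ 2 = ?S \<omega> ^ 2 + 2 * (\<eta> n \<omega> ^ 1 * ?S \<omega> ^ 1 * ?D \<omega>)
     + (\<eta> n \<omega>)\<^sup>2 * ?S \<omega> ^ 0 * ?D \<omega> ^ 2" for \<omega>
    by (simp add: step_integral_def power2_eq_square algebra_simps)
  have int: "integrable M (\<lambda>\<omega>. \<eta> n \<omega> ^ i * ?S \<omega> ^ j)" if "j \<le> 4" for i j
  proof (rule integrable_mult_power[OF S(2) _ _ _ that, of _ "C ^ i"])
    show "\<bar>\<eta> n \<omega> ^ i\<bar> \<le> C ^ i" if "\<omega> \<in> space M" for \<omega>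
      using D(6)[OF that, of n] by (simp add: power_abs power_mono)
  qed (use Suc D(5) in auto)
  have meas: "(\<lambda>\<omega>. \<eta> n \<omega> ^ i * ?S \<omega> ^ j) \<in> borel_measurable (F (\<tau> n))" for i j
    using S D(4) by (intro borel_measurable_times borel_measurable_power) auto
  note IM = increment_moments[OF meas int D(2) D(1)]
  note IP = integrable_mult_increment_power[OF meas int D(2) D(1)]
  have i2: "integrable M (\<lambda>\<omega>. ?S \<omega> ^ 2)" and i4: "integrable M (\<lambda>\<omega>. ?S \<omega> ^ 4)"
    using int[of 2 0] int[of 4 0] by auto
  have I4: "integrable M (\<lambda>\<omega>. step_integral \<tau> \<eta> (Suc n) \<omega> ^ 4)"
    unfolding e4 using i4 IM(5)[of 3 1] IP[of 2 2 2] IP[of 1 3 3] IP[of 0 4 4] by simp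
  have bnd: "(\<integral>\<omega>. \<eta> n \<omega> ^ i * ?S \<omega> ^ j \<partial>M) \<le> C ^ i * (\<integral>\<omega>. ?S \<omega> ^ j \<partial>M)" if "even i" "even j" "j \<le> 4" for i j
  proof -
    have "(\<integral>\<omega>. \<eta> n \<omega> ^ i * ?S \<omega> ^ j \<partial>M) \<le> (\<integral>\<omega>. C ^ i * ?S \<omega> ^ j \<partial>M)"
    proof (rule integral_mono)
      show "integrable M (\<lambda>\<omega>. C ^ i * ?S \<omega> ^ j)" using int[of j 0] that by simp
      fix \<omega> assume "\<omega> \<in> space M"
      then have "\<bar>\<eta> n \<omega>\<bar> ^ i \<le> C ^ i" by (intro power_mono D(6)) auto
      then show "\<eta> n \<omega> ^ i * ?S \<omega> ^ j \<le> C ^ i * ?S \<omega> ^ j"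
        using that by (intro mult_right_mono) (auto simp: zero_le_even_power power_even_abs)
    qed (use that int in auto)
    then show ?thesis by simp
  qed
  have "(\<integral>\<omega>. step_integral \<tau> \<eta> (Suc n) \<omega> ^ 4 \<partial>M) = (\<integral>\<omega>. ?S \<omega> ^ 4 \<partial>M)
      + 6 * ((\<integral>\<omega>. \<eta> n \<omega> ^ 2 * ?S \<omega> ^ 2 \<partial>M) * ?h) + (\<integral>\<omega>. \<eta> n \<omega> ^ 4 * ?S \<omega> ^ 0 \<partial>M) * (3 * ?h\<^sup>2)"
    unfolding e4 using i4 IM(5)[of 3 1] IP[of 2 2 2] IP[of 1 3 3] IP[of 0 4 4]
      IM(1)[of 3 1] IM(2)[of 2 2] IM(3)[of 1 3] IM(4)[of 0 4] by simp
  also have "\<dots> \<le> 3 * C ^ 4 * (\<tau> n - \<tau> 0)\<^sup>2 + 6 * (C ^ 2 * (C\<^sup>2 * (\<tau> n - \<tau> 0)) * ?h) + C ^ 4 * (3 * ?h\<^sup>2)"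
  proof (intro add_mono mult_left_mono mult_right_mono)
    show "(\<integral>\<omega>. \<eta> n \<omega> ^ 2 * ?S \<omega> ^ 2 \<partial>M) \<le> C ^ 2 * (C\<^sup>2 * (\<tau> n - \<tau> 0))"
      using bnd[of 2 2] Suc by (smt (verit) even_numeral mult_left_mono numeral_le_iff semiring_norm(69,71) zero_le_power2)
    show "(\<integral>\<omega>. \<eta> n \<omega> ^ 4 * ?S \<omega> ^ 0 \<partial>M) \<le> C ^ 4"
      using bnd[of 4 0] by (simp add: prob_space)
  qed (use Suc D(1)[of n] in auto)
  also have "\<dots> = 3 * C ^ 4 * (\<tau> (Suc n) - \<tau> 0)\<^sup>2"
    by (simp add: power4_eq_xxxx power2_eq_square algebra_simps)
  finally have B4: "(\<integral>\<omega>. step_integral \<tau> \<eta> (Suc n) \<omega> ^ 4 \<partial>M) \<le> 3 * C ^ 4 * (\<tau> (Suc n) - \<tau> 0)\<^sup>2" .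
  have "(\<integral>\<omega>. step_integral \<tau> \<eta> (Suc n) \<omega> ^ 2 \<partial>M) = (\<integral>\<omega>. ?S \<omega> ^ 2 \<partial>M)
      + (\<integral>\<omega>. \<eta> n \<omega> ^ 2 * ?S \<omega> ^ 0 \<partial>M) * ?h"
    unfolding e2 using i2 IM(5)[of 1 1] IP[of 0 2 2] IM(1)[of 1 1] IM(2)[of 0 2] by simp
  also have "\<dots> \<le> C\<^sup>2 * (\<tau> n - \<tau> 0) + C\<^sup>2 * ?h"
    using bnd[of 2 0] Suc D(1)[of n] by (intro add_mono mult_right_mono) (auto simp: prob_space)
  also have "\<dots> = C\<^sup>2 * (\<tau> (Suc n) - \<tau> 0)" by (simp add: algebra_simps)
  finally show ?case using I4 B4 by blast
qed

text \<open>The weight \<open>\<zeta>\<close> is known at the left endpoint, so these are the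
  martingale property and the Ito isometry conditionally on \<open>F (\<tau> 0)\<close>. The new
  increment is independent of everything multiplied with it, which kills the cross term.\<close>

lemma step_integral_isometry:
  assumes ad: "adapted_partition \<tau> \<eta> C"
    and z: "\<zeta> \<in> borel_measurable (F (\<tau> 0))" "\<And>\<omega>. \<omega> \<in> space M \<Longrightarrow> \<bar>\<zeta> \<omega>\<bar> \<le> Z"
  shows "(\<integral>\<omega>. \<zeta> \<omega> * step_integral \<tau> \<eta> n \<omega> \<partial>M) = 0"
    and "(\<integral>\<omega>. \<zeta> \<omega> * step_integral \<tau> \<eta> n \<omega> ^ 2 \<partial>M)
      = (\<Sum>k<n. (\<integral>\<omega>. \<zeta> \<omega> * \<eta> k \<omega> ^ 2 \<partial>M) * (\<tau> (Suc k) - \<tau> k))"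
proof -
  note D = adapted_partitionD[OF ad]
  have "(\<integral>\<omega>. \<zeta> \<omega> * step_integral \<tau> \<eta> n \<omega> \<partial>M) = 0 \<and> (\<integral>\<omega>. \<zeta> \<omega> * step_integral \<tau> \<eta> n \<omega> ^ 2 \<partial>M)
      = (\<Sum>k<n. (\<integral>\<omega>. \<zeta> \<omega> * \<eta> k \<omega> ^ 2 \<partial>M) * (\<tau> (Suc k) - \<tau> k))"
  proof (induction n)
    case 0
    then show ?case by (simp add: step_integral_def)
  next
    case (Suc n)
    let ?S = "step_integral \<tau> \<eta> n" and ?D = "\<lambda>\<omega>. B (\<tau> (Suc n)) \<omega> - B (\<tau> n) \<omega>"
    let ?h = "\<tau> (Suc n) - \<tau> n"
    note S = step_integral_measurable[OF ad, of n] step_integral_measurable_M[OF ad, of n]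
    have zn: "\<zeta> \<in> borel_measurable (F (\<tau> n))" using measurable_F_mono[OF z(1) D(3)] .
    have zM: "\<zeta> \<in> borel_measurable M" using measurable_F_M[OF zn D(2)] .
    have e1: "\<zeta> \<omega> * step_integral \<tau> \<eta> (Suc n) \<omega> = \<zeta> \<omega> * ?S \<omega> + \<zeta> \<omega> * \<eta> n \<omega> ^ 1 * ?S \<omega> ^ 0 * ?D \<omega>" for \<omega>
      by (simp add: step_integral_def algebra_simps)
    have e2: "\<zeta> \<omega> * step_integral \<tau> \<eta> (Suc n) \<omega> ^ 2 = \<zeta> \<omega> * ?S \<omega> ^ 2
       + 2 * (\<zeta> \<omega> * \<eta> n \<omega> ^ 1 * ?S \<omega> ^ 1 * ?D \<omega>) + \<zeta> \<omega> * \<eta> n \<omega> ^ 2 * ?S \<omega> ^ 0 * ?D \<omega> ^ 2" for \<omega>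
      by (simp add: step_integral_def power2_eq_square algebra_simps)
    have int: "integrable M (\<lambda>\<omega>. \<zeta> \<omega> * \<eta> n \<omega> ^ i * ?S \<omega> ^ j)" if "j \<le> 4" for i j
    proof (rule integrable_mult_power[OF S(2) _ _ _ that, of _ "Z * C ^ i"])
      fix \<omega> assume w: "\<omega> \<in> space M"
      then have "0 \<le> Z" using z(2) by (meson abs_ge_zero order_trans)
      then show "\<bar>\<zeta> \<omega> * \<eta> n \<omega> ^ i\<bar> \<le> Z * C ^ i"
        unfolding abs_mult power_abs using z(2)[OF w] D(6)[OF w, of n] D(7) by (intro mult_mono power_mono) auto
    qed (use step_integral_moment4[OF ad] D(5) zM in auto)
    have meas: "(\<lambda>\<omega>. \<zeta> \<omega> * \<eta> n \<omega> ^ i * ?S \<omega> ^ j) \<in> borel_measurable (F (\<tau> n))" for i j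
      using S D(4) zn by (intro borel_measurable_times borel_measurable_power) auto
    note IM = increment_moments[OF meas int D(2) D(1)]
    note IP = integrable_mult_increment_power[OF meas int D(2) D(1)]
    have i1: "integrable M (\<lambda>\<omega>. \<zeta> \<omega> * ?S \<omega>)" and i2: "integrable M (\<lambda>\<omega>. \<zeta> \<omega> * ?S \<omega> ^ 2)"
      using int[of 1 0] int[of 2 0] by auto
    have "(\<integral>\<omega>. \<zeta> \<omega> * step_integral \<tau> \<eta> (Suc n) \<omega> \<partial>M) = 0"
      unfolding e1 using i1 IM(5)[of 0 1] IM(1)[of 0 1] Suc by simp
    moreover have "(\<integral>\<omega>. \<zeta> \<omega> * step_integral \<tau> \<eta> (Suc n) \<omega> ^ 2 \<partial>M)
      = (\<integral>\<omega>. \<zeta> \<omega> * ?S \<omega> ^ 2 \<partial>M) + (\<integral>\<omega>. \<zeta> \<omega> * \<eta> n \<omega> ^ 2 \<partial>M) * ?h"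
      unfolding e2 using i2 IM(5)[of 1 1] IP[of 0 2 2] IM(1)[of 1 1] IM(2)[of 0 2] by simp
    ultimately show ?case using Suc by simp
  qed
  then show "(\<integral>\<omega>. \<zeta> \<omega> * step_integral \<tau> \<eta> n \<omega> \<partial>M) = 0"
    "(\<integral>\<omega>. \<zeta> \<omega> * step_integral \<tau> \<eta> n \<omega> ^ 2 \<partial>M)
      = (\<Sum>k<n. (\<integral>\<omega>. \<zeta> \<omega> * \<eta> k \<omega> ^ 2 \<partial>M) * (\<tau> (Suc k) - \<tau> k))" by auto
qed

end

section \<open>Normal form of simple processes\<close>

text \<open>For \<open>s \<le> t\<close> the projection onto [s, t]. It restricts time intervals to
  a window, and later clips integrands to [-C, C].\<close>

definition clamp_real :: "real \<Rightarrow> real \<Rightarrow> real \<Rightarrow> real" where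
  "clamp_real s t y = max s (min y t)"

text \<open>
  With \<open>g = B\<close> the identity refines the elementary integral, with \<open>g\<close> the indicator of \<open>{r..}\<close> it
  refines the simple process itself.
\<close>
lemma common_refinement:
  fixes \<phi> :: "'a simple_proc"
  assumes st: "s \<le> t" and \<phi>: "\<And>u v \<xi>. (u, v, \<xi>) \<in> set \<phi> \<Longrightarrow> u \<le> v"
  obtains \<tau> n where "mono \<tau>" "\<tau> 0 = s" "\<tau> n = t"
    "\<And>\<omega> g. (\<Sum>(u, v, \<xi>)\<leftarrow>\<phi>. \<xi> \<omega> * (g (clamp_real s t v) - g (clamp_real s t u))) =
      (\<Sum>k<n. (\<Sum>(u, v, \<xi>)\<leftarrow>\<phi>. if u \<le> \<tau> k \<and> \<tau> (Suc k) \<le> v then \<xi> \<omega> else 0)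
        * ((g :: real \<Rightarrow> real) (\<tau> (Suc k)) - g (\<tau> k)))"
proof -
  let ?c = "clamp_real s t"
  \<comment> \<open>The grid consists of all endpoints projected to [s, t]; adding \<open>s\<close>
    and \<open>t\<close> themselves fixes its first and last point.\<close>
  define P where "P = insert s (insert t (\<Union>(u, v, \<xi>)\<in>set \<phi>. {?c u, ?c v}))"
  have P: "finite P" "s \<in> P" "t \<in> P" by (auto simp: P_def)
  have Pst: "s \<le> p" "p \<le> t" if "p \<in> P" for p
    using that st by (auto simp: P_def clamp_real_def)
  define xs where "xs = sorted_list_of_set P"
  define n where "n = length xs - 1"
  have xs: "set xs = P" "sorted_wrt (<) xs" using P by (auto simp: xs_def)
  have len: "length xs = Suc n" using xs(1) P(2) by (cases xs) (auto simp: n_def)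
  \<comment> \<open>Continuing with the constant \<open>t\<close> beyond \<open>n\<close> keeps
    \<open>\<tau>\<close> monotone on all natural numbers.\<close>
  define \<tau> where "\<tau> k = (if k \<le> n then xs ! k else t)" for k
  have less: "\<tau> i < \<tau> j" if "i < j" "j \<le> n" for i j
    using sorted_wrt_nth_less[OF xs(2) that(1)] that len by (auto simp: \<tau>_def)
  have inP: "\<tau> k \<in> P" for k using xs(1) len P(3) nth_mem[of k xs] by (auto simp: \<tau>_def)
  have idx: "\<exists>i\<le>n. \<tau> i = p" if "p \<in> P" for p
    using that xs(1) len unfolding \<tau>_def by (metis in_set_conv_nth less_Suc_eq_le)
  have le: "\<tau> i \<le> \<tau> j" if "i \<le> j" for i j
    using less[of i j] that Pst(2)[OF inP[of i]] by (cases "i = j"; cases "j \<le> n") (auto simp: \<tau>_def)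
  have mono: "mono \<tau>" using le by (auto simp: mono_def)
  have \<tau>0: "\<tau> 0 = s"
    using idx[OF P(2)] le[of 0] Pst(1)[OF inP[of 0]] by (metis antisym le0)
  have \<tau>n: "\<tau> n = t"
    using idx[OF P(3)] le[of _ n] Pst(2)[OF inP[of n]] by (metis antisym)
  \<comment> \<open>Projected endpoints are grid points with indices i \<le> j, and a cell lies in
    [u, v] exactly if its index is in [i, j); the increment of \<open>g\<close> telescopes over
    these cells.\<close>
  have tel: "g (?c v) - g (?c u) = (\<Sum>k<n. if u \<le> \<tau> k \<and> \<tau> (Suc k) \<le> v then g (\<tau> (Suc k)) - g (\<tau> k) else 0)"
    if uv: "u \<le> v" "?c u \<in> P" "?c v \<in> P" for u v and g :: "real \<Rightarrow> real"
  proof -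
    obtain i j where ij: "i \<le> n" "\<tau> i = ?c u" "j \<le> n" "\<tau> j = ?c v" using idx uv by blast
    have "i \<le> j"
    proof (rule ccontr)
      assume "\<not> i \<le> j"
      then have "?c v < ?c u" using less[of j i] ij by auto
      then show False using uv by (auto simp: clamp_real_def)
    qed
    have iff: "u \<le> \<tau> k \<and> \<tau> (Suc k) \<le> v \<longleftrightarrow> k \<in> {i..<j}" if k: "k < n" for k
    proof -
      have 1: "s \<le> \<tau> k" "\<tau> k < t" "s < \<tau> (Suc k)" "\<tau> (Suc k) \<le> t"
        using less[of k n] less[of 0 "Suc k"] k \<tau>0 \<tau>n Pst inP by auto
      have "u \<le> \<tau> k \<longleftrightarrow> \<tau> i \<le> \<tau> k" unfolding ij using 1 by (auto simp: clamp_real_def)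
      also have "\<dots> \<longleftrightarrow> i \<le> k" using le[of i k] less[of k i] ij(1) by (cases "i \<le> k") auto
      finally have a: "u \<le> \<tau> k \<longleftrightarrow> i \<le> k" .
      have "\<tau> (Suc k) \<le> v \<longleftrightarrow> \<tau> (Suc k) \<le> \<tau> j" unfolding ij using 1 by (auto simp: clamp_real_def)
      also have "\<dots> \<longleftrightarrow> Suc k \<le> j" using le[of "Suc k" j] less[of j "Suc k"] k by (cases "Suc k \<le> j") auto
      finally show ?thesis using a by auto
    qed
    have "(\<Sum>k<n. if u \<le> \<tau> k \<and> \<tau> (Suc k) \<le> v then g (\<tau> (Suc k)) - g (\<tau> k) else 0)
        = (\<Sum>k<n. if k \<in> {i..<j} then g (\<tau> (Suc k)) - g (\<tau> k) else 0)"
      using iff by (intro sum.cong) auto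
    also have "\<dots> = (\<Sum>k\<in>{i..<j}. g (\<tau> (Suc k)) - g (\<tau> k))"
      using ij by (subst sum.inter_restrict[symmetric]) (auto intro!: sum.cong)
    also have "\<dots> = g (\<tau> j) - g (\<tau> i)" using sum_Suc_diff'[OF \<open>i \<le> j\<close>, of "\<lambda>k. g (\<tau> k)"] .
    finally show ?thesis using ij by simp
  qed
  \<comment> \<open>The induction runs over a list \<open>\<psi>\<close> of entries of
    \<open>\<phi>\<close>, because the grid has to stay the one built from the whole of
    \<open>\<phi>\<close>.\<close>
  have "(\<Sum>(u, v, \<xi>)\<leftarrow>\<psi>. \<xi> \<omega> * (g (?c v) - g (?c u))) =
      (\<Sum>k<n. (\<Sum>(u, v, \<xi>)\<leftarrow>\<psi>. if u \<le> \<tau> k \<and> \<tau> (Suc k) \<le> v then \<xi> \<omega> else 0)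
        * (g (\<tau> (Suc k)) - g (\<tau> k)))"
    if "set \<psi> \<subseteq> set \<phi>" for \<psi> \<omega> and g :: "real \<Rightarrow> real"
    using that
  proof (induction \<psi>)
    case (Cons p \<psi>)
    obtain u v \<xi> where p: "p = (u, v, \<xi>)" by (cases p)
    have "u \<le> v" "?c u \<in> P" "?c v \<in> P" using Cons.prems \<phi> p by (auto simp: P_def)
    note t = tel[OF this, of g]
    have "\<xi> \<omega> * (g (?c v) - g (?c u)) = (\<Sum>k<n. (if u \<le> \<tau> k \<and> \<tau> (Suc k) \<le> v then \<xi> \<omega> else 0) * (g (\<tau> (Suc k)) - g (\<tau> k)))"
      unfolding t sum_distrib_left by (intro sum.cong) auto
    then show ?case using Cons by (simp add: p distrib_right sum.distrib)
  qed simp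
  from this[of \<phi>] show thesis by (intro that[OF mono \<tau>0 \<tau>n]) simp
qed

context filtered_brownian_motion begin

text \<open>On the cell from \<open>\<tau> k\<close> to \<open>\<tau> (Suc k)\<close> the value is
  the sum of those \<xi> whose interval contains the cell. Such an interval begins no later than
  \<open>\<tau> k\<close>, so the value is known at \<open>\<tau> k\<close>; this turns overlapping
  intervals into an adapted partition of the window [s, t].\<close>

lemma simple_proc_normal_form:
  assumes ok: "simple_proc_ok M F \<phi>" and st: "0 \<le> s" "s \<le> t"
  obtains \<tau> \<eta> n C where "adapted_partition \<tau> \<eta> C" "\<tau> 0 = s" "\<tau> n = t"
    "\<And>r \<omega>. s < r \<Longrightarrow> r \<le> t \<Longrightarrow> simple_proc_val \<phi> r \<omega> = step_process \<tau> \<eta> n r \<omega>"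
    "\<And>\<omega>. simple_proc_integral B \<phi> t \<omega> - simple_proc_integral B \<phi> s \<omega> = step_integral \<tau> \<eta> n \<omega>"
proof -
  have ok': "0 \<le> u" "u \<le> v" "\<xi> \<in> borel_measurable (F u)" "\<exists>C. \<forall>\<omega>\<in>space M. \<bar>\<xi> \<omega>\<bar> \<le> C"
    if "(u, v, \<xi>) \<in> set \<phi>" for u v \<xi> using ok that by (auto simp: simple_proc_ok_def)
  obtain \<tau> n where \<tau>: "mono \<tau>" "\<tau> 0 = s" "\<tau> n = t"
    "\<And>\<omega> g. (\<Sum>(u, v, \<xi>)\<leftarrow>\<phi>. \<xi> \<omega> * (g (clamp_real s t v) - g (clamp_real s t u))) =
      (\<Sum>k<n. (\<Sum>(u, v, \<xi>)\<leftarrow>\<phi>. if u \<le> \<tau> k \<and> \<tau> (Suc k) \<le> v then \<xi> \<omega> else 0)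
        * ((g :: real \<Rightarrow> real) (\<tau> (Suc k)) - g (\<tau> k)))"
    by (rule common_refinement[OF st(2), of \<phi>], erule ok'(2), rule that)
  define \<eta> where "\<eta> k \<omega> = (\<Sum>(u, v, \<xi>)\<leftarrow>\<phi>. if u \<le> \<tau> k \<and> \<tau> (Suc k) \<le> v then \<xi> \<omega> else 0)" for k \<omega>
  have "\<exists>C\<ge>0. \<forall>\<omega>\<in>space M. \<forall>k. \<bar>\<Sum>(u, v, \<xi>)\<leftarrow>\<psi>. if u \<le> \<tau> k \<and> \<tau> (Suc k) \<le> v then \<xi> \<omega> else 0\<bar> \<le> C"
    if "set \<psi> \<subseteq> set \<phi>" for \<psi>
    using that
  proof (induction \<psi>)
    case (Cons p \<psi>)
    obtain u v \<xi> where p: "p = (u, v, \<xi>)" by (cases p)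
    obtain C1 where C1: "\<forall>\<omega>\<in>space M. \<bar>\<xi> \<omega>\<bar> \<le> C1" using ok'(4)[of u v \<xi>] Cons.prems p by auto
    obtain C2 where C2: "C2 \<ge> 0" "\<forall>\<omega>\<in>space M. \<forall>k. \<bar>\<Sum>(u, v, \<xi>)\<leftarrow>\<psi>. if u \<le> \<tau> k \<and> \<tau> (Suc k) \<le> v then \<xi> \<omega> else 0\<bar> \<le> C2"
      using Cons by auto
    show ?case
    proof (intro exI[of _ "\<bar>C1\<bar> + C2"] conjI ballI allI)
      fix \<omega> k assume w: "\<omega> \<in> space M"
      have "\<bar>if u \<le> \<tau> k \<and> \<tau> (Suc k) \<le> v then \<xi> \<omega> else 0\<bar> \<le> \<bar>C1\<bar>" using C1 w by fastforce
      moreover have "\<bar>\<Sum>(u, v, \<xi>)\<leftarrow>\<psi>. if u \<le> \<tau> k \<and> \<tau> (Suc k) \<le> v then \<xi> \<omega> else 0\<bar> \<le> C2" using C2 w by blast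
      ultimately show "\<bar>\<Sum>(u, v, \<xi>)\<leftarrow>p # \<psi>. if u \<le> \<tau> k \<and> \<tau> (Suc k) \<le> v then \<xi> \<omega> else 0\<bar> \<le> \<bar>C1\<bar> + C2"
        unfolding p list.map sum_list.Cons prod.case by linarith
    qed (use C2 in auto)
  qed auto
  then obtain C where C: "\<forall>\<omega>\<in>space M. \<forall>k. \<bar>\<eta> k \<omega>\<bar> \<le> C" unfolding \<eta>_def by blast
  have "(\<lambda>\<omega>. \<Sum>(u, v, \<xi>)\<leftarrow>\<psi>. if u \<le> \<tau> k \<and> \<tau> (Suc k) \<le> v then \<xi> \<omega> else 0) \<in> borel_measurable (F (\<tau> k))"
    if "set \<psi> \<subseteq> set \<phi>" for \<psi> k
    using that
  proof (induction \<psi>)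
    case (Cons p \<psi>)
    obtain u v \<xi> where p: "p = (u, v, \<xi>)" by (cases p)
    have "\<xi> \<in> borel_measurable (F u)" using Cons.prems p by (intro ok'(3)[of u v]) simp
    then have "(if u \<le> \<tau> k \<and> \<tau> (Suc k) \<le> v then \<xi> else (\<lambda>_. 0)) \<in> borel_measurable (F (\<tau> k))"
      using measurable_F_mono[of \<xi> u borel "\<tau> k"] borel_measurable_const[of "0::real" "F (\<tau> k)"] by presburger
    moreover have "(\<lambda>\<omega>. if u \<le> \<tau> k \<and> \<tau> (Suc k) \<le> v then \<xi> \<omega> else 0)
      = (if u \<le> \<tau> k \<and> \<tau> (Suc k) \<le> v then \<xi> else (\<lambda>_. 0))" by auto
    ultimately have "(\<lambda>\<omega>. if u \<le> \<tau> k \<and> \<tau> (Suc k) \<le> v then \<xi> \<omega> else 0) \<in> borel_measurable (F (\<tau> k))"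
      by simp
    then show ?case unfolding p list.map sum_list.Cons prod.case
      using Cons.IH Cons.prems by (intro borel_measurable_add) auto
  qed simp
  then have meas: "\<eta> k \<in> borel_measurable (F (\<tau> k))" for k unfolding \<eta>_def[abs_def] by simp
  have ad: "adapted_partition \<tau> \<eta> C" using \<tau> meas C st by (auto simp: adapted_partition_def)
  show thesis
  proof (rule that[OF ad \<tau>(2,3)])
    fix r \<omega> assume r: "s < r" "r \<le> t"
    \<comment> \<open>For u \<le> v the increment of this function from u to v is the indicator of u
      < r \<le> v, the half-open convention of simple processes. The projection to [s, t] preserves
      it because s < r \<le> t.\<close>
    let ?g = "indicator {r..} :: real \<Rightarrow> real"
    have "simple_proc_val \<phi> r \<omega> = (\<Sum>(u, v, \<xi>)\<leftarrow>\<phi>. \<xi> \<omega> * (?g (clamp_real s t v) - ?g (clamp_real s t u)))"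
      unfolding simple_proc_val_def
    proof (intro arg_cong[of _ _ sum_list] map_cong refl, clarify)
      fix u v \<xi> assume "(u, v, \<xi>) \<in> set \<phi>"
      then have "u \<le> v" by (rule ok'(2))
      then have "indicator {u<..v} r = ?g (clamp_real s t v) - ?g (clamp_real s t u)"
        using r by (simp add: indicator_def clamp_real_def max_def min_def)
      then show "\<xi> \<omega> * indicator {u<..v} r = \<xi> \<omega> * (?g (clamp_real s t v) - ?g (clamp_real s t u))"
        by simp
    qed
    also have "\<dots> = (\<Sum>k<n. \<eta> k \<omega> * (?g (\<tau> (Suc k)) - ?g (\<tau> k)))" unfolding \<tau>(4) \<eta>_def ..
    also have "\<dots> = step_process \<tau> \<eta> n r \<omega>"
      unfolding step_process_def
    proof (intro sum.cong refl)
      fix k show "\<eta> k \<omega> * (?g (\<tau> (Suc k)) - ?g (\<tau> k)) = \<eta> k \<omega> * indicator {\<tau> k<..\<tau> (Suc k)} r"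
        using monoD[OF \<tau>(1), of k "Suc k"] by (auto simp: indicator_def)
    qed
    finally show "simple_proc_val \<phi> r \<omega> = step_process \<tau> \<eta> n r \<omega>" .
  next
    fix \<omega>
    have "simple_proc_integral B \<phi> t \<omega> - simple_proc_integral B \<phi> s \<omega>
      = (\<Sum>(u, v, \<xi>)\<leftarrow>\<phi>. \<xi> \<omega> * (B (clamp_real s t v) \<omega> - B (clamp_real s t u) \<omega>))"
      unfolding simple_proc_integral_def
    proof (induction \<phi>)
      case (Cons p \<psi>)
      obtain u v \<xi> where p: "p = (u, v, \<xi>)" by (cases p)
      have "B (min y t) \<omega> - B (min y s) \<omega> = B (clamp_real s t y) \<omega> - B s \<omega>" for y
        using st by (auto simp: clamp_real_def min_def max_def)
      from this[of u] this[of v]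
      have "(B (min v t) \<omega> - B (min u t) \<omega>) - (B (min v s) \<omega> - B (min u s) \<omega>)
          = B (clamp_real s t v) \<omega> - B (clamp_real s t u) \<omega>" by linarith
      then have "\<xi> \<omega> * (B (min v t) \<omega> - B (min u t) \<omega>) - \<xi> \<omega> * (B (min v s) \<omega> - B (min u s) \<omega>)
          = \<xi> \<omega> * (B (clamp_real s t v) \<omega> - B (clamp_real s t u) \<omega>)"
        by (simp only: right_diff_distrib[symmetric])
      then show ?case using Cons by (simp add: p)
    qed simp
    also have "\<dots> = step_integral \<tau> \<eta> n \<omega>" unfolding \<eta>_def step_integral_def by (rule \<tau>(4)[of \<omega> "\<lambda>y. B y \<omega>"])
    finally show "simple_proc_integral B \<phi> t \<omega> - simple_proc_integral B \<phi> s \<omega> = step_integral \<tau> \<eta> n \<omega>" .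
  qed
qed

text \<open>The isometry with weight 1, in terms of nonnegative integrals as in
  \<open>has_ito_integral\<close>. Disjointness of the cells lets the square pass to the individual
  values.\<close>

lemma step_isometry_nn:
  assumes ad: "adapted_partition \<tau> \<eta> C" and \<tau>: "\<tau> 0 = s" "\<tau> n = t"
  shows "(\<integral>\<^sup>+\<omega>. ennreal ((step_integral \<tau> \<eta> n \<omega>)\<^sup>2) \<partial>M)
    = (\<integral>\<^sup>+\<omega>. (\<integral>\<^sup>+r\<in>{s..t}. ennreal ((step_process \<tau> \<eta> n r \<omega>)\<^sup>2) \<partial>lborel) \<partial>M)"
proof -
  note D = adapted_partitionD[OF ad]
  have mono: "mono \<tau>" using ad by (simp add: adapted_partition_def)
  have inner: "(\<integral>\<^sup>+r\<in>{s..t}. ennreal ((step_process \<tau> \<eta> n r \<omega>)\<^sup>2) \<partial>lborel)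
    = (\<Sum>k<n. ennreal ((\<eta> k \<omega>)\<^sup>2) * ennreal (\<tau> (Suc k) - \<tau> k))" for \<omega>
  proof -
    have eq: "ennreal ((step_process \<tau> \<eta> n r \<omega>)\<^sup>2) * indicator {s..t} r
      = (\<Sum>k<n. ennreal ((\<eta> k \<omega>)\<^sup>2) * indicator {\<tau> k<..\<tau> (Suc k)} r)" for r
    proof -
      have "(step_process \<tau> \<eta> n r \<omega>)\<^sup>2 = (\<Sum>k<n. (\<eta> k \<omega>)\<^sup>2 * indicator {\<tau> k<..\<tau> (Suc k)} r)"
        by (subst step_process_apply[OF mono, where f = power2]) (simp_all add: step_process_def)
      then have 1: "ennreal ((step_process \<tau> \<eta> n r \<omega>)\<^sup>2)
        = (\<Sum>k<n. ennreal ((\<eta> k \<omega>)\<^sup>2) * indicator {\<tau> k<..\<tau> (Suc k)} r)"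
        by (simp only:) (subst sum_ennreal[symmetric], auto simp: indicator_def intro!: sum.cong)
      have 2: "indicator {\<tau> k<..\<tau> (Suc k)} r * indicator {s..t} r = (indicator {\<tau> k<..\<tau> (Suc k)} r :: ennreal)"
        if "k < n" for k
        using monoD[OF mono, of 0 k] monoD[OF mono, of "Suc k" n] \<tau> that by (auto simp: indicator_def)
      show ?thesis unfolding 1 sum_distrib_right by (intro sum.cong refl) (simp only: mult.assoc 2 lessThan_iff)
    qed
    show ?thesis unfolding eq using D(1)
      by (subst nn_integral_sum) (simp_all add: nn_integral_cmult_indicator)
  qed
  have i2: "integrable M (\<lambda>\<omega>. (\<eta> k \<omega>)\<^sup>2)" for k
    using D(5)[of k] D(6)[of _ k] D(7)
    by (intro integrable_const_bound[of _ "C\<^sup>2"]) (auto intro!: AE_I2 simp: abs_le_square_iff[symmetric])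
  have "(\<integral>\<^sup>+\<omega>. (\<integral>\<^sup>+r\<in>{s..t}. ennreal ((step_process \<tau> \<eta> n r \<omega>)\<^sup>2) \<partial>lborel) \<partial>M)
    = (\<Sum>k<n. ennreal (\<integral>\<omega>. (\<eta> k \<omega>)\<^sup>2 \<partial>M) * ennreal (\<tau> (Suc k) - \<tau> k))"
    unfolding inner using D(5) i2
    by (simp add: nn_integral_sum nn_integral_multc nn_integral_eq_integral)
  also have "\<dots> = ennreal (\<Sum>k<n. (\<integral>\<omega>. 1 * \<eta> k \<omega> ^ 2 \<partial>M) * (\<tau> (Suc k) - \<tau> k))"
    using D(1) by (subst sum_ennreal[symmetric]) (auto simp del: sum_ennreal intro!: sum.cong simp: ennreal_mult)
  also have "\<dots> = ennreal (\<integral>\<omega>. 1 * step_integral \<tau> \<eta> n \<omega> ^ 2 \<partial>M)"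
    using step_integral_isometry(2)[OF ad, of "\<lambda>_. 1" 1 n] by simp
  also have "\<dots> = (\<integral>\<^sup>+\<omega>. ennreal ((step_integral \<tau> \<eta> n \<omega>)\<^sup>2) \<partial>M)"
    using integrable_mult_power[OF step_integral_measurable_M[OF ad, of n], of "\<lambda>_. 1" 1 2] step_integral_moment4[OF ad, of n]
    by (subst nn_integral_eq_integral) auto
  finally show ?thesis ..
qed

end

section \<open>Passage to the limit in the Ito integral\<close>

text \<open>Convergence in ennreal leaves finitely many distances possibly infinite. One index at
  distance below 1 already puts \<open>f\<close> into L2, and then every difference is square
  integrable because every \<open>g n\<close> is.\<close>

lemma L2_convergence:
  fixes f :: "'b \<Rightarrow> real"
  assumes [measurable]: "f \<in> borel_measurable N" "\<And>n. g n \<in> borel_measurable N"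
    and g: "\<And>n. integrable N (\<lambda>x. (g n x)\<^sup>2)"
    and lim: "(\<lambda>n. \<integral>\<^sup>+x. ennreal ((f x - g n x)\<^sup>2) \<partial>N) \<longlonglongrightarrow> 0"
  shows L2_limit_integrable: "integrable N (\<lambda>x. (f x)\<^sup>2)"
    and L2_diff_integrable: "integrable N (\<lambda>x. (f x - g n x)\<^sup>2)"
    and L2_limit_integral: "(\<lambda>n. \<integral>x. (f x - g n x)\<^sup>2 \<partial>N) \<longlonglongrightarrow> 0"
proof -
  obtain m where m: "(\<integral>\<^sup>+x. ennreal ((f x - g m x)\<^sup>2) \<partial>N) < 1"
    using order_tendstoD(2)[OF lim, of 1] by (auto simp: eventually_sequentially)
  then have "integrable N (\<lambda>x. (f x - g m x)\<^sup>2)"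
    by (intro integrableI_nonneg) (auto intro: order.strict_trans)
  then have "integrable N (\<lambda>x. 2 * (f x - g m x)\<^sup>2 + 2 * (g m x)\<^sup>2)" using g by simp
  then show f: "integrable N (\<lambda>x. (f x)\<^sup>2)"
  proof (rule Bochner_Integration.integrable_bound)
    have "(f x)\<^sup>2 \<le> 2 * (f x - g m x)\<^sup>2 + 2 * (g m x)\<^sup>2" for x
      using zero_le_power2[of "f x - 2 * g m x"] by (simp add: power2_eq_square algebra_simps)
    then show "AE x in N. norm ((f x)\<^sup>2) \<le> norm (2 * (f x - g m x)\<^sup>2 + 2 * (g m x)\<^sup>2)" by auto
  qed measurable
  have int: "integrable N (\<lambda>x. (f x - g n x)\<^sup>2)" for n
  proof (rule Bochner_Integration.integrable_bound[of _ "\<lambda>x. 2 * (f x)\<^sup>2 + 2 * (g n x)\<^sup>2"])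
    have "(f x - g n x)\<^sup>2 \<le> 2 * (f x)\<^sup>2 + 2 * (g n x)\<^sup>2" for x
      using zero_le_power2[of "f x + g n x"] by (simp add: power2_eq_square algebra_simps)
    then show "AE x in N. norm ((f x - g n x)\<^sup>2) \<le> norm (2 * (f x)\<^sup>2 + 2 * (g n x)\<^sup>2)" by auto
  qed (use f g in auto)
  then show "integrable N (\<lambda>x. (f x - g n x)\<^sup>2)" .
  have "(\<lambda>n. ennreal (\<integral>x. (f x - g n x)\<^sup>2 \<partial>N)) \<longlonglongrightarrow> ennreal 0"
    using lim int by (simp add: nn_integral_eq_integral)
  then show "(\<lambda>n. \<integral>x. (f x - g n x)\<^sup>2 \<partial>N) \<longlonglongrightarrow> 0"
    by (rule tendsto_ennrealD) auto
qed

text \<open>Cauchy-Schwarz in the weighted form |d g| \<le> d^2 / e + e g^2, with e close to the L2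
  norm of \<open>d n\<close>.\<close>

lemma L2_null_mult:
  fixes d :: "nat \<Rightarrow> 'b \<Rightarrow> real"
  assumes [measurable]: "\<And>n. d n \<in> borel_measurable N" "g \<in> borel_measurable N"
    and d: "\<And>n. integrable N (\<lambda>x. (d n x)\<^sup>2)" "(\<lambda>n. \<integral>x. (d n x)\<^sup>2 \<partial>N) \<longlonglongrightarrow> 0"
    and g: "integrable N (\<lambda>x. (g x)\<^sup>2)"
  shows "integrable N (\<lambda>x. d n x * g x)" "(\<lambda>n. \<integral>x. \<bar>d n x * g x\<bar> \<partial>N) \<longlonglongrightarrow> 0"
proof -
  have int: "integrable N (\<lambda>x. d n x * g x)" for n
  proof (rule Bochner_Integration.integrable_bound[of _ "\<lambda>x. (d n x)\<^sup>2 + (g x)\<^sup>2"])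
    have "\<bar>d n x * g x\<bar> \<le> (d n x)\<^sup>2 + (g x)\<^sup>2" for x
      using zero_le_power2[of "\<bar>d n x\<bar> - \<bar>g x\<bar>"] abs_ge_zero[of "d n x * g x"]
      unfolding power2_diff abs_mult power2_abs by linarith
    then show "AE x in N. norm (d n x * g x) \<le> norm ((d n x)\<^sup>2 + (g x)\<^sup>2)" by auto
  qed (use d g in auto)
  then show "integrable N (\<lambda>x. d n x * g x)" .
  define \<delta> where "\<delta> n = (\<integral>x. (d n x)\<^sup>2 \<partial>N)" for n
  \<comment> \<open>The summand \<open>1 / real (Suc n)\<close> keeps \<open>e n\<close> positive
    when \<open>\<delta> n = 0\<close>, and \<delta> / e \<le> sqrt \<delta> still holds.\<close>
  define e where "e n = sqrt (\<delta> n) + 1 / real (Suc n)" for n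
  have \<delta>: "0 \<le> \<delta> n" for n by (simp add: \<delta>_def)
  have e: "0 < e n" for n using \<delta>[of n] by (auto simp: e_def intro!: add_nonneg_pos)
  have sq: "(\<lambda>n. sqrt (\<delta> n)) \<longlonglongrightarrow> 0" using tendsto_real_sqrt[OF d(2)] by (simp add: \<delta>_def)
  have e0: "e \<longlonglongrightarrow> 0" unfolding e_def[abs_def] using tendsto_add[OF sq lim_inverse_n'[THEN LIMSEQ_Suc]] by simp
  have bound: "(\<integral>x. \<bar>d n x * g x\<bar> \<partial>N) \<le> sqrt (\<delta> n) + e n * (\<integral>x. (g x)\<^sup>2 \<partial>N)" for n
  proof -
    have "(\<integral>x. \<bar>d n x * g x\<bar> \<partial>N) \<le> (\<integral>x. (d n x)\<^sup>2 / e n + e n * (g x)\<^sup>2 \<partial>N)"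
    proof (rule integral_mono)
      fix x
      have "0 \<le> (\<bar>d n x\<bar> - e n * \<bar>g x\<bar>)\<^sup>2" by simp
      then have "2 * e n * \<bar>d n x * g x\<bar> \<le> (d n x)\<^sup>2 + (e n)\<^sup>2 * (g x)\<^sup>2"
        by (simp add: power2_diff abs_mult power_mult_distrib algebra_simps)
      moreover have "0 \<le> e n * \<bar>d n x * g x\<bar>" using e[of n] by simp
      ultimately have "e n * \<bar>d n x * g x\<bar> \<le> (d n x)\<^sup>2 + (e n)\<^sup>2 * (g x)\<^sup>2" by linarith
      then show "\<bar>d n x * g x\<bar> \<le> (d n x)\<^sup>2 / e n + e n * (g x)\<^sup>2"
        using e[of n] by (simp add: field_simps power2_eq_square)
    qed (use int d g in auto)
    also have "\<dots> = \<delta> n / e n + e n * (\<integral>x. (g x)\<^sup>2 \<partial>N)" using d g by (simp add: \<delta>_def)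
    also have "\<delta> n / e n \<le> sqrt (\<delta> n)"
    proof -
      have "\<delta> n = sqrt (\<delta> n) * sqrt (\<delta> n)" using \<delta>[of n] by simp
      also have "\<dots> \<le> sqrt (\<delta> n) * e n" using \<delta>[of n] by (intro mult_left_mono) (auto simp: e_def)
      finally show ?thesis using e[of n] by (simp add: field_simps)
    qed
    finally show ?thesis by simp
  qed
  show "(\<lambda>n. \<integral>x. \<bar>d n x * g x\<bar> \<partial>N) \<longlonglongrightarrow> 0"
  proof (rule tendsto_sandwich[OF _ _ tendsto_const])
    show "\<forall>\<^sub>F n in sequentially. 0 \<le> (\<integral>x. \<bar>d n x * g x\<bar> \<partial>N)" by simp
    show "\<forall>\<^sub>F n in sequentially. (\<integral>x. \<bar>d n x * g x\<bar> \<partial>N) \<le> sqrt (\<delta> n) + e n * (\<integral>x. (g x)\<^sup>2 \<partial>N)"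
      using bound by simp
    show "(\<lambda>n. sqrt (\<delta> n) + e n * (\<integral>x. (g x)\<^sup>2 \<partial>N)) \<longlonglongrightarrow> 0"
      using tendsto_add[OF sq tendsto_mult[OF e0 tendsto_const, of "\<integral>x. (g x)\<^sup>2 \<partial>N"]] by simp
  qed
qed

text \<open>Bounded weights reduce both limits to L1 convergence, of g to f and of g^2 to
  f^2.\<close>

lemma (in finite_measure) L2_tendsto_integrals:
  fixes f \<zeta> :: "'a \<Rightarrow> real"
  assumes meas[measurable]: "f \<in> borel_measurable M" "\<And>n. g n \<in> borel_measurable M"
    and g: "\<And>n. integrable M (\<lambda>x. (g n x)\<^sup>2)"
    and lim: "(\<lambda>n. \<integral>\<^sup>+x. ennreal ((f x - g n x)\<^sup>2) \<partial>M) \<longlonglongrightarrow> 0"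
    and z[measurable]: "\<zeta> \<in> borel_measurable M" and Z: "\<And>x. x \<in> space M \<Longrightarrow> \<bar>\<zeta> x\<bar> \<le> Z"
  shows "(\<lambda>n. \<integral>x. \<zeta> x * g n x \<partial>M) \<longlonglongrightarrow> (\<integral>x. \<zeta> x * f x \<partial>M)"
    and "(\<lambda>n. \<integral>x. \<zeta> x * (g n x)\<^sup>2 \<partial>M) \<longlonglongrightarrow> (\<integral>x. \<zeta> x * (f x)\<^sup>2 \<partial>M)"
    and "(\<lambda>n. \<integral>x. \<bar>f x - g n x\<bar> \<partial>M) \<longlonglongrightarrow> 0" "integrable M f"
    and "integrable M (\<lambda>x. f x - g n x)"
proof -
  note L = L2_convergence[OF meas g lim]
  have [measurable]: "\<And>n. (\<lambda>x. f x - g n x) \<in> borel_measurable M" by measurable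
  note m1 = L2_null_mult[of "\<lambda>n x. f x - g n x" M "\<lambda>_. 1", OF _ _ L(2,3), simplified]
  note mf = L2_null_mult[of "\<lambda>n x. f x - g n x" M f, OF _ _ L(2,3,1), simplified]
  show 1: "(\<lambda>n. \<integral>x. \<bar>f x - g n x\<bar> \<partial>M) \<longlonglongrightarrow> 0" by (rule m1(2))
  show i: "integrable M (\<lambda>x. f x - g n x)" for n by (rule m1(1))
  show f1: "integrable M f"
    using L(1) by (rule square_integrable_imp_integrable[OF meas(1)])
  have g1: "integrable M (g n)" for n
    using g[of n] by (rule square_integrable_imp_integrable[OF meas(2)])
  have zint: "integrable M (\<lambda>x. \<zeta> x * h x)" if "integrable M h" for h
  proof (rule Bochner_Integration.integrable_bound[of _ "\<lambda>x. Z * h x"])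
    show "AE x in M. norm (\<zeta> x * h x) \<le> norm (Z * h x)"
    proof (rule AE_I2)
      fix x assume "x \<in> space M"
      then have "\<bar>\<zeta> x\<bar> \<le> \<bar>Z\<bar>" using Z by fastforce
      then show "norm (\<zeta> x * h x) \<le> norm (Z * h x)" by (simp add: abs_mult mult_right_mono)
    qed
  qed (use that in auto)
  have zb: "\<bar>\<integral>x. \<zeta> x * h x \<partial>M\<bar> \<le> \<bar>Z\<bar> * (\<integral>x. \<bar>h x\<bar> \<partial>M)" if "integrable M h" for h
  proof -
    have "\<bar>\<integral>x. \<zeta> x * h x \<partial>M\<bar> \<le> (\<integral>x. \<bar>\<zeta> x * h x\<bar> \<partial>M)" by (rule integral_abs_bound)
    also have "\<dots> \<le> (\<integral>x. \<bar>Z\<bar> * \<bar>h x\<bar> \<partial>M)"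
    proof (rule integral_mono)
      fix x assume "x \<in> space M"
      then have "\<bar>\<zeta> x\<bar> \<le> \<bar>Z\<bar>" using Z by fastforce
      then show "\<bar>\<zeta> x * h x\<bar> \<le> \<bar>Z\<bar> * \<bar>h x\<bar>" by (simp add: abs_mult mult_right_mono)
    qed (use that zint[OF that] in auto)
    finally show ?thesis by simp
  qed
  show "(\<lambda>n. \<integral>x. \<zeta> x * g n x \<partial>M) \<longlonglongrightarrow> (\<integral>x. \<zeta> x * f x \<partial>M)"
  proof (rule Lim_transform2)
    show "(\<lambda>n. (\<integral>x. \<zeta> x * f x \<partial>M) - (\<integral>x. \<zeta> x * g n x \<partial>M)) \<longlonglongrightarrow> 0"
    proof (rule Lim_null_comparison[OF always_eventually[OF allI]])
      fix n
      have "(\<integral>x. \<zeta> x * f x \<partial>M) - (\<integral>x. \<zeta> x * g n x \<partial>M) = (\<integral>x. \<zeta> x * (f x - g n x) \<partial>M)"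
        using zint[OF f1] zint[OF g1] by (simp add: right_diff_distrib)
      then show "norm ((\<integral>x. \<zeta> x * f x \<partial>M) - (\<integral>x. \<zeta> x * g n x \<partial>M)) \<le> \<bar>Z\<bar> * (\<integral>x. \<bar>f x - g n x\<bar> \<partial>M)"
        using zb[OF i] by simp
      show "(\<lambda>n. \<bar>Z\<bar> * (\<integral>x. \<bar>f x - g n x\<bar> \<partial>M)) \<longlonglongrightarrow> 0" using tendsto_mult_left[OF 1, of "\<bar>Z\<bar>"] by simp
    qed
  qed simp
  show "(\<lambda>n. \<integral>x. \<zeta> x * (g n x)\<^sup>2 \<partial>M) \<longlonglongrightarrow> (\<integral>x. \<zeta> x * (f x)\<^sup>2 \<partial>M)"
  proof (rule Lim_transform2)
    show "(\<lambda>n. (\<integral>x. \<zeta> x * (f x)\<^sup>2 \<partial>M) - (\<integral>x. \<zeta> x * (g n x)\<^sup>2 \<partial>M)) \<longlonglongrightarrow> 0"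
    proof (rule Lim_null_comparison[OF always_eventually[OF allI]])
      fix n
      let ?d = "\<lambda>x. f x - g n x"
      \<comment> \<open>The mixed product contains the fixed \<open>f\<close> instead of the moving
        \<open>g n\<close>, so that \<open>L2_null_mult\<close> applies.\<close>
      have e: "(f x)\<^sup>2 - (g n x)\<^sup>2 = 2 * (?d x * f x) - (?d x)\<^sup>2" for x
        by (simp add: power2_eq_square algebra_simps)
      have ii: "integrable M (\<lambda>x. (f x)\<^sup>2 - (g n x)\<^sup>2)" using L(1) g by simp
      have "(\<integral>x. \<zeta> x * (f x)\<^sup>2 \<partial>M) - (\<integral>x. \<zeta> x * (g n x)\<^sup>2 \<partial>M) = (\<integral>x. \<zeta> x * ((f x)\<^sup>2 - (g n x)\<^sup>2) \<partial>M)"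
        using zint[OF L(1)] zint[OF g] by (simp add: right_diff_distrib)
      then have "\<bar>(\<integral>x. \<zeta> x * (f x)\<^sup>2 \<partial>M) - (\<integral>x. \<zeta> x * (g n x)\<^sup>2 \<partial>M)\<bar> \<le> \<bar>Z\<bar> * (\<integral>x. \<bar>(f x)\<^sup>2 - (g n x)\<^sup>2\<bar> \<partial>M)"
        using zb[OF ii] by simp
      also have "\<dots> \<le> \<bar>Z\<bar> * (\<integral>x. 2 * \<bar>?d x * f x\<bar> + (?d x)\<^sup>2 \<partial>M)"
      proof (intro mult_left_mono integral_mono)
        fix x show "\<bar>(f x)\<^sup>2 - (g n x)\<^sup>2\<bar> \<le> 2 * \<bar>?d x * f x\<bar> + (?d x)\<^sup>2"
          unfolding e using abs_triangle_ineq4[of "2 * (?d x * f x)" "(?d x)\<^sup>2"] by simp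
      qed (use mf(1)[of n] L(2)[of n] ii in auto)
      also have "\<dots> = \<bar>Z\<bar> * (2 * (\<integral>x. \<bar>?d x * f x\<bar> \<partial>M) + (\<integral>x. (?d x)\<^sup>2 \<partial>M))"
        using mf(1)[of n] L(2)[of n] by simp
      finally show "norm ((\<integral>x. \<zeta> x * (f x)\<^sup>2 \<partial>M) - (\<integral>x. \<zeta> x * (g n x)\<^sup>2 \<partial>M))
        \<le> \<bar>Z\<bar> * (2 * (\<integral>x. \<bar>?d x * f x\<bar> \<partial>M) + (\<integral>x. (?d x)\<^sup>2 \<partial>M))" by simp
      show "(\<lambda>n. \<bar>Z\<bar> * (2 * (\<integral>x. \<bar>(f x - g n x) * f x\<bar> \<partial>M) + (\<integral>x. (f x - g n x)\<^sup>2 \<partial>M))) \<longlonglongrightarrow> 0"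
        using tendsto_mult_left[OF tendsto_add[OF tendsto_mult_left[OF mf(2), of 2] L(3)], of "\<bar>Z\<bar>"] by simp
    qed
  qed simp
qed

lemma nn_integral_square_add:
  fixes u v :: "'b \<Rightarrow> real"
  assumes [measurable]: "u \<in> borel_measurable N" "v \<in> borel_measurable N"
    and "(\<integral>\<^sup>+x. ennreal ((u x)\<^sup>2) \<partial>N) \<le> a" "(\<integral>\<^sup>+x. ennreal ((v x)\<^sup>2) \<partial>N) \<le> b"
  shows "(\<integral>\<^sup>+x. ennreal ((u x + v x)\<^sup>2) \<partial>N) \<le> 2 * a + 2 * b"
proof -
  have "(\<integral>\<^sup>+x. ennreal ((u x + v x)\<^sup>2) \<partial>N) \<le> (\<integral>\<^sup>+x. 2 * ennreal ((u x)\<^sup>2) + 2 * ennreal ((v x)\<^sup>2) \<partial>N)"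
  proof (rule nn_integral_mono)
    fix x
    have "(u x + v x)\<^sup>2 \<le> 2 * (u x)\<^sup>2 + 2 * (v x)\<^sup>2"
      using zero_le_power2[of "u x - v x"] by (simp add: power2_eq_square algebra_simps)
    then have "ennreal ((u x + v x)\<^sup>2) \<le> ennreal (2 * (u x)\<^sup>2 + 2 * (v x)\<^sup>2)" by (rule ennreal_leI)
    also have "\<dots> = 2 * ennreal ((u x)\<^sup>2) + 2 * ennreal ((v x)\<^sup>2)"
      by (simp add: ennreal_plus ennreal_mult)
    finally show "ennreal ((u x + v x)\<^sup>2) \<le> 2 * ennreal ((u x)\<^sup>2) + 2 * ennreal ((v x)\<^sup>2)" .
  qed
  also have "\<dots> = 2 * (\<integral>\<^sup>+x. ennreal ((u x)\<^sup>2) \<partial>N) + 2 * (\<integral>\<^sup>+x. ennreal ((v x)\<^sup>2) \<partial>N)"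
    by (simp add: nn_integral_add nn_integral_cmult)
  also have "\<dots> \<le> 2 * a + 2 * b" using assms(3,4) by (intro add_mono mult_left_mono) auto
  finally show ?thesis .
qed

text \<open>Views a process on [s, t] as one function on a finite product measure space, so that the
  L2 lemmas serve for integrands as well as for integrals.\<close>

lemma (in prob_space) strip_nn_integral:
  fixes f :: "'a \<times> real \<Rightarrow> real"
  assumes f: "f \<in> borel_measurable (M \<Otimes>\<^sub>M borel)"
  shows strip_measurable: "f \<in> borel_measurable (M \<Otimes>\<^sub>M restrict_space lborel {s..t})"
    and "(\<integral>\<^sup>+p. ennreal ((f p)\<^sup>2) \<partial>(M \<Otimes>\<^sub>M restrict_space lborel {s..t}))
    = (\<integral>\<^sup>+\<omega>. (\<integral>\<^sup>+r\<in>{s..t}. ennreal ((f (\<omega>, r))\<^sup>2) \<partial>lborel) \<partial>M)"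
    and "finite_measure (M \<Otimes>\<^sub>M restrict_space lborel {s..t})"
proof -
  let ?R = "restrict_space lborel {s..t}"
  interpret R: finite_measure ?R
    by (rule finite_measureI) (auto simp: emeasure_restrict_space space_restrict_space emeasure_lborel_Icc_eq)
  have "(\<lambda>p. (fst p, snd p)) \<in> M \<Otimes>\<^sub>M ?R \<rightarrow>\<^sub>M M \<Otimes>\<^sub>M borel"
    using measurable_restrict_space1[of "\<lambda>x. x" lborel borel "{s..t}"]
    by (intro measurable_Pair) (auto intro: measurable_compose[OF measurable_snd])
  from measurable_compose[OF this f] show m: "f \<in> borel_measurable (M \<Otimes>\<^sub>M ?R)" by simp
  then have "(\<integral>\<^sup>+p. ennreal ((f p)\<^sup>2) \<partial>(M \<Otimes>\<^sub>M ?R)) = (\<integral>\<^sup>+\<omega>. (\<integral>\<^sup>+r. ennreal ((f (\<omega>, r))\<^sup>2) \<partial>?R) \<partial>M)"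
    by (subst R.nn_integral_fst) auto
  then show "(\<integral>\<^sup>+p. ennreal ((f p)\<^sup>2) \<partial>(M \<Otimes>\<^sub>M ?R))
    = (\<integral>\<^sup>+\<omega>. (\<integral>\<^sup>+r\<in>{s..t}. ennreal ((f (\<omega>, r))\<^sup>2) \<partial>lborel) \<partial>M)"
    by (simp add: nn_integral_restrict_space)
  show "finite_measure (M \<Otimes>\<^sub>M ?R)"
    by (intro finite_measure_pair_measure R.finite_measure_axioms finite_measure_axioms)
qed

section \<open>Isometry for simple processes and approximation of Ito increments\<close>

context filtered_brownian_motion begin

lemma step_process_measurable:
  assumes "adapted_partition \<tau> \<eta> C"
  shows "(\<lambda>p. step_process \<tau> \<eta> n (snd p) (fst p)) \<in> borel_measurable (M \<Otimes>\<^sub>M borel)"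
proof -
  note [measurable] = adapted_partitionD(5)[OF assms]
  show ?thesis unfolding step_process_def by measurable
qed

lemma simple_proc_val_measurable:
  assumes "simple_proc_ok M F \<phi>"
  shows "(\<lambda>p. simple_proc_val \<phi> (snd p) (fst p)) \<in> borel_measurable (M \<Otimes>\<^sub>M borel)"
  using assms
proof (induction \<phi>)
  case Nil
  then show ?case by (simp add: simple_proc_val_def)
next
  case (Cons x \<phi>)
  obtain u v \<xi> where x: "x = (u, v, \<xi>)" by (cases x)
  have "\<xi> \<in> borel_measurable (F u)" "0 \<le> u" using Cons.prems by (auto simp: simple_proc_ok_def x)
  then have [measurable]: "\<xi> \<in> borel_measurable M" by (rule measurable_F_M)
  have [measurable]: "(\<lambda>p. simple_proc_val \<phi> (snd p) (fst p)) \<in> borel_measurable (M \<Otimes>\<^sub>M borel)"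
    using Cons by (auto simp: simple_proc_ok_def)
  have "(\<lambda>p. \<xi> (fst p) * indicator {u<..v} (snd p) + simple_proc_val \<phi> (snd p) (fst p)) \<in> borel_measurable (M \<Otimes>\<^sub>M borel)"
    by measurable
  then show ?case by (simp add: simple_proc_val_def x)
qed

lemma simple_proc_integral_0:
  "simple_proc_ok M F \<phi> \<Longrightarrow> simple_proc_integral B \<phi> 0 \<omega> = 0"
proof (induction \<phi>)
  case (Cons p \<phi>)
  obtain u v \<xi> where p: "p = (u, v, \<xi>)" by (cases p)
  have uv: "0 \<le> u" "0 \<le> v" using Cons.prems by (auto simp: simple_proc_ok_def p)
  have "simple_proc_integral B \<phi> 0 \<omega> = 0" using Cons by (auto simp: simple_proc_ok_def)
  then show ?case using uv by (simp add: simple_proc_integral_def p min_absorb2)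
qed (simp add: simple_proc_integral_def)

lemma simple_proc_integral_measurable:
  assumes "simple_proc_ok M F \<phi>" "0 \<le> t"
  shows "simple_proc_integral B \<phi> t \<in> borel_measurable M"
proof -
  obtain \<tau> \<eta> n C where *: "adapted_partition \<tau> \<eta> C"
    "\<And>\<omega>. simple_proc_integral B \<phi> t \<omega> - simple_proc_integral B \<phi> 0 \<omega> = step_integral \<tau> \<eta> n \<omega>"
    by (rule simple_proc_normal_form[OF assms(1) order_refl assms(2)], rule that)
  have "simple_proc_integral B \<phi> t = step_integral \<tau> \<eta> n"
    using *(2) simple_proc_integral_0[OF assms(1)] by auto
  then show ?thesis using step_integral_measurable_M[OF *(1)] by simp
qed

text \<open>Passage to the normal form on [0, t]. The two integrands can differ on [0, t] at time 0
  only, a null set.\<close>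

lemma simple_proc_isometry:
  assumes ok: "simple_proc_ok M F \<phi>" and t: "0 \<le> t"
  shows "(\<integral>\<^sup>+\<omega>. ennreal ((simple_proc_integral B \<phi> t \<omega>)\<^sup>2) \<partial>M)
    = (\<integral>\<^sup>+\<omega>. (\<integral>\<^sup>+r\<in>{0..t}. ennreal ((simple_proc_val \<phi> r \<omega>)\<^sup>2) \<partial>lborel) \<partial>M)"
proof -
  obtain \<tau> \<eta> n C where *: "adapted_partition \<tau> \<eta> C" "\<tau> 0 = 0" "\<tau> n = t"
    "\<And>r \<omega>. 0 < r \<Longrightarrow> r \<le> t \<Longrightarrow> simple_proc_val \<phi> r \<omega> = step_process \<tau> \<eta> n r \<omega>"
    "\<And>\<omega>. simple_proc_integral B \<phi> t \<omega> - simple_proc_integral B \<phi> 0 \<omega> = step_integral \<tau> \<eta> n \<omega>"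
    by (rule simple_proc_normal_form[OF ok order_refl t], rule that)
  have "simple_proc_integral B \<phi> t = step_integral \<tau> \<eta> n"
    using *(5) simple_proc_integral_0[OF ok] by auto
  then have "(\<integral>\<^sup>+\<omega>. ennreal ((simple_proc_integral B \<phi> t \<omega>)\<^sup>2) \<partial>M)
    = (\<integral>\<^sup>+\<omega>. (\<integral>\<^sup>+r\<in>{0..t}. ennreal ((step_process \<tau> \<eta> n r \<omega>)\<^sup>2) \<partial>lborel) \<partial>M)"
    using step_isometry_nn[OF *(1-3)] by simp
  also have "\<dots> = (\<integral>\<^sup>+\<omega>. (\<integral>\<^sup>+r\<in>{0..t}. ennreal ((simple_proc_val \<phi> r \<omega>)\<^sup>2) \<partial>lborel) \<partial>M)"
  proof (rule nn_integral_cong, rule nn_integral_cong_AE)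
    fix \<omega>
    show "AE r in lborel. ennreal ((step_process \<tau> \<eta> n r \<omega>)\<^sup>2) * indicator {0..t} r
        = ennreal ((simple_proc_val \<phi> r \<omega>)\<^sup>2) * indicator {0..t} r"
      using AE_lborel_singleton[of 0] by eventually_elim (auto simp: indicator_def *(4))
  qed
  finally show ?thesis .
qed

text \<open>Overlapping intervals are allowed, so a difference is the concatenation with negated
  values.\<close>

lemma simple_proc_diff:
  assumes \<phi>: "simple_proc_ok M F \<phi>" and \<psi>: "simple_proc_ok M F \<psi>"
  obtains \<rho> where "simple_proc_ok M F \<rho>"
    "\<And>r \<omega>. simple_proc_val \<rho> r \<omega> = simple_proc_val \<phi> r \<omega> - simple_proc_val \<psi> r \<omega>"
    "\<And>t \<omega>. simple_proc_integral B \<rho> t \<omega> = simple_proc_integral B \<phi> t \<omega> - simple_proc_integral B \<psi> t \<omega>"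
proof
  let ?m = "map (\<lambda>(u, v, \<xi>). (u, v, \<lambda>\<omega>. - \<xi> \<omega>)) \<psi>"
  show "simple_proc_ok M F (\<phi> @ ?m)"
    using \<phi> \<psi> by (fastforce simp: simple_proc_ok_def)
  have "simple_proc_val ?m r \<omega> = - simple_proc_val \<psi> r \<omega>" for r \<omega>
    by (induction \<psi>) (auto simp: simple_proc_val_def)
  then show "simple_proc_val (\<phi> @ ?m) r \<omega> = simple_proc_val \<phi> r \<omega> - simple_proc_val \<psi> r \<omega>" for r \<omega>
    by (simp add: simple_proc_val_def)
  have "simple_proc_integral B ?m t \<omega> = - simple_proc_integral B \<psi> t \<omega>" for t \<omega>
    by (induction \<psi>) (auto simp: simple_proc_integral_def algebra_simps)
  then show "simple_proc_integral B (\<phi> @ ?m) t \<omega> = simple_proc_integral B \<phi> t \<omega> - simple_proc_integral B \<psi> t \<omega>" for t \<omega>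
    by (simp add: simple_proc_integral_def)
qed


text \<open>One step of the approximation, with mean square errors a, b, c, d. \<open>I - I'\<close>
  differs from the integral of the clipped step process by four terms: the errors c at time t and d
  at time s; the integral up to s of the difference of \<open>\<phi>\<close> and
  \<open>\<psi>\<close>, which by isometry contributes at most 2 a + 2 b as both approximate
  \<open>H\<close> on [0, s]; and the effect of clipping, at most a. The numerical factors come from
  repeated use of (u + v)^2 \<le> 2 u^2 + 2 v^2.\<close>

lemma ito_increment_approx_aux:
  assumes \<phi>: "simple_proc_ok M F \<phi>" and \<psi>: "simple_proc_ok M F \<psi>" and st: "0 \<le> s" "s \<le> t"
    and I[measurable]: "I \<in> borel_measurable M" "I' \<in> borel_measurable M"
    and Hm: "(\<lambda>p. H (snd p) (fst p)) \<in> borel_measurable (M \<Otimes>\<^sub>M borel)"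
    and Hb: "\<And>r \<omega>. 0 \<le> r \<Longrightarrow> \<omega> \<in> space M \<Longrightarrow> \<bar>H r \<omega>\<bar> \<le> C"
    and a: "(\<integral>\<^sup>+\<omega>. (\<integral>\<^sup>+r\<in>{0..t}. ennreal ((H r \<omega> - simple_proc_val \<phi> r \<omega>)\<^sup>2) \<partial>lborel) \<partial>M) = a"
    and b: "(\<integral>\<^sup>+\<omega>. (\<integral>\<^sup>+r\<in>{0..s}. ennreal ((H r \<omega> - simple_proc_val \<psi> r \<omega>)\<^sup>2) \<partial>lborel) \<partial>M) = b"
    and c: "(\<integral>\<^sup>+\<omega>. ennreal ((I \<omega> - simple_proc_integral B \<phi> t \<omega>)\<^sup>2) \<partial>M) = c"
    and d: "(\<integral>\<^sup>+\<omega>. ennreal ((I' \<omega> - simple_proc_integral B \<psi> s \<omega>)\<^sup>2) \<partial>M) = d"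
  obtains \<tau> \<eta> n where "adapted_partition \<tau> \<eta> C" "\<tau> 0 = s" "\<tau> n = t"
    "(\<integral>\<^sup>+\<omega>. (\<integral>\<^sup>+r\<in>{s..t}. ennreal ((H r \<omega> - step_process \<tau> \<eta> n r \<omega>)\<^sup>2) \<partial>lborel) \<partial>M) \<le> a"
    "(\<integral>\<^sup>+\<omega>. ennreal ((I \<omega> - I' \<omega> - step_integral \<tau> \<eta> n \<omega>)\<^sup>2) \<partial>M)
      \<le> 2 * (2 * c + 2 * d) + 2 * (2 * (2 * a + 2 * b) + 2 * a)"
proof -
  obtain \<tau> \<eta>' n C' where nf: "adapted_partition \<tau> \<eta>' C'" "\<tau> 0 = s" "\<tau> n = t"
    "\<And>r \<omega>. s < r \<Longrightarrow> r \<le> t \<Longrightarrow> simple_proc_val \<phi> r \<omega> = step_process \<tau> \<eta>' n r \<omega>"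
    "\<And>\<omega>. simple_proc_integral B \<phi> t \<omega> - simple_proc_integral B \<phi> s \<omega> = step_integral \<tau> \<eta>' n \<omega>"
    by (rule simple_proc_normal_form[OF \<phi> st], rule that)
  have C: "0 \<le> C" using Hb not_empty by (meson abs_ge_zero all_not_in_conv order_refl order_trans)
  define cl where "cl = clamp_real (- C) C"
  have cl: "cl 0 = 0" "\<bar>cl y\<bar> \<le> C" for y using C by (auto simp: cl_def clamp_real_def)
  \<comment> \<open>\<open>cl y\<close> is the point of [-C, C] nearest to y, and projecting y does
    not increase its distance to a point h of the interval. Hence clipping never moves the
    approximation away from \<open>H\<close>.\<close>
  have cl_dist: "\<bar>y - cl y\<bar> \<le> \<bar>h - y\<bar>" "\<bar>h - cl y\<bar> \<le> \<bar>h - y\<bar>" if "\<bar>h\<bar> \<le> C" for h y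
    using that unfolding cl_def clamp_real_def by linarith+
  have clm[measurable]: "cl \<in> borel_measurable borel" unfolding cl_def clamp_real_def[abs_def] by measurable
  define \<eta> where "\<eta> k \<omega> = cl (\<eta>' k \<omega>)" for k \<omega>
  note D = adapted_partitionD[OF nf(1)]
  have mono: "mono \<tau>" and \<tau>0: "0 \<le> \<tau> 0" using nf(1) by (auto simp: adapted_partition_def)
  have \<eta>m: "\<eta> k \<in> borel_measurable (F (\<tau> k))" for k
    unfolding \<eta>_def[abs_def] using measurable_compose[OF D(4) clm] .
  have ad: "adapted_partition \<tau> \<eta> C"
    using mono \<tau>0 \<eta>m cl(2) by (auto simp: adapted_partition_def \<eta>_def)
  have ad': "adapted_partition \<tau> (\<lambda>k \<omega>. \<eta>' k \<omega> - \<eta> k \<omega>) (C' + C)"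
    unfolding adapted_partition_def
  proof (intro conjI allI ballI mono \<tau>0)
    show "(\<lambda>\<omega>. \<eta>' k \<omega> - \<eta> k \<omega>) \<in> borel_measurable (F (\<tau> k))" for k
      using D(4) \<eta>m by (intro borel_measurable_diff) auto
    show "\<bar>\<eta>' k \<omega> - \<eta> k \<omega>\<bar> \<le> C' + C" if "\<omega> \<in> space M" for k \<omega>
      using D(6)[OF that, of k] cl(2)[of "\<eta>' k \<omega>"] unfolding \<eta>_def by linarith
  qed
  have step: "step_process \<tau> \<eta> n r \<omega> = cl (step_process \<tau> \<eta>' n r \<omega>)" for r \<omega>
    unfolding step_process_apply[where f = cl, OF mono cl(1)] \<eta>_def ..
  have step': "step_process \<tau> (\<lambda>k \<omega>. \<eta>' k \<omega> - \<eta> k \<omega>) n r \<omega> = step_process \<tau> \<eta>' n r \<omega> - cl (step_process \<tau> \<eta>' n r \<omega>)" for r \<omega>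
    by (subst step_process_apply[OF mono, where f = "\<lambda>y. y - cl y"]) (simp_all add: cl \<eta>_def)
  \<comment> \<open>Applied twice: to the error of the clipped process and to the part removed by
    clipping.\<close>
  have le: "(\<integral>\<^sup>+\<omega>. (\<integral>\<^sup>+r\<in>{s..t}. ennreal ((g r \<omega>)\<^sup>2) \<partial>lborel) \<partial>M) \<le> a"
    if g: "\<And>r \<omega>. s < r \<Longrightarrow> r \<le> t \<Longrightarrow> \<omega> \<in> space M \<Longrightarrow> \<bar>g r \<omega>\<bar> \<le> \<bar>H r \<omega> - step_process \<tau> \<eta>' n r \<omega>\<bar>" for g
    unfolding a[symmetric]
  proof (rule nn_integral_mono, rule nn_integral_mono_AE)
    fix \<omega> assume \<omega>: "\<omega> \<in> space M"
    show "AE r in lborel. ennreal ((g r \<omega>)\<^sup>2) * indicator {s..t} r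
        \<le> ennreal ((H r \<omega> - simple_proc_val \<phi> r \<omega>)\<^sup>2) * indicator {0..t} r"
      using AE_lborel_singleton[of s]
    proof eventually_elim
      case (elim r)
      show ?case
      proof (cases "r \<in> {s..t}")
        case True
        then have "(g r \<omega>)\<^sup>2 \<le> (H r \<omega> - simple_proc_val \<phi> r \<omega>)\<^sup>2"
          using g[of r \<omega>] nf(4)[of r \<omega>] elim \<omega> by (simp add: abs_le_square_iff)
        then show ?thesis using True st by (auto simp: ennreal_leI)
      qed simp
    qed
  qed
  obtain \<rho> where \<rho>: "simple_proc_ok M F \<rho>"
    "\<And>r \<omega>. simple_proc_val \<rho> r \<omega> = simple_proc_val \<phi> r \<omega> - simple_proc_val \<psi> r \<omega>"
    "\<And>t \<omega>. simple_proc_integral B \<rho> t \<omega> = simple_proc_integral B \<phi> t \<omega> - simple_proc_integral B \<psi> t \<omega>"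
    by (rule simple_proc_diff[OF \<phi> \<psi>], rule that)
  have e1: "(\<integral>\<^sup>+\<omega>. ennreal ((simple_proc_integral B \<rho> s \<omega>)\<^sup>2) \<partial>M) \<le> 2 * a + 2 * b"
  proof -
    let ?N = "M \<Otimes>\<^sub>M restrict_space lborel {0..s}"
    have m1: "(\<lambda>p. - (H (snd p) (fst p) - simple_proc_val \<phi> (snd p) (fst p))) \<in> borel_measurable (M \<Otimes>\<^sub>M borel)"
      and m2: "(\<lambda>p. H (snd p) (fst p) - simple_proc_val \<psi> (snd p) (fst p)) \<in> borel_measurable (M \<Otimes>\<^sub>M borel)"
      using Hm simple_proc_val_measurable[OF \<phi>] simple_proc_val_measurable[OF \<psi>] by measurable
    have "(\<integral>\<^sup>+\<omega>. ennreal ((simple_proc_integral B \<rho> s \<omega>)\<^sup>2) \<partial>M)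
      = (\<integral>\<^sup>+p. ennreal ((- (H (snd p) (fst p) - simple_proc_val \<phi> (snd p) (fst p))
          + (H (snd p) (fst p) - simple_proc_val \<psi> (snd p) (fst p)))\<^sup>2) \<partial>?N)"
      unfolding simple_proc_isometry[OF \<rho>(1) st(1)]
      by (subst strip_nn_integral(2)[OF borel_measurable_add[OF m1 m2]]) (simp add: \<rho>(2) algebra_simps)
    also have "\<dots> \<le> 2 * a + 2 * b"
    proof (rule nn_integral_square_add)
      show "(\<integral>\<^sup>+p. ennreal ((- (H (snd p) (fst p) - simple_proc_val \<phi> (snd p) (fst p)))\<^sup>2) \<partial>?N) \<le> a"
        unfolding strip_nn_integral(2)[OF m1] unfolding a[symmetric] fst_conv snd_conv power2_minus
        using st by (intro nn_integral_mono) (auto simp: indicator_def)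
      show "(\<integral>\<^sup>+p. ennreal ((H (snd p) (fst p) - simple_proc_val \<psi> (snd p) (fst p))\<^sup>2) \<partial>?N) \<le> b"
        unfolding strip_nn_integral(2)[OF m2] b[symmetric] by simp
    qed (rule strip_measurable[OF m1] strip_measurable[OF m2])+
    finally show ?thesis .
  qed
  have e2: "(\<integral>\<^sup>+\<omega>. ennreal ((step_integral \<tau> (\<lambda>k \<omega>. \<eta>' k \<omega> - \<eta> k \<omega>) n \<omega>)\<^sup>2) \<partial>M) \<le> a"
    unfolding step_isometry_nn[OF ad' nf(2,3)]
    by (rule le) (use Hb st in \<open>auto simp: step' intro!: cl_dist\<close>)
  have [measurable]: "simple_proc_integral B \<phi> t \<in> borel_measurable M" "simple_proc_integral B \<phi> s \<in> borel_measurable M"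
    "simple_proc_integral B \<psi> s \<in> borel_measurable M" "simple_proc_integral B \<rho> s \<in> borel_measurable M"
    "step_integral \<tau> (\<lambda>k \<omega>. \<eta>' k \<omega> - \<eta> k \<omega>) n \<in> borel_measurable M"
    using simple_proc_integral_measurable \<phi> \<psi> \<rho>(1) st step_integral_measurable_M[OF ad'] by auto
  show thesis
  proof (rule that[OF ad nf(2,3)])
    show "(\<integral>\<^sup>+\<omega>. (\<integral>\<^sup>+r\<in>{s..t}. ennreal ((H r \<omega> - step_process \<tau> \<eta> n r \<omega>)\<^sup>2) \<partial>lborel) \<partial>M) \<le> a"
      by (rule le) (use Hb st in \<open>auto simp: step intro!: cl_dist\<close>)
    have eq: "I \<omega> - I' \<omega> - step_integral \<tau> \<eta> n \<omega> =
      ((I \<omega> - simple_proc_integral B \<phi> t \<omega>) + - (I' \<omega> - simple_proc_integral B \<psi> s \<omega>))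
      + (simple_proc_integral B \<rho> s \<omega> + step_integral \<tau> (\<lambda>k \<omega>. \<eta>' k \<omega> - \<eta> k \<omega>) n \<omega>)" for \<omega>
    proof -
      have "step_integral \<tau> (\<lambda>k \<omega>. \<eta>' k \<omega> - \<eta> k \<omega>) n \<omega> = step_integral \<tau> \<eta>' n \<omega> - step_integral \<tau> \<eta> n \<omega>"
        unfolding step_integral_def by (simp add: sum_subtractf left_diff_distrib)
      then show ?thesis using nf(5)[of \<omega>] \<rho>(3)[of s \<omega>] by linarith
    qed
    have e3: "(\<integral>\<^sup>+\<omega>. ennreal (((I \<omega> - simple_proc_integral B \<phi> t \<omega>) + - (I' \<omega> - simple_proc_integral B \<psi> s \<omega>))\<^sup>2) \<partial>M)
      \<le> 2 * c + 2 * d"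
      by (rule nn_integral_square_add) (measurable, simp_all only: power2_minus c d order_refl)
    have e4: "(\<integral>\<^sup>+\<omega>. ennreal ((simple_proc_integral B \<rho> s \<omega> + step_integral \<tau> (\<lambda>k \<omega>. \<eta>' k \<omega> - \<eta> k \<omega>) n \<omega>)\<^sup>2) \<partial>M)
      \<le> 2 * (2 * a + 2 * b) + 2 * a"
      by (rule nn_integral_square_add[OF _ _ e1 e2]) measurable
    show "(\<integral>\<^sup>+\<omega>. ennreal ((I \<omega> - I' \<omega> - step_integral \<tau> \<eta> n \<omega>)\<^sup>2) \<partial>M)
      \<le> 2 * (2 * c + 2 * d) + 2 * (2 * (2 * a + 2 * b) + 2 * a)"
      unfolding eq by (rule nn_integral_square_add[OF _ _ e3 e4]) measurable
  qed
qed

text \<open>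
  \<open>I\<close> and \<open>I'\<close> come with unrelated approximating sequences; the isometry makes them interchangeable on
  \<open>[0, s]\<close>. The approximations are clipped to \<open>[-C, C]\<close> because the fourth moment of the limit is
  controlled by a uniform bound on the integrands.
\<close>
lemma ito_increment_approx:
  assumes It: "has_ito_integral M F B H t I" and Is: "has_ito_integral M F B H s I'"
    and st: "0 \<le> s" "s \<le> t"
    and Hm: "(\<lambda>p. H (snd p) (fst p)) \<in> borel_measurable (M \<Otimes>\<^sub>M borel)"
    and Hb: "\<And>r \<omega>. 0 \<le> r \<Longrightarrow> \<omega> \<in> space M \<Longrightarrow> \<bar>H r \<omega>\<bar> \<le> C"
  obtains \<tau> \<eta> n where "\<And>m::nat. adapted_partition (\<tau> m) (\<eta> m) C" "\<And>m. \<tau> m 0 = s" "\<And>m. \<tau> m (n m) = t"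
    "(\<lambda>m. \<integral>\<^sup>+\<omega>. (\<integral>\<^sup>+r\<in>{s..t}. ennreal ((H r \<omega> - step_process (\<tau> m) (\<eta> m) (n m) r \<omega>)\<^sup>2) \<partial>lborel) \<partial>M) \<longlonglongrightarrow> 0"
    "(\<lambda>m. \<integral>\<^sup>+\<omega>. ennreal ((I \<omega> - I' \<omega> - step_integral (\<tau> m) (\<eta> m) (n m) \<omega>)\<^sup>2) \<partial>M) \<longlonglongrightarrow> 0"
proof -
  define a where "a \<phi> = (\<integral>\<^sup>+\<omega>. (\<integral>\<^sup>+r\<in>{0..t}. ennreal ((H r \<omega> - simple_proc_val \<phi> r \<omega>)\<^sup>2) \<partial>lborel) \<partial>M)" for \<phi>
  define b where "b \<psi> = (\<integral>\<^sup>+\<omega>. (\<integral>\<^sup>+r\<in>{0..s}. ennreal ((H r \<omega> - simple_proc_val \<psi> r \<omega>)\<^sup>2) \<partial>lborel) \<partial>M)" for \<psi>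
  define c where "c \<phi> = (\<integral>\<^sup>+\<omega>. ennreal ((I \<omega> - simple_proc_integral B \<phi> t \<omega>)\<^sup>2) \<partial>M)" for \<phi>
  define d where "d \<psi> = (\<integral>\<^sup>+\<omega>. ennreal ((I' \<omega> - simple_proc_integral B \<psi> s \<omega>)\<^sup>2) \<partial>M)" for \<psi>
  obtain \<phi> where \<phi>: "\<And>m::nat. simple_proc_ok M F (\<phi> m)" "(\<lambda>m. a (\<phi> m)) \<longlonglongrightarrow> 0" "(\<lambda>m. c (\<phi> m)) \<longlonglongrightarrow> 0"
    using It unfolding has_ito_integral_def a_def c_def by blast
  obtain \<psi> where \<psi>: "\<And>m::nat. simple_proc_ok M F (\<psi> m)" "(\<lambda>m. b (\<psi> m)) \<longlonglongrightarrow> 0" "(\<lambda>m. d (\<psi> m)) \<longlonglongrightarrow> 0"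
    using Is unfolding has_ito_integral_def b_def d_def by blast
  have I: "I \<in> borel_measurable M" "I' \<in> borel_measurable M" using It Is by (auto simp: has_ito_integral_def)
  let ?A = "\<lambda>\<tau> \<eta> n. \<integral>\<^sup>+\<omega>. (\<integral>\<^sup>+r\<in>{s..t}. ennreal ((H r \<omega> - step_process \<tau> \<eta> n r \<omega>)\<^sup>2) \<partial>lborel) \<partial>M"
  let ?B = "\<lambda>\<tau> \<eta> n. \<integral>\<^sup>+\<omega>. ennreal ((I \<omega> - I' \<omega> - step_integral \<tau> \<eta> n \<omega>)\<^sup>2) \<partial>M"
  let ?b = "\<lambda>m. 2 * (2 * c (\<phi> m) + 2 * d (\<psi> m)) + 2 * (2 * (2 * a (\<phi> m) + 2 * b (\<psi> m)) + 2 * a (\<phi> m))"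
  \<comment> \<open>The triple (\<tau>, \<eta>, n) is packed into a single \<open>p\<close> so that
    one application of choice yields all three sequences.\<close>
  have "\<forall>m. \<exists>p. adapted_partition (fst p) (fst (snd p)) C \<and> fst p 0 = s \<and> fst p (snd (snd p)) = t \<and>
      ?A (fst p) (fst (snd p)) (snd (snd p)) \<le> a (\<phi> m) \<and> ?B (fst p) (fst (snd p)) (snd (snd p)) \<le> ?b m"
  proof
    fix m
    obtain \<tau> \<eta> n where *: "adapted_partition \<tau> \<eta> C" "\<tau> 0 = s" "\<tau> n = t" "?A \<tau> \<eta> n \<le> a (\<phi> m)" "?B \<tau> \<eta> n \<le> ?b m"
      by (rule ito_increment_approx_aux[OF \<phi>(1) \<psi>(1) st I Hm Hb a_def[symmetric] b_def[symmetric] c_def[symmetric] d_def[symmetric]],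
          assumption, assumption, rule that)
    show "\<exists>p. adapted_partition (fst p) (fst (snd p)) C \<and> fst p 0 = s \<and> fst p (snd (snd p)) = t \<and>
      ?A (fst p) (fst (snd p)) (snd (snd p)) \<le> a (\<phi> m) \<and> ?B (fst p) (fst (snd p)) (snd (snd p)) \<le> ?b m"
      by (rule exI[of _ "(\<tau>, \<eta>, n)"], simp only: fst_conv snd_conv, intro conjI, (rule *)+)
  qed
  from choice[OF this] obtain p where p: "\<And>m. adapted_partition (fst (p m)) (fst (snd (p m))) C"
    "\<And>m. fst (p m) 0 = s" "\<And>m. fst (p m) (snd (snd (p m))) = t"
    "\<And>m. ?A (fst (p m)) (fst (snd (p m))) (snd (snd (p m))) \<le> a (\<phi> m)"
    "\<And>m. ?B (fst (p m)) (fst (snd (p m))) (snd (snd (p m))) \<le> ?b m" by blast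
  have c2: "(\<lambda>m. 2 * u m) \<longlonglongrightarrow> 0" if "u \<longlonglongrightarrow> 0" for u :: "nat \<Rightarrow> ennreal"
    using ennreal_tendsto_cmult[OF _ that, of 2] by (simp add: less_top[symmetric])
  have ad: "(\<lambda>m. u m + v m) \<longlonglongrightarrow> 0" if "u \<longlonglongrightarrow> 0" "v \<longlonglongrightarrow> 0" for u v :: "nat \<Rightarrow> ennreal"
    using tendsto_add[OF that] by simp
  have "?b \<longlonglongrightarrow> 0" by (intro c2 ad \<phi> \<psi>)
  then have B0: "(\<lambda>m. ?B (fst (p m)) (fst (snd (p m))) (snd (snd (p m)))) \<longlonglongrightarrow> 0"
    by (rule tendsto_sandwich[OF _ _ tendsto_const, rotated 2]) (use p(5) in auto)
  have A0: "(\<lambda>m. ?A (fst (p m)) (fst (snd (p m))) (snd (snd (p m)))) \<longlonglongrightarrow> 0"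
    by (rule tendsto_sandwich[OF _ _ tendsto_const \<phi>(2)]) (use p(4) in auto)
  show thesis by (rule that[OF p(1-3) A0 B0])
qed

text \<open>Moments one and two are equalities preserved by L2 convergence; the weight
  \<open>\<zeta>\<close> makes them statements conditional on \<open>F s\<close>. The fourth moment
  only needs an upper bound and comes from Fatou's lemma, which asks for an estimate uniform along
  the approximation; for this the approximations share the bound \<open>C\<close>.\<close>

lemma ito_increment_moments:
  assumes It: "has_ito_integral M F B H t I" and Is: "has_ito_integral M F B H s I'"
    and st: "0 \<le> s" "s \<le> t"
    and Hm[measurable]: "(\<lambda>p. H (snd p) (fst p)) \<in> borel_measurable (M \<Otimes>\<^sub>M borel)"
    and Hb: "\<And>r \<omega>. 0 \<le> r \<Longrightarrow> \<omega> \<in> space M \<Longrightarrow> \<bar>H r \<omega>\<bar> \<le> C"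
    and \<zeta>: "\<zeta> \<in> borel_measurable (F s)" and Z: "\<And>\<omega>. \<omega> \<in> space M \<Longrightarrow> \<bar>\<zeta> \<omega>\<bar> \<le> Z"
  shows "integrable M (\<lambda>\<omega>. (I \<omega> - I' \<omega>) ^ 4)"
    and "(\<integral>\<omega>. (I \<omega> - I' \<omega>) ^ 4 \<partial>M) \<le> 3 * C ^ 4 * (t - s)\<^sup>2"
    and "(\<integral>\<omega>. \<zeta> \<omega> * (I \<omega> - I' \<omega>) \<partial>M) = 0"
    and "(\<integral>\<omega>. \<zeta> \<omega> * (I \<omega> - I' \<omega>)\<^sup>2 \<partial>M) = (LBINT r:{s..t}. (\<integral>\<omega>. \<zeta> \<omega> * (H r \<omega>)\<^sup>2 \<partial>M))"
proof -
  let ?R = "restrict_space lborel {s..t}" and ?N = "M \<Otimes>\<^sub>M restrict_space lborel {s..t}"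
  let ?D = "\<lambda>\<omega>. I \<omega> - I' \<omega>"
  obtain \<tau> \<eta> n where ad: "\<And>m::nat. adapted_partition (\<tau> m) (\<eta> m) C" and \<tau>: "\<And>m. \<tau> m 0 = s" "\<And>m. \<tau> m (n m) = t"
    and A: "(\<lambda>m. \<integral>\<^sup>+\<omega>. (\<integral>\<^sup>+r\<in>{s..t}. ennreal ((H r \<omega> - step_process (\<tau> m) (\<eta> m) (n m) r \<omega>)\<^sup>2) \<partial>lborel) \<partial>M) \<longlonglongrightarrow> 0"
    and B: "(\<lambda>m. \<integral>\<^sup>+\<omega>. ennreal ((I \<omega> - I' \<omega> - step_integral (\<tau> m) (\<eta> m) (n m) \<omega>)\<^sup>2) \<partial>M) \<longlonglongrightarrow> 0"
    by (rule ito_increment_approx[OF It Is st Hm Hb], assumption, assumption, rule that)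
  let ?S = "\<lambda>m. step_integral (\<tau> m) (\<eta> m) (n m)"
  let ?E = "\<lambda>m p. step_process (\<tau> m) (\<eta> m) (n m) (snd p) (fst p)"
  have [measurable]: "I \<in> borel_measurable M" "I' \<in> borel_measurable M"
    using It Is by (auto simp: has_ito_integral_def)
  have Sm[measurable]: "?S m \<in> borel_measurable M" for m using step_integral_measurable_M[OF ad] .
  have zM[measurable]: "\<zeta> \<in> borel_measurable M" using measurable_F_M[OF \<zeta> st(1)] .
  have S4: "integrable M (\<lambda>\<omega>. ?S m \<omega> ^ 4)" "(\<integral>\<omega>. ?S m \<omega> ^ 4 \<partial>M) \<le> 3 * C ^ 4 * (t - s)\<^sup>2" for m
    using step_integral_moment4[OF ad, of m "n m"] \<tau> by auto
  have S2: "integrable M (\<lambda>\<omega>. (?S m \<omega>)\<^sup>2)" for m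
    using integrable_mult_power[OF Sm _ S4(1), of "\<lambda>_. 1" 1 2] by simp
  have Dm: "?D \<in> borel_measurable M" by measurable
  note LM = L2_tendsto_integrals[OF Dm Sm S2 B zM Z]
  have iso: "(\<integral>\<omega>. \<zeta> \<omega> * ?S m \<omega> \<partial>M) = 0"
    "(\<integral>\<omega>. \<zeta> \<omega> * (?S m \<omega>)\<^sup>2 \<partial>M)
      = (\<Sum>k<n m. (\<integral>\<omega>. \<zeta> \<omega> * (\<eta> m k \<omega>)\<^sup>2 \<partial>M) * (\<tau> m (Suc k) - \<tau> m k))" for m
    using step_integral_isometry[OF ad[of m], of \<zeta> Z "n m"] \<zeta> Z \<tau> by auto
  show "(\<integral>\<omega>. \<zeta> \<omega> * ?D \<omega> \<partial>M) = 0"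
    using LIMSEQ_unique[OF LM(1)] unfolding iso by simp
  show I4: "integrable M (\<lambda>\<omega>. ?D \<omega> ^ 4)" and "(\<integral>\<omega>. ?D \<omega> ^ 4 \<partial>M) \<le> 3 * C ^ 4 * (t - s)\<^sup>2"
  proof -
    \<comment> \<open>L2 convergence gives L1 convergence, hence almost sure convergence along a
      subsequence, as Fatou's lemma requires.\<close>
    obtain r where r: "AE \<omega> in M. (\<lambda>m. ?D \<omega> - ?S (r m) \<omega>) \<longlonglongrightarrow> 0"
      using tendsto_L1_AE_subseq[of M "\<lambda>m \<omega>. ?D \<omega> - ?S m \<omega>"] LM(3,5) by auto
    have "(\<integral>\<^sup>+\<omega>. ennreal (?D \<omega> ^ 4) \<partial>M) = (\<integral>\<^sup>+\<omega>. liminf (\<lambda>m. ennreal (?S (r m) \<omega> ^ 4)) \<partial>M)"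
    proof (rule nn_integral_cong_AE)
      show "AE \<omega> in M. ennreal (?D \<omega> ^ 4) = liminf (\<lambda>m. ennreal (?S (r m) \<omega> ^ 4))"
        using r
      proof eventually_elim
        case (elim \<omega>)
        have "(\<lambda>m. ?D \<omega> - (?D \<omega> - ?S (r m) \<omega>)) \<longlonglongrightarrow> ?D \<omega> - 0"
          by (intro tendsto_diff tendsto_const elim)
        then have "(\<lambda>m. ?S (r m) \<omega>) \<longlonglongrightarrow> ?D \<omega>" by simp
        then have "(\<lambda>m. ennreal (?S (r m) \<omega> ^ 4)) \<longlonglongrightarrow> ennreal (?D \<omega> ^ 4)"
          by (intro tendsto_ennrealI tendsto_power)
        then show ?case by (rule lim_imp_Liminf[OF sequentially_bot, symmetric])
      qed
    qed
    also have "\<dots> \<le> liminf (\<lambda>m. \<integral>\<^sup>+\<omega>. ennreal (?S (r m) \<omega> ^ 4) \<partial>M)"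
      by (rule nn_integral_liminf) measurable
    also have "\<dots> \<le> liminf (\<lambda>m. ennreal (3 * C ^ 4 * (t - s)\<^sup>2))"
      by (intro Liminf_mono always_eventually allI) (simp add: nn_integral_eq_integral S4 ennreal_leI)
    also have "\<dots> = ennreal (3 * C ^ 4 * (t - s)\<^sup>2)" by (simp add: Liminf_const)
    finally have le: "(\<integral>\<^sup>+\<omega>. ennreal (?D \<omega> ^ 4) \<partial>M) \<le> ennreal (3 * C ^ 4 * (t - s)\<^sup>2)" .
    then show i: "integrable M (\<lambda>\<omega>. ?D \<omega> ^ 4)"
      by (intro integrableI_nonneg) (auto intro: le_less_trans)
    show "(\<integral>\<omega>. ?D \<omega> ^ 4 \<partial>M) \<le> 3 * C ^ 4 * (t - s)\<^sup>2"
      using le by (subst (asm) nn_integral_eq_integral[OF i]) auto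
  qed
  interpret R: finite_measure ?R
    by (rule finite_measureI) (auto simp: emeasure_restrict_space space_restrict_space emeasure_lborel_Icc_eq)
  interpret N: finite_measure ?N by (rule strip_nn_integral(3)[OF Hm])
  interpret P: pair_sigma_finite M ?R ..
  have spN: "fst p \<in> space M" "snd p \<in> {s..t}" if "p \<in> space ?N" for p
    using that by (auto simp: space_pair_measure space_restrict_space)
  have Em: "?E m \<in> borel_measurable (M \<Otimes>\<^sub>M borel)" for m by (rule step_process_measurable[OF ad])
  have mN: "(\<lambda>p. H (snd p) (fst p)) \<in> borel_measurable ?N" "?E m \<in> borel_measurable ?N" for m
    by (rule strip_measurable[OF Hm], rule strip_measurable[OF Em])
  \<comment> \<open>Bounds on the values alone do not bound a sum of them. Clipping fixes every
    value, hence by \<open>step_process_apply\<close> the whole process.\<close>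
  have Eb: "\<bar>step_process (\<tau> m) (\<eta> m) (n m) r \<omega>\<bar> \<le> C" if "\<omega> \<in> space M" for m r \<omega>
  proof -
    have mono: "mono (\<tau> m)" using ad by (auto simp: adapted_partition_def)
    have "clamp_real (- C) C (step_process (\<tau> m) (\<eta> m) (n m) r \<omega>)
        = step_process (\<tau> m) (\<lambda>k \<omega>. clamp_real (- C) C (\<eta> m k \<omega>)) (n m) r \<omega>"
      by (rule step_process_apply[OF mono]) (use adapted_partitionD(7)[OF ad] in \<open>auto simp: clamp_real_def\<close>)
    also have "\<dots> = step_process (\<tau> m) (\<eta> m) (n m) r \<omega>"
      unfolding step_process_def
    proof (intro sum.cong refl arg_cong2[where f = "(*)"])
      fix k show "clamp_real (- C) C (\<eta> m k \<omega>) = \<eta> m k \<omega>"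
        using adapted_partitionD(6)[OF ad that, of m k] unfolding clamp_real_def by linarith
    qed
    finally show ?thesis using adapted_partitionD(7)[OF ad] unfolding clamp_real_def by linarith
  qed
  have sqle: "\<bar>y\<^sup>2\<bar> \<le> C\<^sup>2" if "\<bar>y\<bar> \<le> C" for y :: real
    using power_mono[OF that, of 2] by simp
  have E2: "integrable ?N (\<lambda>p. (?E m p)\<^sup>2)" for m
    by (rule N.integrable_const_bound[of _ "C\<^sup>2"]) (use mN Eb spN sqle in \<open>auto intro!: AE_I2\<close>)
  have AN: "(\<lambda>m. \<integral>\<^sup>+p. ennreal ((H (snd p) (fst p) - ?E m p)\<^sup>2) \<partial>?N) \<longlonglongrightarrow> 0"
    using A by (subst strip_nn_integral(2)) (use Hm Em in \<open>auto intro!: borel_measurable_diff\<close>)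
  have zN: "(\<lambda>p. \<zeta> (fst p)) \<in> borel_measurable ?N" by measurable
  have lim: "(\<lambda>m. \<integral>p. \<zeta> (fst p) * (?E m p)\<^sup>2 \<partial>?N) \<longlonglongrightarrow> (\<integral>p. \<zeta> (fst p) * (H (snd p) (fst p))\<^sup>2 \<partial>?N)"
    by (rule N.L2_tendsto_integrals(2)[OF mN E2 AN zN]) (use Z spN in auto)
  have intN: "integrable ?N (\<lambda>p. \<zeta> (fst p) * (G p)\<^sup>2)"
    if "G \<in> borel_measurable ?N" "\<And>p. p \<in> space ?N \<Longrightarrow> \<bar>G p\<bar> \<le> C" for G
  proof (rule N.integrable_const_bound[of _ "Z * C\<^sup>2"])
    show "AE p in ?N. norm (\<zeta> (fst p) * (G p)\<^sup>2) \<le> Z * C\<^sup>2"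
    proof (rule AE_I2)
      fix p assume p: "p \<in> space ?N"
      have "0 \<le> Z" using Z[OF spN(1)[OF p]] by linarith
      then show "norm (\<zeta> (fst p) * (G p)\<^sup>2) \<le> Z * C\<^sup>2"
        unfolding real_norm_def abs_mult using Z[OF spN(1)[OF p]] sqle[OF that(2)[OF p]] by (intro mult_mono) auto
    qed
  qed (use that zN in measurable)
  have fub: "(\<integral>p. \<zeta> (fst p) * (G p)\<^sup>2 \<partial>?N) = (LBINT r:{s..t}. (\<integral>\<omega>. \<zeta> \<omega> * (G (\<omega>, r))\<^sup>2 \<partial>M))"
    if "G \<in> borel_measurable ?N" "\<And>p. p \<in> space ?N \<Longrightarrow> \<bar>G p\<bar> \<le> C" for G
  proof -
    have e: "(\<lambda>(\<omega>, r). \<zeta> \<omega> * (G (\<omega>, r))\<^sup>2) = (\<lambda>p. \<zeta> (fst p) * (G p)\<^sup>2)" by (auto simp: fun_eq_iff)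
    show ?thesis
      using P.integral_snd[of "\<lambda>\<omega> r. \<zeta> \<omega> * (G (\<omega>, r))\<^sup>2", unfolded e, OF intN[OF that]]
      by (simp add: integral_restrict_space set_lebesgue_integral_def)
  qed
  \<comment> \<open>Exchanging the time integral with the finite sum over cells gives the right side
    of the isometry \<open>iso\<close>.\<close>
  have step: "(\<integral>p. \<zeta> (fst p) * (?E m p)\<^sup>2 \<partial>?N) = (\<integral>\<omega>. \<zeta> \<omega> * (?S m \<omega>)\<^sup>2 \<partial>M)" for m
  proof -
    have mono: "mono (\<tau> m)" using ad by (auto simp: adapted_partition_def)
    have sub: "{\<tau> m k<..\<tau> m (Suc k)} \<subseteq> {s..t}" if "k < n m" for k
      using monoD[OF mono, of 0 k] monoD[OF mono, of "Suc k" "n m"] \<tau> that by auto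
    have zi: "integrable M (\<lambda>\<omega>. \<zeta> \<omega> * (\<eta> m k \<omega>)\<^sup>2)" for k
    proof (rule integrable_const_bound[of _ "Z * C\<^sup>2"])
      show "AE \<omega> in M. norm (\<zeta> \<omega> * (\<eta> m k \<omega>)\<^sup>2) \<le> Z * C\<^sup>2"
      proof (rule AE_I2)
        fix \<omega> assume w: "\<omega> \<in> space M"
        have "0 \<le> Z" using Z[OF w] by linarith
        then show "norm (\<zeta> \<omega> * (\<eta> m k \<omega>)\<^sup>2) \<le> Z * C\<^sup>2"
          unfolding real_norm_def abs_mult using Z[OF w] sqle[OF adapted_partitionD(6)[OF ad w]] by (intro mult_mono) auto
      qed
    qed (use adapted_partitionD(5)[OF ad] in measurable)
    have "(\<integral>\<omega>. \<zeta> \<omega> * (step_process (\<tau> m) (\<eta> m) (n m) r \<omega>)\<^sup>2 \<partial>M)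
      = (\<Sum>k<n m. (\<integral>\<omega>. \<zeta> \<omega> * (\<eta> m k \<omega>)\<^sup>2 \<partial>M) * indicator {\<tau> m k<..\<tau> m (Suc k)} r)" for r
    proof -
      have "\<zeta> \<omega> * (step_process (\<tau> m) (\<eta> m) (n m) r \<omega>)\<^sup>2
        = (\<Sum>k<n m. \<zeta> \<omega> * (\<eta> m k \<omega>)\<^sup>2 * indicator {\<tau> m k<..\<tau> m (Suc k)} r)" for \<omega>
        unfolding step_process_apply[of "\<tau> m" "\<lambda>x. x\<^sup>2", OF mono zero_power2]
        unfolding step_process_def sum_distrib_left by (simp only: mult.assoc)
      then show ?thesis using zi by simp
    qed
    then have "(\<integral>p. \<zeta> (fst p) * (?E m p)\<^sup>2 \<partial>?N)
      = (LBINT r:{s..t}. (\<Sum>k<n m. (\<integral>\<omega>. \<zeta> \<omega> * (\<eta> m k \<omega>)\<^sup>2 \<partial>M) * indicator {\<tau> m k<..\<tau> m (Suc k)} r))"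
      using fub[OF mN(2)] Eb spN by simp
    also have "\<dots> = (LBINT r. (\<Sum>k<n m. (\<integral>\<omega>. \<zeta> \<omega> * (\<eta> m k \<omega>)\<^sup>2 \<partial>M) * indicator {\<tau> m k<..\<tau> m (Suc k)} r))"
      unfolding set_lebesgue_integral_def
    proof (rule Bochner_Integration.integral_cong[OF refl])
      fix r show "indicator {s..t} r *\<^sub>R (\<Sum>k<n m. (\<integral>\<omega>. \<zeta> \<omega> * (\<eta> m k \<omega>)\<^sup>2 \<partial>M) * indicator {\<tau> m k<..\<tau> m (Suc k)} r)
        = (\<Sum>k<n m. (\<integral>\<omega>. \<zeta> \<omega> * (\<eta> m k \<omega>)\<^sup>2 \<partial>M) * indicator {\<tau> m k<..\<tau> m (Suc k)} r)"
        unfolding scaleR_sum_right using sub by (intro sum.cong refl) (force simp: indicator_def)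
    qed
    also have "\<dots> = (\<Sum>k<n m. (\<integral>\<omega>. \<zeta> \<omega> * (\<eta> m k \<omega>)\<^sup>2 \<partial>M) * (\<tau> m (Suc k) - \<tau> m k))"
      using adapted_partitionD(1)[OF ad, of m]
      by (subst Bochner_Integration.integral_sum)
        (auto intro!: integrable_mult_right integrable_real_indicator)
    finally show ?thesis unfolding iso .
  qed
  have "(\<integral>\<omega>. \<zeta> \<omega> * (?D \<omega>)\<^sup>2 \<partial>M) = (\<integral>p. \<zeta> (fst p) * (H (snd p) (fst p))\<^sup>2 \<partial>?N)"
    by (rule LIMSEQ_unique[OF LM(2) lim[unfolded step]])
  also have "\<dots> = (LBINT r:{s..t}. (\<integral>\<omega>. \<zeta> \<omega> * (H (snd (\<omega>, r)) (fst (\<omega>, r)))\<^sup>2 \<partial>M))"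
  proof (rule fub[OF mN(1)])
    fix p assume "p \<in> space ?N"
    then show "\<bar>H (snd p) (fst p)\<bar> \<le> C" using spN[of p] st by (intro Hb) auto
  qed
  finally show "(\<integral>\<omega>. \<zeta> \<omega> * (?D \<omega>)\<^sup>2 \<partial>M) = (LBINT r:{s..t}. (\<integral>\<omega>. \<zeta> \<omega> * (H r \<omega>)\<^sup>2 \<partial>M))"
    by (simp only: fst_conv snd_conv)
qed

end

section \<open>Solutions with bounded coefficients\<close>

text \<open>Rounding the time down to the grid of mesh 1/(n+1) leaves countably many sections, and
  continuity of the paths gives the limit. The \<sigma>-algebra \<open>G\<close> is arbitrary
  because the result is applied both to \<open>M\<close> and to the \<sigma>-algebra generated by
  the path.\<close>

lemma continuous_process_jointly_measurable:
  fixes X :: "real \<Rightarrow> 'b \<Rightarrow> real"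
  assumes X: "\<And>t. 0 \<le> t \<Longrightarrow> X t \<in> borel_measurable G"
    and cont: "\<And>\<omega>. \<omega> \<in> space G \<Longrightarrow> continuous_on {0..} (\<lambda>t. X t \<omega>)"
  shows "(\<lambda>p. X (max 0 (snd p)) (fst p)) \<in> borel_measurable (G \<Otimes>\<^sub>M borel)"
proof (rule borel_measurable_LIMSEQ_real)
  let ?a = "\<lambda>n p. real (nat \<lfloor>max 0 (snd p) * real (Suc n)\<rfloor>) / real (Suc n)"
  fix p assume p: "p \<in> space (G \<Otimes>\<^sub>M (borel :: real measure))"
  let ?r = "max 0 (snd p)"
  have b: "?r - 1 / real (Suc n) \<le> ?a n p" "?a n p \<le> ?r" for n
  proof -
    have nn: "0 \<le> \<lfloor>?r * real (Suc n)\<rfloor>" by simp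
    have e: "?a n p = of_int \<lfloor>?r * real (Suc n)\<rfloor> / real (Suc n)" using nn by (simp only: of_nat_nat)
    have "of_int \<lfloor>?r * real (Suc n)\<rfloor> \<le> ?r * real (Suc n)" by (rule of_int_floor_le)
    then show "?a n p \<le> ?r" unfolding e by (subst pos_divide_le_eq) auto
    have "?r * real (Suc n) - 1 \<le> of_int \<lfloor>?r * real (Suc n)\<rfloor>" by linarith
    then have "(?r * real (Suc n) - 1) / real (Suc n) \<le> ?a n p" unfolding e by (intro divide_right_mono) auto
    then show "?r - 1 / real (Suc n) \<le> ?a n p" by (simp add: diff_divide_distrib)
  qed
  have "(\<lambda>n. ?r - 1 / real (Suc n)) \<longlonglongrightarrow> ?r - 0"
    by (intro tendsto_diff tendsto_const lim_inverse_n'[THEN LIMSEQ_Suc])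
  then have "(\<lambda>n. ?r - 1 / real (Suc n)) \<longlonglongrightarrow> ?r" by (simp only: diff_zero)
  then have lim: "(\<lambda>n. ?a n p) \<longlonglongrightarrow> ?r"
    by (rule tendsto_sandwich[OF always_eventually always_eventually _ tendsto_const, OF allI allI, rotated 2])
      (rule b)+
  show "(\<lambda>n. X (?a n p) (fst p)) \<longlonglongrightarrow> X ?r (fst p)"
  proof (rule continuous_on_tendsto_compose[OF _ lim])
    show "continuous_on {0..} (\<lambda>t. X t (fst p))" using p by (intro cont) (auto simp: space_pair_measure)
    show "\<forall>\<^sub>F n in sequentially. ?a n p \<in> {0..}" by (rule always_eventually) simp
  qed simp
next
  fix n
  show "(\<lambda>p. X (real (nat \<lfloor>max 0 (snd p) * real (Suc n)\<rfloor>) / real (Suc n)) (fst p)) \<in> borel_measurable (G \<Otimes>\<^sub>M borel)"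
  proof (rule measurable_compose_countable[of "\<lambda>i p. X (real i / real (Suc n)) (fst p)"])
    fix i :: nat
    have [measurable]: "X (real i / real (Suc n)) \<in> borel_measurable G" by (rule X) simp
    show "(\<lambda>p. X (real i / real (Suc n)) (fst p)) \<in> borel_measurable (G \<Otimes>\<^sub>M borel)" by measurable
    show "(\<lambda>p. nat \<lfloor>max 0 (snd p) * real (Suc n)\<rfloor>) \<in> G \<Otimes>\<^sub>M borel \<rightarrow>\<^sub>M count_space UNIV" by measurable
  qed
qed

lemma bounded_set_integrable_Icc:
  fixes g :: "real \<Rightarrow> real"
  assumes "g \<in> borel_measurable borel" "\<And>r. \<bar>g r\<bar> \<le> K"
  shows "set_integrable lborel {s..t} g"
  unfolding set_integrable_def using assms
  by (intro integrableI_bounded_set_indicator[where B = K]) (auto simp: emeasure_lborel_Icc_eq)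

lemma set_integral_Icc_combine:
  fixes g :: "real \<Rightarrow> real"
  assumes "g \<in> borel_measurable borel" "\<And>r. \<bar>g r\<bar> \<le> K" and st: "u \<le> s" "s \<le> t"
  shows "(LBINT r:{u..t}. g r) = (LBINT r:{u..s}. g r) + (LBINT r:{s..t}. g r)"
proof -
  have "(LBINT r:{u..t}. g r) = (LBINT r:{u..s} \<union> {s..t}. g r)"
    using st by (simp add: ivl_disj_un_two_touch)
  also have "\<dots> = (LBINT r:{u..s}. g r) + (LBINT r:{s..t}. g r)"
  proof (rule set_integral_Un_AE)
    show "AE r in lborel. \<not> (r \<in> {u..s} \<and> r \<in> {s..t})"
      using AE_lborel_singleton[of s] by eventually_elim auto
  qed (use assms in \<open>auto intro!: bounded_set_integrable_Icc\<close>)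
  finally show ?thesis .
qed

lemma (in prob_space) Fubini_strip:
  fixes G :: "'a \<times> real \<Rightarrow> real"
  assumes G[measurable]: "G \<in> borel_measurable (M \<Otimes>\<^sub>M borel)" and K: "\<And>\<omega> r. \<omega> \<in> space M \<Longrightarrow> \<bar>G (\<omega>, r)\<bar> \<le> K"
  shows "(\<lambda>r. \<integral>\<omega>. G (\<omega>, r) \<partial>M) \<in> borel_measurable borel"
    and "(\<integral>\<omega>. (LBINT r:{s..t}. G (\<omega>, r)) \<partial>M) = (LBINT r:{s..t}. (\<integral>\<omega>. G (\<omega>, r) \<partial>M))"
    and "(\<lambda>\<omega>. LBINT r:{s..t}. G (\<omega>, r)) \<in> borel_measurable M"
proof -
  have [measurable]: "(\<lambda>(r, \<omega>). G (\<omega>, r)) \<in> borel_measurable (borel \<Otimes>\<^sub>M M)"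
    using measurable_compose[OF measurable_pair_swap' G] by (simp add: split_beta)
  show "(\<lambda>r. \<integral>\<omega>. G (\<omega>, r) \<partial>M) \<in> borel_measurable borel" by measurable
  show "(\<lambda>\<omega>. LBINT r:{s..t}. G (\<omega>, r)) \<in> borel_measurable M"
    unfolding set_lebesgue_integral_def by measurable
  let ?R = "restrict_space lborel {s..t}"
  interpret R: finite_measure ?R
    by (rule finite_measureI) (auto simp: emeasure_restrict_space space_restrict_space emeasure_lborel_Icc_eq)
  interpret N: finite_measure "M \<Otimes>\<^sub>M ?R" by (rule strip_nn_integral(3)[OF G])
  interpret P: pair_sigma_finite M ?R ..
  have "integrable (M \<Otimes>\<^sub>M ?R) (\<lambda>(\<omega>, r). G (\<omega>, r))"
    by (rule N.integrable_const_bound[of _ K])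
      (use strip_measurable[OF G] K in \<open>auto intro!: AE_I2 simp: space_pair_measure\<close>)
  from P.Fubini_integral[OF this]
  show "(\<integral>\<omega>. (LBINT r:{s..t}. G (\<omega>, r)) \<partial>M) = (LBINT r:{s..t}. (\<integral>\<omega>. G (\<omega>, r) \<partial>M))"
    by (simp add: integral_restrict_space set_lebesgue_integral_def)
qed

text \<open>Taylor's formula with Lagrange remainder puts the second derivative at an intermediate
  point; moving it back to \<open>y\<close> costs one Lipschitz factor, which replaces a third
  derivative.\<close>

lemma Taylor2_bound:
  fixes v :: "real \<Rightarrow> real"
  assumes v1: "\<And>y. (v has_real_derivative v1 y) (at y)" and v2: "\<And>y. (v1 has_real_derivative v2 y) (at y)"
    and lip: "\<And>y z. \<bar>v2 y - v2 z\<bar> \<le> L * \<bar>y - z\<bar>"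
  shows "\<bar>v z - v y - v1 y * (z - y) - v2 y / 2 * (z - y)\<^sup>2\<bar> \<le> L * \<bar>z - y\<bar> ^ 3"
proof -
  define d where "d = z - y"
  \<comment> \<open>The table of derivatives that \<open>Maclaurin_bi_le\<close> expects, for the
    function shifted to have its base point at 0.\<close>
  define df where "df m = (if m = 0 then (\<lambda>h. v (y + h)) else if m = Suc 0 then (\<lambda>h. v1 (y + h)) else (\<lambda>h. v2 (y + h)))" for m :: nat
  have "\<exists>h. \<bar>h\<bar> \<le> \<bar>d\<bar> \<and> v (y + d) = (\<Sum>m<2. df m 0 / fact m * d ^ m) + df 2 h / fact 2 * d ^ 2"
  proof (rule Maclaurin_bi_le)
    show "\<forall>m t. m < 2 \<and> \<bar>t\<bar> \<le> \<bar>d\<bar> \<longrightarrow> (df m has_real_derivative df (Suc m) t) (at t)"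
      using v1 v2 by (auto simp: df_def less_2_cases_iff DERIV_shift[symmetric] add.commute)
  qed (simp add: df_def)
  then obtain h where h: "\<bar>h\<bar> \<le> \<bar>d\<bar>" "v (y + d) = v y + v1 y * d + v2 (y + h) / 2 * d ^ 2"
    by (auto simp: df_def lessThan_Suc numeral_2_eq_2)
  have L: "0 \<le> L" using lip[of 1 0] by simp
  have "v z = v (y + d)" by (simp add: d_def)
  also have "\<dots> = v y + v1 y * d + v2 (y + h) / 2 * d ^ 2" by (rule h(2))
  finally have "v z - v y - v1 y * (z - y) - v2 y / 2 * (z - y)\<^sup>2 = (v2 (y + h) - v2 y) / 2 * d ^ 2"
    unfolding d_def by (simp only: diff_divide_distrib left_diff_distrib)
  then have "\<bar>v z - v y - v1 y * (z - y) - v2 y / 2 * (z - y)\<^sup>2\<bar> \<le> \<bar>v2 (y + h) - v2 y\<bar> * d ^ 2"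
    by (simp only:) (simp add: abs_mult)
  also have "\<dots> \<le> (L * \<bar>d\<bar>) * \<bar>d\<bar> ^ 2"
    using lip[of "y + h" y] mult_left_mono[OF h(1) L] by (auto intro!: mult_right_mono)
  finally show ?thesis by (simp add: d_def power3_eq_cube power2_eq_square)
qed

text \<open>If the fourth moment has size w^4 then the j-th has size w^j: below the threshold w use
  |Q|^j \<le> w^j, above it |Q|^j \<le> Q^4 / w^(4 - j).\<close>

lemma (in prob_space) interpolated_moment:
  fixes Q :: "'a \<Rightarrow> real"
  assumes [measurable]: "Q \<in> borel_measurable M" and Q: "integrable M (\<lambda>\<omega>. Q \<omega> ^ 4)" "(\<integral>\<omega>. Q \<omega> ^ 4 \<partial>M) \<le> c * w ^ 4"
    and w: "0 < w" and j: "j \<le> 4"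
  shows "integrable M (\<lambda>\<omega>. \<bar>Q \<omega>\<bar> ^ j)" "(\<integral>\<omega>. \<bar>Q \<omega>\<bar> ^ j \<partial>M) \<le> (1 + c) * w ^ j"
proof -
  have b: "\<bar>Q \<omega>\<bar> ^ j \<le> w ^ j + Q \<omega> ^ 4 / w ^ (4 - j)" for \<omega>
  proof (cases "\<bar>Q \<omega>\<bar> \<le> w")
    case True
    then have "\<bar>Q \<omega>\<bar> ^ j \<le> w ^ j" by (intro power_mono) auto
    then show ?thesis using w by (simp add: add_increasing2)
  next
    case False
    then have "w ^ (4 - j) \<le> \<bar>Q \<omega>\<bar> ^ (4 - j)" using w by (intro power_mono) auto
    then have "\<bar>Q \<omega>\<bar> ^ j * w ^ (4 - j) \<le> \<bar>Q \<omega>\<bar> ^ j * \<bar>Q \<omega>\<bar> ^ (4 - j)" by (intro mult_left_mono) auto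
    also have "\<dots> = Q \<omega> ^ 4" using j by (simp add: power_add[symmetric] power_even_abs)
    finally have "\<bar>Q \<omega>\<bar> ^ j \<le> Q \<omega> ^ 4 / w ^ (4 - j)" using w by (simp add: field_simps)
    then show ?thesis using w by (simp add: add_increasing)
  qed
  show i: "integrable M (\<lambda>\<omega>. \<bar>Q \<omega>\<bar> ^ j)"
    by (rule Bochner_Integration.integrable_bound[of _ "\<lambda>\<omega>. w ^ j + Q \<omega> ^ 4 / w ^ (4 - j)"])
      (use Q b w in \<open>auto intro!: AE_I2 intro: order_trans[OF b]\<close>)
  have "(\<integral>\<omega>. \<bar>Q \<omega>\<bar> ^ j \<partial>M) \<le> (\<integral>\<omega>. w ^ j + Q \<omega> ^ 4 / w ^ (4 - j) \<partial>M)"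
    using i Q b by (intro integral_mono) auto
  also have "\<dots> = w ^ j + (\<integral>\<omega>. Q \<omega> ^ 4 \<partial>M) / w ^ (4 - j)" using Q by (simp add: prob_space)
  also have "\<dots> \<le> w ^ j + c * w ^ 4 / w ^ (4 - j)" using Q w by (intro add_left_mono divide_right_mono) auto
  also have "w ^ 4 = w ^ j * w ^ (4 - j)" using j by (simp add: power_add[symmetric])
  also have "w ^ j + c * (w ^ j * w ^ (4 - j)) / w ^ (4 - j) = (1 + c) * w ^ j" using w by (simp add: algebra_simps)
  finally show "(\<integral>\<omega>. \<bar>Q \<omega>\<bar> ^ j \<partial>M) \<le> (1 + c) * w ^ j" .
qed

locale bounded_sde = filtered_brownian_motion M F B
  for M :: "'a measure" and F B +
  fixes b \<sigma> :: "real \<Rightarrow> real" and x :: real and X :: "real \<Rightarrow> 'a \<Rightarrow> real" and K :: real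
  assumes sol: "sde_solution M F B b \<sigma> x X"
    and b_meas[measurable]: "b \<in> borel_measurable borel" and s_meas[measurable]: "\<sigma> \<in> borel_measurable borel"
    and b_bound: "\<bar>b y\<bar> \<le> K" and s_bound: "\<bar>\<sigma> y\<bar> \<le> K"
begin

text \<open>Times below \<open>0\<close>, where \<open>X\<close> is unconstrained, are replaced by \<open>0\<close>.\<close>
definition Y :: "real \<Rightarrow> 'a \<Rightarrow> real" where "Y r = X (max 0 r)"

lemma Y_measurable_F: "0 \<le> r \<Longrightarrow> Y r \<in> borel_measurable (F r)"
  using sol by (auto simp: Y_def sde_solution_def adapted_def)

lemma Y_joint[measurable]: "(\<lambda>p. Y (snd p) (fst p)) \<in> borel_measurable (M \<Otimes>\<^sub>M borel)"
  unfolding Y_def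
proof (rule continuous_process_jointly_measurable)
  show "X t \<in> borel_measurable M" if "0 \<le> t" for t
    using measurable_F_M[OF Y_measurable_F[OF that] that] that by (simp only: Y_def max_absorb2)
qed (use sol in \<open>auto simp: sde_solution_def continuous_paths_def\<close>)

lemma Y_measurable[measurable]: "Y r \<in> borel_measurable M"
proof -
  have "Y (max 0 r) \<in> borel_measurable M"
    using measurable_F_M[OF Y_measurable_F, of "max 0 r"] by simp
  then show ?thesis by (simp add: Y_def)
qed

lemma K_nonneg: "0 \<le> K" using b_bound[of 0] by linarith

lemma has_ito_Y:
  assumes "has_ito_integral M F B (\<lambda>s \<omega>. \<sigma> (X s \<omega>)) t I"
  shows "has_ito_integral M F B (\<lambda>s \<omega>. \<sigma> (Y s \<omega>)) t I"
proof -
  have 1: "(\<lambda>(s, \<omega>). \<sigma> (Y s \<omega>)) \<in> borel_measurable (restrict_space borel {0..t} \<Otimes>\<^sub>M F t) \<longleftrightarrow>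
    (\<lambda>(s, \<omega>). \<sigma> (X s \<omega>)) \<in> borel_measurable (restrict_space borel {0..t} \<Otimes>\<^sub>M F t)" for t
    by (rule measurable_cong) (auto simp: space_pair_measure space_restrict_space Y_def)
  have 2: "(\<integral>\<^sup>+s\<in>{0..t}. ennreal ((\<sigma> (Y s \<omega>) - g s \<omega>)\<^sup>2) \<partial>lborel) = (\<integral>\<^sup>+s\<in>{0..t}. ennreal ((\<sigma> (X s \<omega>) - g s \<omega>)\<^sup>2) \<partial>lborel)" for g \<omega>
    by (rule nn_integral_cong) (auto simp: indicator_def Y_def)
  show ?thesis using assms unfolding has_ito_integral_def progressively_measurable_def 1 2 .
qed

text \<open>The definition of a solution supplies an Ito integral for every time separately, so the
  increment is expressed by the difference of two independently chosen variables \<open>I\<close>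
  and \<open>I'\<close>.\<close>

lemma increment_decomposition:
  assumes st: "0 \<le> s" "s \<le> t"
  obtains I I' where "has_ito_integral M F B (\<lambda>s \<omega>. \<sigma> (Y s \<omega>)) t I" "has_ito_integral M F B (\<lambda>s \<omega>. \<sigma> (Y s \<omega>)) s I'"
    "AE \<omega> in M. Y t \<omega> - Y s \<omega> = (LBINT r:{s..t}. b (Y r \<omega>)) + (I \<omega> - I' \<omega>)"
proof -
  have ex: "\<exists>I. has_ito_integral M F B (\<lambda>s \<omega>. \<sigma> (X s \<omega>)) u I \<and>
      (AE \<omega> in M. X u \<omega> = x + (LBINT r:{0..u}. b (X r \<omega>)) + I \<omega>)" if "0 \<le> u" for u
    using sol that unfolding sde_solution_def by simp
  obtain I where I: "has_ito_integral M F B (\<lambda>s \<omega>. \<sigma> (X s \<omega>)) t I"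
    "AE \<omega> in M. X t \<omega> = x + (LBINT r:{0..t}. b (X r \<omega>)) + I \<omega>"
    using ex[of t] st by auto
  obtain I' where I': "has_ito_integral M F B (\<lambda>s \<omega>. \<sigma> (X s \<omega>)) s I'"
    "AE \<omega> in M. X s \<omega> = x + (LBINT r:{0..s}. b (X r \<omega>)) + I' \<omega>"
    using ex[OF st(1)] by auto
  have "AE \<omega> in M. Y t \<omega> - Y s \<omega> = (LBINT r:{s..t}. b (Y r \<omega>)) + (I \<omega> - I' \<omega>)"
    using I(2) I'(2) AE_space
  proof eventually_elim
    case (elim \<omega>)
    have [measurable]: "(\<lambda>r. b (Y r \<omega>)) \<in> borel_measurable borel"
      using measurable_compose[OF measurable_Pair1'[OF elim(3)] measurable_compose[OF Y_joint b_meas]] by simp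
    have eq: "(LBINT r:{0..u}. b (X r \<omega>)) = (LBINT r:{0..u}. b (Y r \<omega>))" for u
      unfolding set_lebesgue_integral_def by (rule Bochner_Integration.integral_cong) (auto simp: indicator_def Y_def)
    have "(LBINT r:{0..t}. b (Y r \<omega>)) = (LBINT r:{0..s}. b (Y r \<omega>)) + (LBINT r:{s..t}. b (Y r \<omega>))"
      using st b_bound by (intro set_integral_Icc_combine) auto
    then show ?case using elim(1,2) st unfolding eq by (simp add: Y_def)
  qed
  with I(1) I'(1) show thesis by (intro that has_ito_Y)
qed

end

lemma set_integral_Icc_bound:
  fixes g :: "real \<Rightarrow> real"
  assumes [measurable]: "g \<in> borel_measurable borel" and g: "\<And>r. r \<in> {s..t} \<Longrightarrow> \<bar>g r\<bar> \<le> K" and st: "s \<le> t"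
  shows "\<bar>LBINT r:{s..t}. g r\<bar> \<le> K * (t - s)"
proof -
  have i: "integrable lborel (\<lambda>r. indicator {s..t} r *\<^sub>R g r)"
    using g by (intro integrableI_bounded_set_indicator[where B = K]) (auto simp: emeasure_lborel_Icc_eq)
  have "\<bar>LBINT r:{s..t}. g r\<bar> \<le> (\<integral>r. \<bar>indicator {s..t} r *\<^sub>R g r\<bar> \<partial>lborel)"
    unfolding set_lebesgue_integral_def by (rule integral_abs_bound)
  also have "\<dots> \<le> (\<integral>r. K * indicator {s..t} r \<partial>lborel)"
  proof (rule integral_mono)
    show "integrable lborel (\<lambda>r. K * indicator {s..t} r)"
      by (intro integrable_mult_right integrable_real_indicator) (auto simp: emeasure_lborel_Icc_eq)
  qed (use i g in \<open>auto simp: indicator_def\<close>)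
  also have "\<dots> = K * (t - s)" using st by simp
  finally show ?thesis .
qed

text \<open>Asking only for a Lipschitz \<open>v2\<close> is deliberate: it suffices for a cubic
  Taylor remainder and holds for difference quotients of functions whose second derivative is
  Lipschitz.\<close>

definition test_function :: "(real \<Rightarrow> real) \<Rightarrow> (real \<Rightarrow> real) \<Rightarrow> (real \<Rightarrow> real) \<Rightarrow> real \<Rightarrow> bool" where
  "test_function v v1 v2 L \<longleftrightarrow>
    (\<forall>y. (v has_real_derivative v1 y) (at y)) \<and> (\<forall>y. (v1 has_real_derivative v2 y) (at y)) \<and>
    (\<forall>y. \<bar>v y\<bar> \<le> L \<and> \<bar>v1 y\<bar> \<le> L \<and> \<bar>v2 y\<bar> \<le> L) \<and> (\<forall>y z. \<bar>v2 y - v2 z\<bar> \<le> L * \<bar>y - z\<bar>)"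

lemma Lipschitz_of_bounded_derivative:
  fixes f :: "real \<Rightarrow> real"
  assumes "\<And>y. (f has_real_derivative f' y) (at y)" "\<And>y. \<bar>f' y\<bar> \<le> L"
  shows "\<bar>f y - f z\<bar> \<le> L * \<bar>y - z\<bar>"
proof -
  have "norm (f y - f z) \<le> L * norm (y - z)"
    by (rule field_differentiable_bound[of UNIV f f']) (use assms in auto)
  then show ?thesis by simp
qed

lemma test_functionD:
  assumes "test_function v v1 v2 L"
  shows "(v has_real_derivative v1 y) (at y)" "(v1 has_real_derivative v2 y) (at y)"
    "\<bar>v y\<bar> \<le> L" "\<bar>v1 y\<bar> \<le> L" "\<bar>v2 y\<bar> \<le> L" "\<bar>v2 y - v2 z\<bar> \<le> L * \<bar>y - z\<bar>" "\<bar>v1 y - v1 z\<bar> \<le> L * \<bar>y - z\<bar>"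
    "v \<in> borel_measurable borel" "v1 \<in> borel_measurable borel" "v2 \<in> borel_measurable borel" "0 \<le> L"
proof -
  show *: "(v has_real_derivative v1 y) (at y)" "(v1 has_real_derivative v2 y) (at y)"
    "\<bar>v y\<bar> \<le> L" "\<bar>v1 y\<bar> \<le> L" "\<bar>v2 y\<bar> \<le> L" "\<bar>v2 y - v2 z\<bar> \<le> L * \<bar>y - z\<bar>" for y z
    using assms by (auto simp: test_function_def)
  show "\<bar>v1 y - v1 z\<bar> \<le> L * \<bar>y - z\<bar>" by (rule Lipschitz_of_bounded_derivative[of v1 v2]) (use * in auto)
  show L: "0 \<le> L" using *(3)[of 0] by linarith
  have "continuous_on UNIV v" "continuous_on UNIV v1"
    using *(1,2) by (auto intro!: continuous_at_imp_continuous_on DERIV_isCont)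
  moreover have "continuous_on UNIV v2"
  proof (rule lipschitz_on_continuous_on)
    show "L-lipschitz_on UNIV v2" using *(6) L by (auto simp: lipschitz_on_def dist_real_def)
  qed
  ultimately show "v \<in> borel_measurable borel" "v1 \<in> borel_measurable borel" "v2 \<in> borel_measurable borel"
    by (auto intro: borel_measurable_continuous_onI)
qed

section \<open>Short-time estimates and Dynkin's formula\<close>

context bounded_sde begin

text \<open>The derivatives are arguments, so that at a kink a one-sided second derivative can be
  supplied.\<close>

definition generator :: "(real \<Rightarrow> real) \<Rightarrow> (real \<Rightarrow> real) \<Rightarrow> real \<Rightarrow> real" where
  "generator v1 v2 y = b y * v1 y + (\<sigma> y)\<^sup>2 / 2 * v2 y"

lemma Y_path_measurable[measurable (raw)]: "\<omega> \<in> space M \<Longrightarrow> (\<lambda>r. Y r \<omega>) \<in> borel_measurable borel"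
  using measurable_compose[OF measurable_Pair1' Y_joint] by simp

lemma sigma_Y_joint: "(\<lambda>p. \<sigma> (Y (snd p) (fst p))) \<in> borel_measurable (M \<Otimes>\<^sub>M borel)"
  by measurable

lemma drift_bound:
  assumes "\<omega> \<in> space M" "s \<le> t"
  shows "\<bar>LBINT r:{s..t}. b (Y r \<omega>)\<bar> \<le> K * (t - s)"
  using assms b_bound by (intro set_integral_Icc_bound) auto

text \<open>The drift part is at most \<open>K * (t - s)\<close> and the Ito part has the Gaussian
  bound, so (u + v)^4 \<le> 8 u^4 + 8 v^4 yields 32 = 8 + 8 * 3. For t \<le> s + 1 the drift term (t
  - s)^4 is absorbed in (t - s)^2.\<close>

lemma displacement_moment4:
  assumes st: "0 \<le> s" "s \<le> t" "t \<le> s + 1"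
  shows "integrable M (\<lambda>\<omega>. (Y t \<omega> - Y s \<omega>) ^ 4)" "(\<integral>\<omega>. (Y t \<omega> - Y s \<omega>) ^ 4 \<partial>M) \<le> 32 * K ^ 4 * (t - s)\<^sup>2"
proof -
  obtain I I' where I: "has_ito_integral M F B (\<lambda>s \<omega>. \<sigma> (Y s \<omega>)) t I" "has_ito_integral M F B (\<lambda>s \<omega>. \<sigma> (Y s \<omega>)) s I'"
    "AE \<omega> in M. Y t \<omega> - Y s \<omega> = (LBINT r:{s..t}. b (Y r \<omega>)) + (I \<omega> - I' \<omega>)"
    by (rule increment_decomposition[OF st(1,2)], rule that)
  have J: "integrable M (\<lambda>\<omega>. (I \<omega> - I' \<omega>) ^ 4)" "(\<integral>\<omega>. (I \<omega> - I' \<omega>) ^ 4 \<partial>M) \<le> 3 * K ^ 4 * (t - s)\<^sup>2"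
    using ito_increment_moments(1,2)[OF I(1,2) st(1,2) sigma_Y_joint s_bound, of "\<lambda>_. 0" 0] by auto
  have bd: "AE \<omega> in M. (Y t \<omega> - Y s \<omega>) ^ 4 \<le> 8 * (K * (t - s)) ^ 4 + 8 * (I \<omega> - I' \<omega>) ^ 4"
    using I(3) AE_space
  proof eventually_elim
    case (elim \<omega>)
    let ?A = "LBINT r:{s..t}. b (Y r \<omega>)" and ?J = "I \<omega> - I' \<omega>"
    have sq: "(u + v)\<^sup>2 \<le> 2 * u\<^sup>2 + 2 * v\<^sup>2" for u v :: real
      using zero_le_power2[of "u - v"] by (simp add: power2_eq_square algebra_simps)
    have "(?A + ?J) ^ 4 = ((?A + ?J)\<^sup>2)\<^sup>2" by simp
    also have "\<dots> \<le> (2 * ?A\<^sup>2 + 2 * ?J\<^sup>2)\<^sup>2" by (intro power_mono sq) simp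
    also have "\<dots> \<le> 2 * (2 * ?A\<^sup>2)\<^sup>2 + 2 * (2 * ?J\<^sup>2)\<^sup>2" by (rule sq)
    also have "\<dots> = 8 * \<bar>?A\<bar> ^ 4 + 8 * ?J ^ 4" by (simp add: power_mult_distrib)
    also have "\<dots> \<le> 8 * (K * (t - s)) ^ 4 + 8 * ?J ^ 4"
      using drift_bound[OF elim(2) st(2)] by (intro add_right_mono mult_left_mono power_mono) auto
    finally show ?case unfolding elim(1) .
  qed
  show i: "integrable M (\<lambda>\<omega>. (Y t \<omega> - Y s \<omega>) ^ 4)"
  proof (rule Bochner_Integration.integrable_bound)
    show "integrable M (\<lambda>\<omega>. 8 * (K * (t - s)) ^ 4 + 8 * (I \<omega> - I' \<omega>) ^ 4)" using J(1) by simp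
    show "AE \<omega> in M. norm ((Y t \<omega> - Y s \<omega>) ^ 4) \<le> norm (8 * (K * (t - s)) ^ 4 + 8 * (I \<omega> - I' \<omega>) ^ 4)"
      using bd by eventually_elim auto
  qed measurable
  have "(\<integral>\<omega>. (Y t \<omega> - Y s \<omega>) ^ 4 \<partial>M) \<le> (\<integral>\<omega>. 8 * (K * (t - s)) ^ 4 + 8 * (I \<omega> - I' \<omega>) ^ 4 \<partial>M)"
    using i J bd by (intro integral_mono_AE) auto
  also have "\<dots> = 8 * (K ^ 4 * (t - s) ^ 4) + 8 * (\<integral>\<omega>. (I \<omega> - I' \<omega>) ^ 4 \<partial>M)"
    using J(1) by (simp add: prob_space power_mult_distrib)
  also have "\<dots> \<le> 8 * (K ^ 4 * (t - s)\<^sup>2) + 8 * (3 * K ^ 4 * (t - s)\<^sup>2)"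
    using J(2) st by (intro add_mono mult_left_mono power_decreasing) auto
  finally show "(\<integral>\<omega>. (Y t \<omega> - Y s \<omega>) ^ 4 \<partial>M) \<le> 32 * K ^ 4 * (t - s)\<^sup>2" by simp
qed

text \<open>Interpolation at the diffusive scale sqrt (t - s). The bound is uniform in
  \<open>r\<close>, because it is used under an integral over \<open>r\<close>.\<close>

lemma displacement_moment:
  assumes st: "0 \<le> s" "s \<le> r" "r \<le> t" "t \<le> s + 1" "s < t" and j: "j \<le> 4"
  shows "integrable M (\<lambda>\<omega>. \<bar>Y r \<omega> - Y s \<omega>\<bar> ^ j)"
    "(\<integral>\<omega>. \<bar>Y r \<omega> - Y s \<omega>\<bar> ^ j \<partial>M) \<le> (1 + 32 * K ^ 4) * sqrt (t - s) ^ j"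
proof -
  have "(\<integral>\<omega>. (Y r \<omega> - Y s \<omega>) ^ 4 \<partial>M) \<le> 32 * K ^ 4 * (r - s)\<^sup>2"
    using displacement_moment4[of s r] st by auto
  also have "\<dots> \<le> 32 * K ^ 4 * (t - s)\<^sup>2" using st K_nonneg by (intro mult_left_mono power_mono) auto
  also have "(t - s)\<^sup>2 = sqrt (t - s) ^ 4" using st by (simp add: power4_eq_xxxx power2_eq_square)
  finally have 4: "(\<integral>\<omega>. (Y r \<omega> - Y s \<omega>) ^ 4 \<partial>M) \<le> 32 * K ^ 4 * sqrt (t - s) ^ 4" .
  have m: "(\<lambda>\<omega>. Y r \<omega> - Y s \<omega>) \<in> borel_measurable M" by measurable
  have i: "integrable M (\<lambda>\<omega>. (Y r \<omega> - Y s \<omega>) ^ 4)" using displacement_moment4[of s r] st by auto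
  have w: "0 < sqrt (t - s)" using st by simp
  show "integrable M (\<lambda>\<omega>. \<bar>Y r \<omega> - Y s \<omega>\<bar> ^ j)"
    "(\<integral>\<omega>. \<bar>Y r \<omega> - Y s \<omega>\<bar> ^ j \<partial>M) \<le> (1 + 32 * K ^ 4) * sqrt (t - s) ^ j"
    using interpolated_moment[OF m i 4 w j] .
qed

lemma generator_bounds:
  assumes "test_function v v1 v2 L"
  shows "generator v1 v2 \<in> borel_measurable borel" "\<bar>generator v1 v2 y\<bar> \<le> K * L + K\<^sup>2 / 2 * L"
proof -
  note T = test_functionD[OF assms]
  note [measurable] = T(8-10)
  show "generator v1 v2 \<in> borel_measurable borel" unfolding generator_def[abs_def] by measurable
  have "\<bar>b y * v1 y\<bar> \<le> K * L" unfolding abs_mult by (intro mult_mono b_bound T(4) K_nonneg) auto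
  moreover have "(\<sigma> y)\<^sup>2 \<le> K\<^sup>2" using power_mono[OF s_bound[of y], of 2] by simp
  then have "\<bar>(\<sigma> y)\<^sup>2 / 2 * v2 y\<bar> \<le> K\<^sup>2 / 2 * L"
    unfolding abs_mult by (intro mult_mono T(5)) auto
  ultimately show "\<bar>generator v1 v2 y\<bar> \<le> K * L + K\<^sup>2 / 2 * L"
    unfolding generator_def by linarith
qed

lemma expectation_Y:
  fixes g :: "real \<Rightarrow> real"
  assumes g[measurable]: "g \<in> borel_measurable borel" and bd: "\<And>y. \<bar>g y\<bar> \<le> L"
  shows "(\<lambda>r. \<integral>\<omega>. g (Y r \<omega>) \<partial>M) \<in> borel_measurable borel" "\<bar>\<integral>\<omega>. g (Y r \<omega>) \<partial>M\<bar> \<le> L"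
    "integrable M (\<lambda>\<omega>. g (Y r \<omega>))"
proof -
  have "(\<lambda>p. g (Y (snd p) (fst p))) \<in> borel_measurable (M \<Otimes>\<^sub>M borel)" by measurable
  from Fubini_strip(1)[OF this, of L] bd
  show "(\<lambda>r. \<integral>\<omega>. g (Y r \<omega>) \<partial>M) \<in> borel_measurable borel" by simp
  show i: "integrable M (\<lambda>\<omega>. g (Y r \<omega>))"
    by (rule integrable_const_bound[of _ L]) (use bd in auto)
  have "\<bar>\<integral>\<omega>. g (Y r \<omega>) \<partial>M\<bar> \<le> (\<integral>\<omega>. \<bar>g (Y r \<omega>)\<bar> \<partial>M)" by (rule integral_abs_bound)
  also have "\<dots> \<le> (\<integral>\<omega>. L \<partial>M)" using i bd by (intro integral_mono) auto
  finally show "\<bar>\<integral>\<omega>. g (Y r \<omega>) \<partial>M\<bar> \<le> L" by (simp add: prob_space)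
qed

text \<open>Mixed products in which \<open>f\<close>, a derivative of the test function, is frozen
  at time \<open>s\<close> while \<open>g\<close>, a coefficient, keeps moving.\<close>

lemma frozen_expectation:
  fixes f g :: "real \<Rightarrow> real"
  assumes [measurable]: "f \<in> borel_measurable borel" "g \<in> borel_measurable borel"
    and bd: "\<And>y. \<bar>f y\<bar> \<le> L" "\<And>y. \<bar>g y\<bar> \<le> L'"
  shows "(\<lambda>r. \<integral>\<omega>. f (Y s \<omega>) * g (Y r \<omega>) \<partial>M) \<in> borel_measurable borel"
    "\<bar>\<integral>\<omega>. f (Y s \<omega>) * g (Y r \<omega>) \<partial>M\<bar> \<le> L * L'"
    "integrable M (\<lambda>\<omega>. f (Y s \<omega>) * g (Y r \<omega>))"
    "(\<integral>\<omega>. f (Y s \<omega>) * (LBINT r:{s..t}. g (Y r \<omega>)) \<partial>M) = (LBINT r:{s..t}. (\<integral>\<omega>. f (Y s \<omega>) * g (Y r \<omega>) \<partial>M))"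
    "(\<lambda>\<omega>. LBINT r:{s..t}. g (Y r \<omega>)) \<in> borel_measurable M"
proof -
  have b: "\<bar>f y * g z\<bar> \<le> L * L'" for y z
  proof -
    have "0 \<le> L" using bd(1)[of 0] by linarith
    then show ?thesis unfolding abs_mult by (intro mult_mono bd) auto
  qed
  have m: "(\<lambda>p. f (Y s (fst p)) * g (Y (snd p) (fst p))) \<in> borel_measurable (M \<Otimes>\<^sub>M borel)" by measurable
  have m': "(\<lambda>p. g (Y (snd p) (fst p))) \<in> borel_measurable (M \<Otimes>\<^sub>M borel)" by measurable
  show "(\<lambda>r. \<integral>\<omega>. f (Y s \<omega>) * g (Y r \<omega>) \<partial>M) \<in> borel_measurable borel"
    using Fubini_strip(1)[OF m, of "L * L'"] b by simp
  show "(\<integral>\<omega>. f (Y s \<omega>) * (LBINT r:{s..t}. g (Y r \<omega>)) \<partial>M) = (LBINT r:{s..t}. (\<integral>\<omega>. f (Y s \<omega>) * g (Y r \<omega>) \<partial>M))"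
    using Fubini_strip(2)[OF m, of "L * L'" s t] b by simp
  show "(\<lambda>\<omega>. LBINT r:{s..t}. g (Y r \<omega>)) \<in> borel_measurable M"
    using Fubini_strip(3)[OF m', of L'] bd by simp
  show i: "integrable M (\<lambda>\<omega>. f (Y s \<omega>) * g (Y r \<omega>))"
    by (rule integrable_const_bound[of _ "L * L'"]) (use b in auto)
  have "\<bar>\<integral>\<omega>. f (Y s \<omega>) * g (Y r \<omega>) \<partial>M\<bar> \<le> (\<integral>\<omega>. \<bar>f (Y s \<omega>) * g (Y r \<omega>)\<bar> \<partial>M)" by (rule integral_abs_bound)
  also have "\<dots> \<le> (\<integral>\<omega>. L * L' \<partial>M)" using i b by (intro integral_mono) auto
  finally show "\<bar>\<integral>\<omega>. f (Y s \<omega>) * g (Y r \<omega>) \<partial>M\<bar> \<le> L * L'" by (simp add: prob_space)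
qed

text \<open>All terms carry the coefficients at time \<open>r\<close>; only \<open>v1\<close> and
  \<open>v2\<close> are compared at \<open>Y s\<close> and \<open>Y r\<close>. Their Lipschitz
  bounds leave the mean of |Y r - Y s|, of order sqrt (t - s), so the jumps of the coefficients do
  no harm.\<close>

lemma freezing_error:
  assumes tf: "test_function v v1 v2 L" and st: "0 \<le> s" "s < t" "t \<le> s + 1"
  shows "\<bar>(LBINT r:{s..t}. (\<integral>\<omega>. v1 (Y s \<omega>) * b (Y r \<omega>) \<partial>M))
      + (LBINT r:{s..t}. (\<integral>\<omega>. v2 (Y s \<omega>) * (\<sigma> (Y r \<omega>))\<^sup>2 \<partial>M)) / 2
      - (LBINT r:{s..t}. (\<integral>\<omega>. generator v1 v2 (Y r \<omega>) \<partial>M))\<bar>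
    \<le> L * (K + K\<^sup>2) * (1 + 32 * K ^ 4) * sqrt (t - s) * (t - s)"
proof -
  note T = test_functionD[OF tf]
  note [measurable] = T(8-10) generator_bounds(1)[OF tf]
  have s2: "\<bar>(\<sigma> y)\<^sup>2\<bar> \<le> K\<^sup>2" for y using power_mono[OF s_bound[of y], of 2] by simp
  have s2m: "(\<lambda>y. (\<sigma> y)\<^sup>2) \<in> borel_measurable borel" by measurable
  let ?p = "\<lambda>r. \<integral>\<omega>. v1 (Y s \<omega>) * b (Y r \<omega>) \<partial>M"
  let ?q = "\<lambda>r. \<integral>\<omega>. v2 (Y s \<omega>) * (\<sigma> (Y r \<omega>))\<^sup>2 \<partial>M"
  let ?g = "\<lambda>r. \<integral>\<omega>. generator v1 v2 (Y r \<omega>) \<partial>M"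
  note P = frozen_expectation(1-3)[OF T(9) b_meas T(4) b_bound, of s]
  note Q = frozen_expectation(1-3)[OF T(10) s2m T(5) s2, of s]
  note G = expectation_Y[OF generator_bounds[OF tf]]
  have si: "set_integrable lborel {s..t} ?p" "set_integrable lborel {s..t} ?q" "set_integrable lborel {s..t} ?g"
    by (rule bounded_set_integrable_Icc, rule P Q G, rule P Q G)+
  have q2: "set_integrable lborel {s..t} (\<lambda>r. ?q r / 2)" "(LBINT r:{s..t}. ?q r) / 2 = (LBINT r:{s..t}. ?q r / 2)"
    using si(2) by (simp_all add: set_integrable_def set_lebesgue_integral_def)
  have "(LBINT r:{s..t}. ?p r) + (LBINT r:{s..t}. ?q r) / 2 - (LBINT r:{s..t}. ?g r)
      = (LBINT r:{s..t}. ?p r + ?q r / 2 - ?g r)"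
    unfolding q2(2) set_integral_add(2)[OF si(1) q2(1), symmetric]
    by (rule set_integral_diff(2)[OF set_integral_add(1)[OF si(1) q2(1)] si(3), symmetric])
  also have "\<bar>LBINT r:{s..t}. ?p r + ?q r / 2 - ?g r\<bar>
      \<le> (L * (K + K\<^sup>2) * (1 + 32 * K ^ 4) * sqrt (t - s)) * (t - s)"
  proof (rule set_integral_Icc_bound)
    show "(\<lambda>r. ?p r + ?q r / 2 - ?g r) \<in> borel_measurable borel" using P(1) Q(1) G(1) by measurable
    show "s \<le> t" using st by simp
    fix r assume r: "r \<in> {s..t}"
    let ?D = "\<lambda>\<omega>. \<bar>Y r \<omega> - Y s \<omega>\<bar> ^ 1"
    note D = displacement_moment[of s r t 1]
    have Di: "integrable M ?D" and Db: "(\<integral>\<omega>. ?D \<omega> \<partial>M) \<le> (1 + 32 * K ^ 4) * sqrt (t - s)"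
      using D r st by auto
    have pt: "\<bar>v1 (Y s \<omega>) * b (Y r \<omega>) + v2 (Y s \<omega>) * (\<sigma> (Y r \<omega>))\<^sup>2 / 2 - generator v1 v2 (Y r \<omega>)\<bar>
        \<le> L * (K + K\<^sup>2) * ?D \<omega>" for \<omega>
    proof -
      let ?y = "Y s \<omega>" and ?z = "Y r \<omega>"
      have "v1 ?y * b ?z + v2 ?y * (\<sigma> ?z)\<^sup>2 / 2 - generator v1 v2 ?z
        = (v1 ?y - v1 ?z) * b ?z + (v2 ?y - v2 ?z) * ((\<sigma> ?z)\<^sup>2 / 2)"
        unfolding generator_def by (simp add: algebra_simps diff_divide_distrib)
      moreover have "\<bar>(v1 ?y - v1 ?z) * b ?z\<bar> \<le> (L * \<bar>?y - ?z\<bar>) * K"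
        unfolding abs_mult using T(11) by (intro mult_mono T(7) b_bound) auto
      moreover have "\<bar>(v2 ?y - v2 ?z) * ((\<sigma> ?z)\<^sup>2 / 2)\<bar> \<le> (L * \<bar>?y - ?z\<bar>) * K\<^sup>2"
      proof -
        have "\<bar>(\<sigma> ?z)\<^sup>2 / 2\<bar> \<le> K\<^sup>2" using s2[of ?z] zero_le_power2[of "\<sigma> ?z"] by linarith
        then show ?thesis unfolding abs_mult[of "v2 ?y - v2 ?z"] using T(11) by (intro mult_mono T(6)) auto
      qed
      ultimately have "\<bar>v1 ?y * b ?z + v2 ?y * (\<sigma> ?z)\<^sup>2 / 2 - generator v1 v2 ?z\<bar>
        \<le> (L * \<bar>?y - ?z\<bar>) * K + (L * \<bar>?y - ?z\<bar>) * K\<^sup>2" by linarith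
      also have "\<dots> = L * (K + K\<^sup>2) * ?D \<omega>" by (simp add: algebra_simps abs_minus_commute)
      finally show ?thesis .
    qed
    let ?e = "\<lambda>\<omega>. v1 (Y s \<omega>) * b (Y r \<omega>) + v2 (Y s \<omega>) * (\<sigma> (Y r \<omega>))\<^sup>2 / 2 - generator v1 v2 (Y r \<omega>)"
    have ei: "integrable M ?e"
      using P(3)[of r] Q(3)[of r] G(3)[of r] by (intro Bochner_Integration.integrable_diff Bochner_Integration.integrable_add integrable_divide) auto
    have "?p r + ?q r / 2 - ?g r = (\<integral>\<omega>. ?e \<omega> \<partial>M)"
      using P(3)[of r] Q(3)[of r] G(3)[of r] by simp
    then have "\<bar>?p r + ?q r / 2 - ?g r\<bar> \<le> (\<integral>\<omega>. \<bar>?e \<omega>\<bar> \<partial>M)"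
      by (simp only: integral_abs_bound)
    also have "\<dots> \<le> (\<integral>\<omega>. L * (K + K\<^sup>2) * ?D \<omega> \<partial>M)"
      by (rule integral_mono[OF integrable_abs[OF ei] integrable_mult_right[OF Di] pt])
    also have "\<dots> = L * (K + K\<^sup>2) * (\<integral>\<omega>. ?D \<omega> \<partial>M)" using Di by simp
    also have "\<dots> \<le> L * (K + K\<^sup>2) * ((1 + 32 * K ^ 4) * sqrt (t - s))"
      using Db T(11) K_nonneg by (intro mult_left_mono) auto
    finally show "\<bar>?p r + ?q r / 2 - ?g r\<bar> \<le> L * (K + K\<^sup>2) * (1 + 32 * K ^ 4) * sqrt (t - s)"
      by (simp only: mult.assoc)
  qed
  finally show ?thesis .
qed

text \<open>Split the increment into the drift A = O(w^2) and the Ito part J = O(w), where w = sqrt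
  (t - s). The term v1 J has mean zero and v2 J^2 is given by the isometry, both with a weight known
  at time \<open>s\<close>. What is left, namely v2 (A^2/2 + A J) and the cubic Taylor remainder,
  has order w^3.\<close>

lemma Taylor_remainder_error:
  assumes tf: "test_function v v1 v2 L" and st: "0 \<le> s" "s < t" "t \<le> s + 1"
  shows "\<bar>(\<integral>\<omega>. v (Y t \<omega>) \<partial>M) - (\<integral>\<omega>. v (Y s \<omega>) \<partial>M)
      - (LBINT r:{s..t}. (\<integral>\<omega>. v1 (Y s \<omega>) * b (Y r \<omega>) \<partial>M))
      - (LBINT r:{s..t}. (\<integral>\<omega>. v2 (Y s \<omega>) * (\<sigma> (Y r \<omega>))\<^sup>2 \<partial>M)) / 2\<bar>
    \<le> L * (K\<^sup>2 + K * (1 + 3 * K ^ 4) + (1 + 32 * K ^ 4)) * sqrt (t - s) * (t - s)"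
proof -
  define w where "w = sqrt (t - s)"
  have w: "0 < w" "w\<^sup>2 = t - s" "w \<le> 1" using st by (auto simp: w_def)
  note T = test_functionD[OF tf]
  note [measurable] = T(8-10)
  have s2: "\<bar>(\<sigma> y)\<^sup>2\<bar> \<le> K\<^sup>2" for y using power_mono[OF s_bound[of y], of 2] by simp
  have s2m: "(\<lambda>y. (\<sigma> y)\<^sup>2) \<in> borel_measurable borel" by measurable
  have st': "s \<le> t" using st by simp
  obtain I I' where I: "has_ito_integral M F B (\<lambda>s \<omega>. \<sigma> (Y s \<omega>)) t I" "has_ito_integral M F B (\<lambda>s \<omega>. \<sigma> (Y s \<omega>)) s I'"
    "AE \<omega> in M. Y t \<omega> - Y s \<omega> = (LBINT r:{s..t}. b (Y r \<omega>)) + (I \<omega> - I' \<omega>)"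
    by (rule increment_decomposition[OF st(1) st'], rule that)
  have IF: "(\<lambda>\<omega>. f (Y s \<omega>)) \<in> borel_measurable (F s)" if "f \<in> borel_measurable borel" for f :: "real \<Rightarrow> real"
    using measurable_compose[OF Y_measurable_F[OF st(1)] that] .
  note IM1 = ito_increment_moments[OF I(1,2) st(1) st' sigma_Y_joint s_bound IF[OF T(9)] T(4)]
  note IM2 = ito_increment_moments[OF I(1,2) st(1) st' sigma_Y_joint s_bound IF[OF T(10)] T(5)]
  define J where "J \<omega> = I \<omega> - I' \<omega>" for \<omega>
  define A where "A \<omega> = (LBINT r:{s..t}. b (Y r \<omega>))" for \<omega>
  have [measurable]: "I \<in> borel_measurable M" "I' \<in> borel_measurable M" using I by (auto simp: has_ito_integral_def)
  have Jm[measurable]: "J \<in> borel_measurable M" unfolding J_def[abs_def] by measurable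
  have Am[measurable]: "A \<in> borel_measurable M"
    unfolding A_def[abs_def] by (rule frozen_expectation(5)[OF T(9) b_meas T(4) b_bound])
  have Ab: "\<bar>A \<omega>\<bar> \<le> K * w\<^sup>2" if "\<omega> \<in> space M" for \<omega>
    using drift_bound[OF that st'] unfolding A_def w(2) .
  have J4: "integrable M (\<lambda>\<omega>. J \<omega> ^ 4)" "(\<integral>\<omega>. J \<omega> ^ 4 \<partial>M) \<le> 3 * K ^ 4 * w ^ 4"
    using IM1(1,2) unfolding J_def w(2)[symmetric] by auto
  have J1: "integrable M (\<lambda>\<omega>. \<bar>J \<omega>\<bar>)" "(\<integral>\<omega>. \<bar>J \<omega>\<bar> \<partial>M) \<le> (1 + 3 * K ^ 4) * w"
    using interpolated_moment[OF Jm J4 w(1), of 1] by auto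
  have D3: "integrable M (\<lambda>\<omega>. \<bar>Y t \<omega> - Y s \<omega>\<bar> ^ 3)" "(\<integral>\<omega>. \<bar>Y t \<omega> - Y s \<omega>\<bar> ^ 3 \<partial>M) \<le> (1 + 32 * K ^ 4) * w ^ 3"
    using displacement_moment[of s t t 3] st unfolding w_def by auto
  define Q where "Q \<omega> = v (Y t \<omega>) - v (Y s \<omega>) - v1 (Y s \<omega>) * A \<omega> - v1 (Y s \<omega>) * J \<omega> - v2 (Y s \<omega>) * (J \<omega>)\<^sup>2 / 2" for \<omega>
  have i1: "integrable M (\<lambda>\<omega>. v1 (Y s \<omega>) * A \<omega>)"
    by (rule integrable_const_bound[of _ "L * (K * w\<^sup>2)"])
      (use T(4,11) Ab in \<open>auto intro!: AE_I2 mult_mono simp: abs_mult\<close>)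
  have i2: "integrable M (\<lambda>\<omega>. v1 (Y s \<omega>) * J \<omega>)" "integrable M (\<lambda>\<omega>. v2 (Y s \<omega>) * (J \<omega>)\<^sup>2)"
    using integrable_mult_power[OF Jm _ J4(1), of "\<lambda>\<omega>. v1 (Y s \<omega>)" L 1]
      integrable_mult_power[OF Jm _ J4(1), of "\<lambda>\<omega>. v2 (Y s \<omega>)" L 2] T(4,5) by auto
  have iv: "integrable M (\<lambda>\<omega>. v (Y r \<omega>))" for r by (rule expectation_Y(3)[OF T(8) T(3)])
  have Qi: "integrable M Q" unfolding Q_def[abs_def] using iv i1 i2 by simp
  have "(\<integral>\<omega>. Q \<omega> \<partial>M) = (\<integral>\<omega>. v (Y t \<omega>) \<partial>M) - (\<integral>\<omega>. v (Y s \<omega>) \<partial>M)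
      - (\<integral>\<omega>. v1 (Y s \<omega>) * A \<omega> \<partial>M) - (\<integral>\<omega>. v1 (Y s \<omega>) * J \<omega> \<partial>M) - (\<integral>\<omega>. v2 (Y s \<omega>) * (J \<omega>)\<^sup>2 \<partial>M) / 2"
    unfolding Q_def using iv i1 i2 by simp
  also have "(\<integral>\<omega>. v1 (Y s \<omega>) * J \<omega> \<partial>M) = 0" using IM1(3) unfolding J_def .
  also have "(\<integral>\<omega>. v2 (Y s \<omega>) * (J \<omega>)\<^sup>2 \<partial>M) = (LBINT r:{s..t}. (\<integral>\<omega>. v2 (Y s \<omega>) * (\<sigma> (Y r \<omega>))\<^sup>2 \<partial>M))"
    using IM2(4) unfolding J_def .
  also have "(\<integral>\<omega>. v1 (Y s \<omega>) * A \<omega> \<partial>M) = (LBINT r:{s..t}. (\<integral>\<omega>. v1 (Y s \<omega>) * b (Y r \<omega>) \<partial>M))"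
    unfolding A_def by (rule frozen_expectation(4)[OF T(9) b_meas T(4) b_bound])
  finally have EQ: "(\<integral>\<omega>. v (Y t \<omega>) \<partial>M) - (\<integral>\<omega>. v (Y s \<omega>) \<partial>M)
      - (LBINT r:{s..t}. (\<integral>\<omega>. v1 (Y s \<omega>) * b (Y r \<omega>) \<partial>M))
      - (LBINT r:{s..t}. (\<integral>\<omega>. v2 (Y s \<omega>) * (\<sigma> (Y r \<omega>))\<^sup>2 \<partial>M)) / 2 = (\<integral>\<omega>. Q \<omega> \<partial>M)" by simp
  let ?e = "\<lambda>\<omega>. L * (K\<^sup>2 * w ^ 4) + L * (K * w\<^sup>2) * \<bar>J \<omega>\<bar> + L * \<bar>Y t \<omega> - Y s \<omega>\<bar> ^ 3"
  have Qb: "AE \<omega> in M. \<bar>Q \<omega>\<bar> \<le> ?e \<omega>"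
    using I(3) AE_space
  proof eventually_elim
    case (elim \<omega>)
    let ?y = "Y s \<omega>" and ?z = "Y t \<omega>"
    have D: "?z - ?y = A \<omega> + J \<omega>" using elim(1) by (simp add: A_def J_def)
    \<comment> \<open>The second order Taylor term contains (A + J)^2 while \<open>Q\<close> only
      subtracts the part with J^2; the difference A^2/2 + A J is small by itself.\<close>
    have e: "Q \<omega> = (v ?z - v ?y - v1 ?y * (?z - ?y) - v2 ?y / 2 * (?z - ?y)\<^sup>2) + v2 ?y * ((A \<omega>)\<^sup>2 / 2 + A \<omega> * J \<omega>)"
      unfolding D Q_def by (simp add: power2_eq_square field_simps)
    have "\<bar>v ?z - v ?y - v1 ?y * (?z - ?y) - v2 ?y / 2 * (?z - ?y)\<^sup>2\<bar> \<le> L * \<bar>?z - ?y\<bar> ^ 3"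
      by (rule Taylor2_bound[OF T(1,2,6)])
    moreover have "\<bar>v2 ?y * ((A \<omega>)\<^sup>2 / 2 + A \<omega> * J \<omega>)\<bar> \<le> L * (K\<^sup>2 * w ^ 4 + (K * w\<^sup>2) * \<bar>J \<omega>\<bar>)"
      unfolding abs_mult[of "v2 ?y"]
    proof (intro mult_mono T(5) T(11))
      have "(A \<omega>)\<^sup>2 \<le> (K * w\<^sup>2)\<^sup>2" using power_mono[OF Ab[OF elim(2)], of 2] by simp
      also have "\<dots> = K\<^sup>2 * w ^ 4" by (simp add: power_mult_distrib)
      finally have "\<bar>(A \<omega>)\<^sup>2 / 2\<bar> \<le> K\<^sup>2 * w ^ 4" using zero_le_power2[of "A \<omega>"] by linarith
      moreover have "\<bar>A \<omega> * J \<omega>\<bar> \<le> (K * w\<^sup>2) * \<bar>J \<omega>\<bar>"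
        unfolding abs_mult by (intro mult_right_mono Ab elim) auto
      ultimately show "\<bar>(A \<omega>)\<^sup>2 / 2 + A \<omega> * J \<omega>\<bar> \<le> K\<^sup>2 * w ^ 4 + (K * w\<^sup>2) * \<bar>J \<omega>\<bar>" by linarith
    qed simp
    ultimately have "\<bar>Q \<omega>\<bar> \<le> L * \<bar>?z - ?y\<bar> ^ 3 + L * (K\<^sup>2 * w ^ 4 + (K * w\<^sup>2) * \<bar>J \<omega>\<bar>)"
      unfolding e by linarith
    then show ?case by (simp add: algebra_simps)
  qed
  have "\<bar>\<integral>\<omega>. Q \<omega> \<partial>M\<bar> \<le> (\<integral>\<omega>. \<bar>Q \<omega>\<bar> \<partial>M)" by (rule integral_abs_bound)
  also have "\<dots> \<le> (\<integral>\<omega>. ?e \<omega> \<partial>M)" using Qi J1 D3 Qb by (intro integral_mono_AE) auto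
  also have "\<dots> = L * (K\<^sup>2 * w ^ 4) + L * (K * w\<^sup>2) * (\<integral>\<omega>. \<bar>J \<omega>\<bar> \<partial>M) + L * (\<integral>\<omega>. \<bar>Y t \<omega> - Y s \<omega>\<bar> ^ 3 \<partial>M)"
    using J1 D3 by (simp add: prob_space)
  \<comment> \<open>Here w^4 \<le> w^3 because w \<le> 1; the other two terms already have order
    w^3.\<close>
  also have "\<dots> \<le> L * (K\<^sup>2 * w ^ 3) + L * (K * w\<^sup>2) * ((1 + 3 * K ^ 4) * w) + L * ((1 + 32 * K ^ 4) * w ^ 3)"
    using J1 D3 T(11) K_nonneg w st by (intro add_mono mult_left_mono power_decreasing) auto
  also have "\<dots> = L * (K\<^sup>2 + K * (1 + 3 * K ^ 4) + (1 + 32 * K ^ 4)) * w * w\<^sup>2"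
    by (simp add: power2_eq_square power3_eq_cube algebra_simps)
  finally show ?thesis unfolding EQ w(2) unfolding w_def .
qed


lemma local_Dynkin_estimate:
  assumes tf: "test_function v v1 v2 L"
  obtains C where "\<And>s t. 0 \<le> s \<Longrightarrow> s < t \<Longrightarrow> t \<le> s + 1 \<Longrightarrow>
    \<bar>(\<integral>\<omega>. v (Y t \<omega>) \<partial>M) - (\<integral>\<omega>. v (Y s \<omega>) \<partial>M) - (LBINT r:{s..t}. (\<integral>\<omega>. generator v1 v2 (Y r \<omega>) \<partial>M))\<bar>
      \<le> C * sqrt (t - s) * (t - s)"
proof -
  define A1 where "A1 = L * (K + K\<^sup>2) * (1 + 32 * K ^ 4)"
  define A2 where "A2 = L * (K\<^sup>2 + K * (1 + 3 * K ^ 4) + (1 + 32 * K ^ 4))"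
  show thesis
  proof (rule that)
    fix s t :: real assume st: "0 \<le> s" "s < t" "t \<le> s + 1"
    have "\<bar>y - z\<bar> \<le> (c1 + c2) * w * h" if "\<bar>p + q - z\<bar> \<le> c1 * w * h" "\<bar>y - p - q\<bar> \<le> c2 * w * h"
      for p q y z c1 c2 w h :: real
      using that unfolding distrib_right by linarith
    from this[OF freezing_error[OF tf st, folded A1_def] Taylor_remainder_error[OF tf st, folded A2_def]]
    show "\<bar>(\<integral>\<omega>. v (Y t \<omega>) \<partial>M) - (\<integral>\<omega>. v (Y s \<omega>) \<partial>M) - (LBINT r:{s..t}. (\<integral>\<omega>. generator v1 v2 (Y r \<omega>) \<partial>M))\<bar>
      \<le> (A1 + A2) * sqrt (t - s) * (t - s)" .
  qed
qed

text \<open>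
  The error of order \<open>(t - s)\<^bsup>3/2\<^esup>\<close> in the local estimate forces the difference of the two sides to
  have derivative zero.
\<close>
lemma Dynkin:
  assumes tf: "test_function v v1 v2 L" and t: "0 \<le> t"
  shows "(\<integral>\<omega>. v (Y t \<omega>) \<partial>M) = v x + (LBINT r:{0..t}. (\<integral>\<omega>. generator v1 v2 (Y r \<omega>) \<partial>M))"
proof -
  note T = test_functionD[OF tf]
  note l = expectation_Y(1,2)[OF generator_bounds[OF tf]]
  define G where "G t = (\<integral>\<omega>. v (Y t \<omega>) \<partial>M) - (LBINT r:{0..t}. (\<integral>\<omega>. generator v1 v2 (Y r \<omega>) \<partial>M))" for t
  obtain C where C: "\<And>s t. 0 \<le> s \<Longrightarrow> s < t \<Longrightarrow> t \<le> s + 1 \<Longrightarrow>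
    \<bar>(\<integral>\<omega>. v (Y t \<omega>) \<partial>M) - (\<integral>\<omega>. v (Y s \<omega>) \<partial>M) - (LBINT r:{s..t}. (\<integral>\<omega>. generator v1 v2 (Y r \<omega>) \<partial>M))\<bar>
      \<le> C * sqrt (t - s) * (t - s)"
    by (rule local_Dynkin_estimate[OF tf], rule that)
  have G1: "\<bar>G t - G s\<bar> \<le> C * sqrt (t - s) * (t - s)" if "0 \<le> s" "s < t" "t \<le> s + 1" for s t
  proof -
    have "(LBINT r:{0..t}. (\<integral>\<omega>. generator v1 v2 (Y r \<omega>) \<partial>M)) = (LBINT r:{0..s}. (\<integral>\<omega>. generator v1 v2 (Y r \<omega>) \<partial>M))
      + (LBINT r:{s..t}. (\<integral>\<omega>. generator v1 v2 (Y r \<omega>) \<partial>M))"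
      by (rule set_integral_Icc_combine) (use l that in auto)
    then show ?thesis using C[OF that] unfolding G_def by linarith
  qed
  \<comment> \<open>Covers steps to both sides of \<open>u\<close>, as a derivative
    requires.\<close>
  have G2: "\<bar>G y - G u\<bar> \<le> C * sqrt \<bar>y - u\<bar> * \<bar>y - u\<bar>" if "0 \<le> u" "0 \<le> y" "\<bar>y - u\<bar> < 1" for u y
    using G1[of u y] G1[of y u] that by (cases u y rule: linorder_cases) (auto simp: abs_minus_commute)
  have "(G has_real_derivative 0) (at u within {0..})" if u: "u \<in> {0..}" for u
    unfolding has_field_derivative_iff
  proof (rule Lim_null_comparison)
    have "\<forall>\<^sub>F y in at u within {0..}. y \<in> {0..} \<and> y \<noteq> u \<and> dist y u < 1"
      using eventually_at[of "\<lambda>y. y \<in> {0..} \<and> y \<noteq> u \<and> dist y u < 1" u "{0..}"] zero_less_one by blast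
    then show "\<forall>\<^sub>F y in at u within {0..}. norm ((G y - G u) / (y - u)) \<le> C * sqrt \<bar>y - u\<bar>"
    proof eventually_elim
      case (elim y)
      then show ?case using G2[of u y] u by (simp add: dist_real_def field_simps)
    qed
    have "((\<lambda>y. C * sqrt \<bar>y - u\<bar>) \<longlongrightarrow> C * sqrt \<bar>u - u\<bar>) (at u within {0..})"
      by (intro tendsto_intros)
    then show "((\<lambda>y. C * sqrt \<bar>y - u\<bar>) \<longlongrightarrow> 0) (at u within {0..})" by simp
  qed
  then obtain c where c: "\<And>u. 0 \<le> u \<Longrightarrow> G u = c"
    using has_field_derivative_zero_constant[of "{0..}" G] by auto
  have "\<bar>LBINT r:{0..0}. (\<integral>\<omega>. generator v1 v2 (Y r \<omega>) \<partial>M)\<bar> \<le> (K * L + K\<^sup>2 / 2 * L) * (0 - 0)"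
    by (rule set_integral_Icc_bound) (use l in auto)
  then have "G 0 = (\<integral>\<omega>. v (Y 0 \<omega>) \<partial>M)" by (simp add: G_def)
  also have "\<dots> = (\<integral>\<omega>. v x \<partial>M)"
  proof (rule integral_cong_AE)
    have "AE \<omega> in M. X 0 \<omega> = x" using sol unfolding sde_solution_def by blast
    then show "AE \<omega> in M. v (Y 0 \<omega>) = v x" by eventually_elim (simp add: Y_def)
  qed (use T(8) in measurable)
  finally have "G 0 = v x" by (simp add: prob_space)
  then show ?thesis using c[OF order_refl] c[OF t] by (simp add: G_def)
qed

end

section \<open>The solution at an independent exponential time\<close>

locale exponential_sde = bounded_sde M F B b \<sigma> x X K
  for M :: "'a measure" and F B b \<sigma> x X K +
  fixes e :: "'a \<Rightarrow> real" and q :: real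
  assumes q: "0 < q" and e_dist: "distributed M lborel e (exponential_density q)"
    and e_indep: "indep_set
          (sets (vimage_algebra (space M) (\<lambda>\<omega>. \<lambda>t\<in>{0..}. X t \<omega>) (\<Pi>\<^sub>M t\<in>{0..}. borel)))
          (sets (vimage_algebra (space M) e borel))"
begin

text \<open>Going through \<open>Y\<close> gives a composition of measurable maps for all values of
  \<open>e\<close>, also negative ones. \<open>Z\<close> agrees with X at time e almost
  surely.\<close>

definition Z :: "'a \<Rightarrow> real" where "Z \<omega> = Y (e \<omega>) \<omega>"

lemma e_measurable[measurable]: "e \<in> borel_measurable M"
  using distributed_measurable[OF e_dist] by simp

lemma Z_measurable[measurable]: "Z \<in> borel_measurable M"
proof -
  have "(\<lambda>\<omega>. (\<omega>, e \<omega>)) \<in> M \<rightarrow>\<^sub>M M \<Otimes>\<^sub>M borel" by measurable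
  from measurable_compose[OF this Y_joint] show ?thesis unfolding Z_def[abs_def] by simp
qed

text \<open>Conditioning on \<open>e\<close> by Fubini. Independence is known for the
  \<sigma>-algebra \<open>G\<close> generated by the path, so the pair (\<omega>, e) has a product
  law when \<omega> is observed through \<open>G\<close>; therefore joint measurability of
  \<open>Y\<close> is established relative to \<open>G\<close>.\<close>

lemma law_of_Z:
  fixes g :: "real \<Rightarrow> real"
  assumes g[measurable]: "g \<in> borel_measurable borel" and bd: "\<And>y. \<bar>g y\<bar> \<le> L"
  shows "(\<integral>\<omega>. g (Z \<omega>) \<partial>M) = (LBINT t. exponential_density q t * (\<integral>\<omega>. g (Y t \<omega>) \<partial>M))"
proof -
  let ?\<Pi> = "\<Pi>\<^sub>M t\<in>{0::real..}. (borel :: real measure)"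
  define G where "G = vimage_algebra (space M) (\<lambda>\<omega>. \<lambda>t\<in>{0..}. X t \<omega>) ?\<Pi>"
  have spG: "space G = space M" by (simp add: G_def)
  have ind: "indep_set (sets G) (sets (vimage_algebra (space M) e borel))" using e_indep unfolding G_def .
  then have setsG: "sets G \<subseteq> sets M" by (simp add: indep_sets2_eq)
  have XG: "X t \<in> borel_measurable G" if "0 \<le> t" for t
  proof -
    have "(\<lambda>\<omega>. \<lambda>t\<in>{0..}. X t \<omega>) \<in> G \<rightarrow>\<^sub>M ?\<Pi>"
      unfolding G_def by (rule measurable_vimage_algebra1) (auto simp: space_PiM)
    from measurable_compose[OF this measurable_component_singleton[of t]] that show ?thesis by simp
  qed
  have YG: "(\<lambda>p. Y (snd p) (fst p)) \<in> borel_measurable (G \<Otimes>\<^sub>M borel)"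
    unfolding Y_def
    by (rule continuous_process_jointly_measurable[OF XG])
      (use sol in \<open>auto simp: sde_solution_def continuous_paths_def spG\<close>)
  have idG: "(\<lambda>\<omega>. \<omega>) \<in> M \<rightarrow>\<^sub>M G" using setsG by (intro measurableI) (auto simp: spG)
  interpret G: prob_space "distr M G (\<lambda>\<omega>. \<omega>)" by (rule prob_space_distr[OF idG])
  interpret E: prob_space "distr M borel e" by (rule prob_space_distr) measurable
  \<comment> \<open>The identity map pushes \<open>M\<close> to \<open>G\<close>; on rectangles the
    claim is the definition of independence.\<close>
  have joint: "distr M G (\<lambda>\<omega>. \<omega>) \<Otimes>\<^sub>M distr M borel e = distr M (G \<Otimes>\<^sub>M borel) (\<lambda>\<omega>. (\<omega>, e \<omega>))"
  proof (rule pair_measure_eqI)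
    show "sets (distr M G (\<lambda>\<omega>. \<omega>) \<Otimes>\<^sub>M distr M borel e) = sets (distr M (G \<Otimes>\<^sub>M borel) (\<lambda>\<omega>. (\<omega>, e \<omega>)))"
      by (simp cong: sets_pair_measure_cong)
    fix A C assume "A \<in> sets (distr M G (\<lambda>\<omega>. \<omega>))" "C \<in> sets (distr M borel e)"
    then have A: "A \<in> sets G" and C: "C \<in> sets borel" by auto
    let ?C = "e -` C \<inter> space M"
    have AM: "A \<in> sets M" "A \<inter> space M = A" using A setsG sets.sets_into_space[OF A] by (auto simp: spG)
    have CM: "?C \<in> sets M" using C by measurable
    have pm: "(\<lambda>\<omega>. (\<omega>, e \<omega>)) \<in> M \<rightarrow>\<^sub>M G \<Otimes>\<^sub>M borel" using idG by measurable
    have "prob (A \<inter> ?C) = prob A * prob ?C"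
      using ind A in_vimage_algebra[OF C] unfolding indep_sets2_eq by blast
    moreover have "(\<lambda>\<omega>. (\<omega>, e \<omega>)) -` (A \<times> C) \<inter> space M = A \<inter> ?C" using AM(2) by auto
    ultimately show "emeasure (distr M G (\<lambda>\<omega>. \<omega>)) A * emeasure (distr M borel e) C
        = emeasure (distr M (G \<Otimes>\<^sub>M borel) (\<lambda>\<omega>. (\<omega>, e \<omega>))) (A \<times> C)"
      using A C AM by (simp add: emeasure_distr idG pm emeasure_eq_measure ennreal_mult')
  qed (unfold_locales)
  interpret GE: pair_prob_space "distr M G (\<lambda>\<omega>. \<omega>)" "distr M borel e" ..
  have gm: "(\<lambda>p. g (Y (snd p) (fst p))) \<in> borel_measurable (G \<Otimes>\<^sub>M borel)"
    using measurable_compose[OF YG g] .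
  have "integrable (distr M G (\<lambda>\<omega>. \<omega>) \<Otimes>\<^sub>M distr M borel e) (\<lambda>p. g (Y (snd p) (fst p)))"
    by (rule GE.integrable_const_bound[of _ L]) (use bd gm in auto)
  then have int: "integrable (distr M G (\<lambda>\<omega>. \<omega>) \<Otimes>\<^sub>M distr M borel e) (\<lambda>(\<omega>, t). g (Y t \<omega>))"
    by (simp add: split_beta')
  have "(\<integral>\<omega>. g (Z \<omega>) \<partial>M) = (\<integral>p. g (Y (snd p) (fst p)) \<partial>distr M (G \<Otimes>\<^sub>M borel) (\<lambda>\<omega>. (\<omega>, e \<omega>)))"
    unfolding Z_def using idG by (subst integral_distr[OF _ gm]) auto
  also have "\<dots> = (\<integral>p. (\<lambda>(\<omega>, t). g (Y t \<omega>)) p \<partial>(distr M G (\<lambda>\<omega>. \<omega>) \<Otimes>\<^sub>M distr M borel e))"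
    unfolding joint by (simp add: split_beta')
  also have "\<dots> = (\<integral>t. (\<integral>\<omega>. g (Y t \<omega>) \<partial>distr M G (\<lambda>\<omega>. \<omega>)) \<partial>distr M borel e)"
    using GE.integral_snd[OF int] by simp
  also have "\<dots> = (\<integral>t. (\<integral>\<omega>. g (Y t \<omega>) \<partial>M) \<partial>distr M borel e)"
  proof (rule Bochner_Integration.integral_cong[OF refl])
    fix t
    have "(\<lambda>\<omega>. g (Y t \<omega>)) \<in> borel_measurable G"
      using XG[of "max 0 t"] by (auto simp: Y_def intro: measurable_compose[OF _ g])
    then show "(\<integral>\<omega>. g (Y t \<omega>) \<partial>distr M G (\<lambda>\<omega>. \<omega>)) = (\<integral>\<omega>. g (Y t \<omega>) \<partial>M)"
      by (rule integral_distr[OF idG])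
  qed
  also have "\<dots> = (\<integral>\<omega>. (\<lambda>t. \<integral>\<omega>. g (Y t \<omega>) \<partial>M) (e \<omega>) \<partial>M)"
    by (rule integral_distr[OF e_measurable expectation_Y(1)[OF g bd]])
  also have "\<dots> = (LBINT t. exponential_density q t * (\<integral>\<omega>. g (Y t \<omega>) \<partial>M))"
    by (rule distributed_integral[OF e_dist, symmetric])
      (use expectation_Y(1)[OF g bd] q in \<open>auto simp: erlang_density_nonneg\<close>)
  finally show ?thesis .
qed

section \<open>Laplace transform of Dynkin's formula\<close>

lemma exponential_tail_integral:
  assumes r: "0 \<le> r"
  shows "(LBINT t. exponential_density q t * indicator {r..} t) = exp (- q * r)"
    and "integrable lborel (\<lambda>t. exponential_density q t * indicator {r..} t)"
    and "integrable lborel (exponential_density q)" and "(LBINT t. exponential_density q t) = 1"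
proof -
  have nn: "0 \<le> exponential_density q t" for t using q by (simp add: exponential_density_def)
  \<comment> \<open>The integral is not computed but read off as the probability that
    \<open>e\<close> exceeds \<open>r\<close>, after replacing {r..} by {r<..} up to a null
    set.\<close>
  have "(LBINT t. exponential_density q t * indicator {r..} t) = (LBINT t. exponential_density q t * indicator {r<..} t)"
    by (rule integral_cong_AE)
      (use AE_lborel_singleton[of r] in \<open>auto simp: indicator_def elim: eventually_mono\<close>)
  also have "\<dots> = (\<integral>\<omega>. indicator {r<..} (e \<omega>) \<partial>M)"
    by (rule distributed_integral[OF e_dist]) (use nn in auto)
  also have "\<dots> = (\<integral>\<omega>. indicator {\<omega>\<in>space M. r < e \<omega>} \<omega> \<partial>M)"
    by (rule Bochner_Integration.integral_cong) (auto simp: indicator_def)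
  also have "\<dots> = prob {\<omega>\<in>space M. r < e \<omega>}" by simp
  also have "\<dots> = exp (- q * r)" using exponential_distributedD_gt[OF e_dist r q] by (simp add: mult.commute)
  finally show "(LBINT t. exponential_density q t * indicator {r..} t) = exp (- q * r)" .
  have "integrable M (\<lambda>\<omega>. indicator {r..} (e \<omega>) :: real)"
    by (rule integrable_const_bound[of _ 1]) (auto simp: indicator_def)
  then show "integrable lborel (\<lambda>t. exponential_density q t * indicator {r..} t)"
    by (subst distributed_integrable[OF e_dist]) (use nn in auto)
  show "integrable lborel (exponential_density q)"
    using distributed_integrable[OF e_dist, of "\<lambda>_. 1"] nn by simp
  show "(LBINT t. exponential_density q t) = 1"
    using distributed_integral[OF e_dist, of "\<lambda>_. 1"] nn by (simp add: prob_space)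
qed

text \<open>Fubini on the region 0 \<le> r \<le> t: the mass of the density beyond \<open>r\<close>
  is exp (- q r), the density at \<open>r\<close> divided by \<open>q\<close>.\<close>

lemma exponential_integral_by_parts:
  fixes l :: "real \<Rightarrow> real"
  assumes l[measurable]: "l \<in> borel_measurable borel" and bd: "\<And>r. \<bar>l r\<bar> \<le> L"
  shows "(LBINT t. exponential_density q t * (LBINT r:{0..t}. l r)) = (LBINT r. exponential_density q r * l r) / q"
proof -
  have nn: "0 \<le> exponential_density q t" for t using q by (simp add: exponential_density_def)
  let ?f = "\<lambda>r t. exponential_density q t * indicator {r..} t * (indicator {0..} r * l r)"
  have L: "0 \<le> L" using bd[of 0] by linarith
  have fm: "(\<lambda>(r, t). ?f r t) \<in> borel_measurable (lborel \<Otimes>\<^sub>M lborel)"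
  proof -
    have "(\<lambda>p :: real \<times> real. indicator {fst p..} (snd p) :: real) = (\<lambda>p. if fst p \<le> snd p then 1 else 0)" by (auto simp: indicator_def)
    then have [measurable]: "(\<lambda>p :: real \<times> real. indicator {fst p..} (snd p) :: real) \<in> borel_measurable (lborel \<Otimes>\<^sub>M lborel)"
      by (simp only:) measurable
    show ?thesis unfolding split_beta' by measurable
  qed
  have it: "(LBINT t. ?f r t) = exponential_density q r * l r / q" for r
  proof (cases "0 \<le> r")
    case True
    have "(LBINT t. ?f r t) = (LBINT t. exponential_density q t * indicator {r..} t) * (indicator {0..} r * l r)"
      by (rule integral_mult_left_zero)
    then show ?thesis using exponential_tail_integral(1)[OF True] True q by (simp add: exponential_density_def mult.commute)
  next
    case False
    then show ?thesis by (simp add: exponential_density_def)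
  qed
  have ii: "integrable lborel (\<lambda>t. ?f r t)" for r
    using exponential_tail_integral(2)[of r] by (cases "0 \<le> r") auto
  have "integrable (lborel \<Otimes>\<^sub>M lborel) (\<lambda>(r, t). ?f r t)"
  proof (rule lborel_pair.Fubini_integrable[OF fm])
    have "integrable lborel (\<lambda>r. L / q * exponential_density q r)"
      using exponential_tail_integral(3)[of 0] by simp
    then show "integrable lborel (\<lambda>r. LBINT t. norm (case (r, t) of (r, t) \<Rightarrow> ?f r t))"
    proof (rule Bochner_Integration.integrable_bound)
      show "AE r in lborel. norm (LBINT t. norm (case (r, t) of (r, t) \<Rightarrow> ?f r t)) \<le> norm (L / q * exponential_density q r)"
      proof (rule AE_I2)
        fix r
        have "norm (case (r, t) of (r, t) \<Rightarrow> ?f r t) = exponential_density q t * indicator {r..} t * \<bar>indicator {0..} r * l r\<bar>" for t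
          using nn[of t] by (simp add: abs_mult)
        then have "(LBINT t. norm (case (r, t) of (r, t) \<Rightarrow> ?f r t))
           = (LBINT t. exponential_density q t * indicator {r..} t) * \<bar>indicator {0..} r * l r\<bar>"
          by (simp only: integral_mult_left_zero)
        also have "\<dots> = exponential_density q r / q * \<bar>l r\<bar>"
          using exponential_tail_integral(1)[of r] q by (cases "0 \<le> r") (auto simp: exponential_density_def mult.commute)
        finally have eq: "(LBINT t. norm (case (r, t) of (r, t) \<Rightarrow> ?f r t)) = exponential_density q r / q * \<bar>l r\<bar>" .
        have "exponential_density q r / q * \<bar>l r\<bar> \<le> exponential_density q r / q * L"
          using nn[of r] q bd[of r] by (intro mult_left_mono) auto
        then show "norm (LBINT t. norm (case (r, t) of (r, t) \<Rightarrow> ?f r t)) \<le> norm (L / q * exponential_density q r)"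
          unfolding eq using nn[of r] q L by (simp add: abs_mult mult.commute)
      qed
      show "(\<lambda>r. LBINT t. norm (case (r, t) of (r, t) \<Rightarrow> ?f r t)) \<in> borel_measurable lborel"
        using fm by measurable
    qed
    show "AE r in lborel. integrable lborel (\<lambda>t. case (r, t) of (r, t) \<Rightarrow> ?f r t)" using ii by simp
  qed
  from lborel_pair.Fubini_integral[OF this]
  have "(LBINT t. LBINT r. ?f r t) = (LBINT r. LBINT t. ?f r t)" .
  moreover have "(LBINT r. ?f r t) = exponential_density q t * (LBINT r:{0..t}. l r)" for t
  proof -
    have "?f r t = exponential_density q t * (indicator {0..t} r *\<^sub>R l r)" for r by (auto simp: indicator_def)
    then show ?thesis unfolding set_lebesgue_integral_def by (simp only: integral_mult_right_zero)
  qed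
  ultimately show ?thesis unfolding it by simp
qed

text \<open>Averaging Dynkin's formula over the exponential time turns the time integral into the
  mean of the generator at \<open>Z\<close>, divided by \<open>q\<close>.\<close>

lemma resolvent_equation_smooth:
  assumes tf: "test_function v v1 v2 L"
  shows "(\<integral>\<omega>. q * v (Z \<omega>) - generator v1 v2 (Z \<omega>) \<partial>M) = q * v x"
proof -
  note T = test_functionD[OF tf]
  note gb = generator_bounds[OF tf]
  note l = expectation_Y(1,2)[OF gb]
  note ev = expectation_Y(1,2)[OF T(8) T(3)]
  let ?l = "\<lambda>r. \<integral>\<omega>. generator v1 v2 (Y r \<omega>) \<partial>M"
  have dens: "integrable lborel (\<lambda>t. exponential_density q t * c)" for c
    using exponential_tail_integral(3)[of 0] by simp
  have "(\<integral>\<omega>. v (Z \<omega>) \<partial>M) = (LBINT t. exponential_density q t * (\<integral>\<omega>. v (Y t \<omega>) \<partial>M))"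
    by (rule law_of_Z[OF T(8) T(3)])
  also have "\<dots> = (LBINT t. exponential_density q t * v x + exponential_density q t * (LBINT r:{0..t}. ?l r))"
  proof (rule Bochner_Integration.integral_cong[OF refl])
    fix t show "exponential_density q t * (\<integral>\<omega>. v (Y t \<omega>) \<partial>M) = exponential_density q t * v x + exponential_density q t * (LBINT r:{0..t}. ?l r)"
      using Dynkin[OF tf, of t] by (cases "0 \<le> t") (auto simp: exponential_density_def algebra_simps)
  qed
  also have "\<dots> = v x + (LBINT r. exponential_density q r * ?l r) / q"
  proof -
    have "integrable lborel (\<lambda>t. exponential_density q t * (\<integral>\<omega>. v (Y t \<omega>) \<partial>M))"
    proof (rule Bochner_Integration.integrable_bound[OF dens[of L]])
      show "AE t in lborel. norm (exponential_density q t * (\<integral>\<omega>. v (Y t \<omega>) \<partial>M)) \<le> norm (exponential_density q t * L)"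
        using ev(2) T(11) by (intro AE_I2) (auto simp: abs_mult intro!: mult_left_mono)
    qed (use ev(1) in measurable)
    then have "integrable lborel (\<lambda>t. exponential_density q t * (\<integral>\<omega>. v (Y t \<omega>) \<partial>M) - exponential_density q t * v x)"
      using dens by (rule Bochner_Integration.integrable_diff)
    moreover have "exponential_density q t * (\<integral>\<omega>. v (Y t \<omega>) \<partial>M) - exponential_density q t * v x = exponential_density q t * (LBINT r:{0..t}. ?l r)" for t
      using Dynkin[OF tf, of t] by (cases "0 \<le> t") (auto simp: exponential_density_def algebra_simps)
    ultimately have "integrable lborel (\<lambda>t. exponential_density q t * (LBINT r:{0..t}. ?l r))" by simp
    then show ?thesis
      using dens exponential_tail_integral(4)[of 0] exponential_integral_by_parts[OF l]
      by simp
  qed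
  also have "(LBINT r. exponential_density q r * ?l r) = (\<integral>\<omega>. generator v1 v2 (Z \<omega>) \<partial>M)"
    by (rule law_of_Z[OF gb, symmetric])
  finally have eq: "(\<integral>\<omega>. v (Z \<omega>) \<partial>M) = v x + (\<integral>\<omega>. generator v1 v2 (Z \<omega>) \<partial>M) / q" .
  note [measurable] = T(8) gb(1)
  have "integrable M (\<lambda>\<omega>. v (Z \<omega>))" by (rule integrable_const_bound[of _ L]) (use T(3) in auto)
  moreover have "integrable M (\<lambda>\<omega>. generator v1 v2 (Z \<omega>))" by (rule integrable_const_bound) (use gb(2) in auto)
  ultimately show ?thesis using eq q by (simp add: field_simps)
qed

end

section \<open>From smooth test functions to one-sided second derivatives\<close>

lemma DERIV_difference_quotient_sequence:
  fixes f :: "real \<Rightarrow> real"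
  assumes f: "(f has_real_derivative D) (at y)" and h: "h \<longlonglongrightarrow> 0" "\<And>n::nat. h n \<noteq> 0"
  shows "(\<lambda>n. (f (y + h n) - f y) / h n) \<longlonglongrightarrow> D"
proof -
  have "filterlim h (at 0) sequentially" using h by (auto simp: filterlim_at)
  moreover have "((\<lambda>k. (f (y + k) - f y) / k) \<longlongrightarrow> D) (at 0)" using f by (simp add: DERIV_def)
  ultimately show ?thesis by (rule filterlim_compose[rotated])
qed

lemma difference_quotient_bound:
  fixes f :: "real \<Rightarrow> real"
  assumes "\<And>y z. \<bar>f y - f z\<bar> \<le> L * \<bar>y - z\<bar>" "h \<noteq> 0"
  shows "\<bar>(f (y + h) - f y) / h\<bar> \<le> L"
proof -
  have "\<bar>f (y + h) - f y\<bar> \<le> L * \<bar>h\<bar>" using assms(1)[of "y + h" y] by simp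
  then show ?thesis using assms(2) by (simp add: pos_divide_le_eq)
qed

text \<open>Quotients of Lipschitz functions are bounded by \<open>L\<close> whatever
  \<open>h\<close> is; only the Lipschitz constant of the second derivative, 2 L / |h|, degenerates
  as h tends to 0. That is harmless, since the constant does not appear in the resolvent equation
  for a fixed h.\<close>

lemma test_function_difference_quotient:
  fixes V v v1 :: "real \<Rightarrow> real"
  assumes V: "\<And>y. (V has_real_derivative v y) (at y)" and v: "\<And>y. (v has_real_derivative v1 y) (at y)"
    and b: "\<And>y. \<bar>v y\<bar> \<le> L" "\<And>y. \<bar>v1 y\<bar> \<le> L" "\<And>y z. \<bar>v1 y - v1 z\<bar> \<le> L * \<bar>y - z\<bar>" and h: "h \<noteq> 0"
  shows "test_function (\<lambda>y. (V (y + h) - V y) / h) (\<lambda>y. (v (y + h) - v y) / h) (\<lambda>y. (v1 (y + h) - v1 y) / h)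
    (L + 2 * L / \<bar>h\<bar>)"
proof -
  have L: "0 \<le> L" using b(1)[of 0] by linarith
  have Lh: "0 \<le> 2 * L / \<bar>h\<bar>" using L by simp
  have D: "((\<lambda>y. (f (y + h) - f y) / h) has_real_derivative (f' (y + h) - f' y) / h) (at y)"
    if "\<And>y. (f has_real_derivative f' y) (at y)" for f f' y
    using that[of "y + h"] that[of y] by (auto intro!: DERIV_cdivide DERIV_diff simp: DERIV_shift)
  have lip: "\<bar>f y - f z\<bar> \<le> L * \<bar>y - z\<bar>" if "\<And>y. (f has_real_derivative f' y) (at y)" "\<And>y. \<bar>f' y\<bar> \<le> L" for f f' y z
    by (rule Lipschitz_of_bounded_derivative[of f f', OF that])
  have le: "u \<le> L + 2 * L / \<bar>h\<bar>" if "u \<le> L" for u using that Lh by linarith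
  show ?thesis
    unfolding test_function_def
  proof (intro conjI allI)
    fix y z
    show "((\<lambda>y. (V (y + h) - V y) / h) has_real_derivative (v (y + h) - v y) / h) (at y)" by (rule D[OF V])
    show "((\<lambda>y. (v (y + h) - v y) / h) has_real_derivative (v1 (y + h) - v1 y) / h) (at y)" by (rule D[OF v])
    show "\<bar>(V (y + h) - V y) / h\<bar> \<le> L + 2 * L / \<bar>h\<bar>"
      by (intro le difference_quotient_bound lip[OF V b(1)] h)
    show "\<bar>(v (y + h) - v y) / h\<bar> \<le> L + 2 * L / \<bar>h\<bar>"
      by (intro le difference_quotient_bound lip[OF v b(2)] h)
    show "\<bar>(v1 (y + h) - v1 y) / h\<bar> \<le> L + 2 * L / \<bar>h\<bar>"
      by (intro le difference_quotient_bound b(3) h)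
    have "(v1 (y + h) - v1 y) / h - (v1 (z + h) - v1 z) / h = ((v1 (y + h) - v1 (z + h)) - (v1 y - v1 z)) / h"
      by (simp add: diff_divide_distrib)
    also have "\<bar>\<dots>\<bar> \<le> (2 * L * \<bar>y - z\<bar>) / \<bar>h\<bar>"
      unfolding abs_divide using b(3)[of "y + h" "z + h"] b(3)[of y z] by (intro divide_right_mono) auto
    also have "\<dots> = 2 * L / \<bar>h\<bar> * \<bar>y - z\<bar>" by simp
    also have "\<dots> \<le> (L + 2 * L / \<bar>h\<bar>) * \<bar>y - z\<bar>" using L by (intro mult_right_mono) auto
    finally show "\<bar>(v1 (y + h) - v1 y) / h - (v1 (z + h) - v1 z) / h\<bar> \<le> (L + 2 * L / \<bar>h\<bar>) * \<bar>y - z\<bar>" .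
  qed
qed

context exponential_sde begin

text \<open>
  The difference quotients of an antiderivative of \<open>v\<close> are admissible test functions, and their second
  derivatives are the difference quotients of \<open>v1\<close>. Hence at a kink of \<open>v1\<close> the one-sided second
  derivative enters, on the side prescribed by the sign of \<open>h\<close>.
\<close>
lemma resolvent_equation:
  fixes v v1 v2 :: "real \<Rightarrow> real"
  assumes v: "\<And>y. (v has_real_derivative v1 y) (at y)"
    and b: "\<And>y. \<bar>v y\<bar> \<le> L" "\<And>y. \<bar>v1 y\<bar> \<le> L" "\<And>y z. \<bar>v1 y - v1 z\<bar> \<le> L * \<bar>y - z\<bar>"
    and h: "h \<longlonglongrightarrow> 0" "\<And>n::nat. h n \<noteq> 0"
    and v2: "\<And>y. (\<lambda>n. (v1 (y + h n) - v1 y) / h n) \<longlonglongrightarrow> v2 y"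
  shows "(\<integral>\<omega>. q * v (Z \<omega>) - generator v1 v2 (Z \<omega>) \<partial>M) = q * v x"
    and "integrable M (\<lambda>\<omega>. q * v (Z \<omega>) - generator v1 v2 (Z \<omega>))"
proof -
  have L: "0 \<le> L" using b(1)[of 0] by linarith
  obtain V where V: "\<And>y. (V has_real_derivative v y) (at y)"
  proof -
    have "\<exists>V. \<forall>y. -\<infinity> < ereal y \<longrightarrow> ereal y < \<infinity> \<longrightarrow> (V has_vector_derivative v y) (at y)"
      by (rule einterval_antiderivative) (use DERIV_isCont[OF v] in auto)
    then show thesis using that by (auto simp: has_real_derivative_iff_has_vector_derivative)
  qed
  let ?v = "\<lambda>n y. (V (y + h n) - V y) / h n"
  let ?v1 = "\<lambda>n y. (v (y + h n) - v y) / h n"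
  let ?v2 = "\<lambda>n y. (v1 (y + h n) - v1 y) / h n"
  have tf: "test_function (?v n) (?v1 n) (?v2 n) (L + 2 * L / \<bar>h n\<bar>)" for n
    by (rule test_function_difference_quotient[OF V v b h(2)])
  \<comment> \<open>These bounds, unlike the constant in \<open>tf\<close>, are independent of
    \<open>n\<close>; they furnish the dominating constant in \<open>gb\<close>.\<close>
  have bv: "\<bar>?v n y\<bar> \<le> L" "\<bar>?v1 n y\<bar> \<le> L" "\<bar>?v2 n y\<bar> \<le> L" for n y
    by (rule difference_quotient_bound[OF _ h(2)], rule Lipschitz_of_bounded_derivative[OF V b(1)]
        difference_quotient_bound[OF _ h(2)] Lipschitz_of_bounded_derivative[OF v b(2)] b(3))+
  have lim: "(\<lambda>n. q * ?v n y - generator (?v1 n) (?v2 n) y) \<longlonglongrightarrow> q * v y - generator v1 v2 y" for y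
    unfolding generator_def
    by (intro tendsto_intros DERIV_difference_quotient_sequence[OF V h] DERIV_difference_quotient_sequence[OF v h] v2)
  have m: "(\<lambda>y. q * ?v n y - generator (?v1 n) (?v2 n) y) \<in> borel_measurable borel" for n
    using test_functionD(8)[OF tf] generator_bounds(1)[OF tf] by measurable
  \<comment> \<open>\<open>v2\<close> is only known as a pointwise limit, and measurability of the
    limiting integrand is obtained from that.\<close>
  have m': "(\<lambda>y. q * v y - generator v1 v2 y) \<in> borel_measurable borel"
    by (rule borel_measurable_LIMSEQ_real[OF lim m])
  have gb: "\<bar>q * ?v n y - generator (?v1 n) (?v2 n) y\<bar> \<le> q * L + (K * L + K\<^sup>2 / 2 * L)" for n y
  proof -
    have "\<bar>q * ?v n y\<bar> \<le> q * L" unfolding abs_mult using q by (intro mult_mono bv) auto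
    moreover have "\<bar>b y * ?v1 n y\<bar> \<le> K * L"
      unfolding abs_mult by (intro mult_mono b_bound bv K_nonneg) auto
    moreover have "\<bar>(\<sigma> y)\<^sup>2 / 2 * ?v2 n y\<bar> \<le> K\<^sup>2 / 2 * L"
      unfolding abs_mult using power_mono[OF s_bound[of y], of 2] by (intro mult_mono bv) auto
    ultimately show ?thesis unfolding generator_def by linarith
  qed
  have "(\<lambda>n. \<integral>\<omega>. q * ?v n (Z \<omega>) - generator (?v1 n) (?v2 n) (Z \<omega>) \<partial>M) \<longlonglongrightarrow> (\<integral>\<omega>. q * v (Z \<omega>) - generator v1 v2 (Z \<omega>) \<partial>M)"
    by (rule integral_dominated_convergence[where w = "\<lambda>_. q * L + (K * L + K\<^sup>2 / 2 * L)"])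
      (use measurable_compose[OF Z_measurable m] measurable_compose[OF Z_measurable m'] lim gb in auto)
  moreover have "(\<lambda>n. \<integral>\<omega>. q * ?v n (Z \<omega>) - generator (?v1 n) (?v2 n) (Z \<omega>) \<partial>M) \<longlonglongrightarrow> q * v x"
    unfolding resolvent_equation_smooth[OF tf]
    by (intro tendsto_intros DERIV_difference_quotient_sequence[OF V h])
  ultimately show "(\<integral>\<omega>. q * v (Z \<omega>) - generator v1 v2 (Z \<omega>) \<partial>M) = q * v x" by (rule LIMSEQ_unique)
  show "integrable M (\<lambda>\<omega>. q * v (Z \<omega>) - generator v1 v2 (Z \<omega>))"
  proof (rule integrable_const_bound[OF AE_I2])
    fix \<omega>
    have "\<bar>q * v (Z \<omega>) - generator v1 v2 (Z \<omega>)\<bar> \<le> q * L + (K * L + K\<^sup>2 / 2 * L)"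
      by (rule LIMSEQ_le_const2[OF tendsto_rabs[OF lim]]) (use gb in auto)
    then show "norm (q * v (Z \<omega>) - generator v1 v2 (Z \<omega>)) \<le> q * L + (K * L + K\<^sup>2 / 2 * L)" by simp
  qed (rule measurable_compose[OF Z_measurable m'])
qed

end

section \<open>Functions glued at a point\<close>

lemma DERIV_If_le:
  fixes f g :: "real \<Rightarrow> real"
  assumes f: "\<And>y. y \<le> c \<Longrightarrow> (f has_real_derivative f' y) (at y)" and g: "\<And>y. c \<le> y \<Longrightarrow> (g has_real_derivative g' y) (at y)"
    and eq: "f c = g c" "f' c = g' c"
  shows "((\<lambda>y. if y \<le> c then f y else g y) has_real_derivative (if y \<le> c then f' y else g' y)) (at y)"
proof -
  consider "y < c" | "y = c" | "c < y" by linarith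
  then show ?thesis
  proof cases
    case 1
    have "((\<lambda>y. if y \<le> c then f y else g y) has_real_derivative f' y) (at y)"
      by (rule has_field_derivative_transform_within_open[OF f, of y "{..<c}"]) (use 1 in auto)
    then show ?thesis using 1 by simp
  next
    case 3
    have "((\<lambda>y. if y \<le> c then f y else g y) has_real_derivative g' y) (at y)"
      by (rule has_field_derivative_transform_within_open[OF g, of y "{c<..}"]) (use 3 in auto)
    then show ?thesis using 3 by simp
  next
    case 2
    have "((\<lambda>y. if y \<le> c then f y else g y) has_real_derivative f' c) (at c within {..c})"
      by (rule has_field_derivative_transform_within[OF has_field_derivative_at_within[OF f, of c] zero_less_one]) auto
    moreover have "((\<lambda>y. if y \<le> c then f y else g y) has_real_derivative f' c) (at c within {c..})"
      unfolding eq(2)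
      by (rule has_field_derivative_transform_within[OF has_field_derivative_at_within[OF g, of c] zero_less_one]) (use eq(1) in auto)
    ultimately have "((\<lambda>y. if y \<le> c then f y else g y) has_real_derivative f' c) (at c within {..c} \<union> {c..})"
      unfolding has_field_derivative_iff Lim_within_Un by simp
    moreover have "{..c} \<union> {c..} = UNIV" by auto
    ultimately show ?thesis using 2 by simp
  qed
qed

text \<open>Across \<open>c\<close> the segment is split at \<open>c\<close>, where the branches
  agree. The set \<open>S\<close> lets the lemma be nested, first at \<open>z\<close> on [a, inf),
  then at \<open>a\<close> on the whole line.\<close>

lemma Lipschitz_If_le:
  fixes f g :: "real \<Rightarrow> real"
  assumes f: "\<And>y z. y \<in> S \<Longrightarrow> z \<in> S \<Longrightarrow> y \<le> c \<Longrightarrow> z \<le> c \<Longrightarrow> \<bar>f y - f z\<bar> \<le> L * \<bar>y - z\<bar>"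
    and g: "\<And>y z. y \<in> S \<Longrightarrow> z \<in> S \<Longrightarrow> c \<le> y \<Longrightarrow> c \<le> z \<Longrightarrow> \<bar>g y - g z\<bar> \<le> L * \<bar>y - z\<bar>"
    and eq: "f c = g c" and c: "c \<in> S" and yz: "y \<in> S" "z \<in> S"
  shows "\<bar>(if y \<le> c then f y else g y) - (if z \<le> c then f z else g z)\<bar> \<le> L * \<bar>y - z\<bar>"
proof -
  have *: "\<bar>f u - g w\<bar> \<le> L * \<bar>u - w\<bar>" if "u \<le> c" "c \<le> w" "u \<in> S" "w \<in> S" for u w
  proof -
    have "\<bar>f u - g w\<bar> \<le> L * \<bar>u - c\<bar> + L * \<bar>c - w\<bar>"
      using f[of u c] g[of c w] that c eq by auto
    also have "\<dots> = L * \<bar>u - w\<bar>" using that by (simp add: algebra_simps)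
    finally show ?thesis .
  qed
  show ?thesis
    using *[of y z] *[of z y] f[of y z] g[of y z] yz by (auto simp: abs_minus_commute)
qed

text \<open>With negative steps the point y = c stays in the left branch, and a point y > c
  eventually stays in the right one. The outcome follows the same convention
  \<open>y \<le> c\<close> as the coefficients at \<open>a\<close>.\<close>

lemma left_quotient_If_le:
  fixes f g :: "real \<Rightarrow> real"
  assumes h: "h \<longlonglongrightarrow> 0" "\<And>n::nat. h n < 0"
    and f: "\<And>y. (\<lambda>n. (f (y + h n) - f y) / h n) \<longlonglongrightarrow> f' y"
    and g: "\<And>y. (\<lambda>n. (g (y + h n) - g y) / h n) \<longlonglongrightarrow> g' y"
  shows "(\<lambda>n. ((if y + h n \<le> c then f (y + h n) else g (y + h n)) - (if y \<le> c then f y else g y)) / h n)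
    \<longlonglongrightarrow> (if y \<le> c then f' y else g' y)"
proof (cases "y \<le> c")
  case True
  then have "y + h n \<le> c" for n using h(2)[of n] by linarith
  then show ?thesis using f[of y] True by simp
next
  case False
  then have "\<forall>\<^sub>F n in sequentially. c - y < h n" using order_tendstoD(1)[OF h(1), of "c - y"] by simp
  then have "\<forall>\<^sub>F n in sequentially. (g (y + h n) - g y) / h n
      = ((if y + h n \<le> c then f (y + h n) else g (y + h n)) - (if y \<le> c then f y else g y)) / h n"
    by eventually_elim (use False in auto)
  from Lim_transform_eventually[OF g this] show ?thesis using False by simp
qed

section \<open>The explicit resolvent\<close>

lemma bounded_derivative_Lipschitz_on:
  fixes f :: "real \<Rightarrow> real"
  assumes "convex S" "\<And>y. (f has_real_derivative f' y) (at y)" "\<And>y. y \<in> S \<Longrightarrow> \<bar>f' y\<bar> \<le> L" "y \<in> S" "z \<in> S"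
  shows "\<bar>f y - f z\<bar> \<le> L * \<bar>y - z\<bar>"
proof -
  have "norm (f y - f z) \<le> L * norm (y - z)"
    by (rule field_differentiable_bound[of S f f']) (use assms in \<open>auto intro: has_field_derivative_at_within\<close>)
  then show ?thesis by simp
qed

lemma bounded_exp_image:
  assumes "\<And>y. y \<in> S \<Longrightarrow> r * (y - a) \<le> R"
  shows "bounded ((\<lambda>y::real. c * exp (r * (y - a))) ` S)"
proof (rule boundedI[of _ "\<bar>c\<bar> * exp R"])
  fix u assume "u \<in> (\<lambda>y. c * exp (r * (y - a))) ` S"
  then show "norm u \<le> \<bar>c\<bar> * exp R" using assms by (auto simp: abs_mult intro!: mult_left_mono)
qed

context exponential_sde begin

text \<open>
  The second derivative of the test function jumps at \<open>c\<close>; the left and the right version of the resolvent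
  equation differ by \<open>\<sigma>(c)\<^sup>2/2\<close> times the mass of the atom.
\<close>
lemma no_atom:
  assumes s: "\<sigma> c \<noteq> 0"
  shows "prob {\<omega>\<in>space M. Z \<omega> = c} = 0"
proof -
  \<comment> \<open>With t = y - c this is 1 - (1 + t) exp (- t), the integral of t exp (- t): value
    and slope vanish at c, the second derivative is 1 there, and all three are bounded by 1 for t
    \<ge> 0.\<close>
  let ?g = "\<lambda>y. 1 - (1 + (y - c)) * exp (- (y - c))" and ?g1 = "\<lambda>y. (y - c) * exp (- (y - c))"
    and ?g2 = "\<lambda>y. (1 - (y - c)) * exp (- (y - c))"
  let ?v = "\<lambda>y. if y \<le> c then 0 else ?g y" and ?v1 = "\<lambda>y. if y \<le> c then 0 else ?g1 y"
  have g: "(?g has_real_derivative ?g1 y) (at y)" for y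
    by (auto intro!: derivative_eq_intros simp: algebra_simps)
  have g1: "(?g1 has_real_derivative ?g2 y) (at y)" for y
    by (auto intro!: derivative_eq_intros simp: algebra_simps)
  have v: "(?v has_real_derivative ?v1 y) (at y)" for y
    by (rule DERIV_If_le) (use g in auto)
  have e: "(1 + t) * exp (- t) \<le> 1" if "0 \<le> t" for t :: real
    using exp_ge_add_one_self[of t] by (simp add: exp_minus field_simps)
  have gb: "\<bar>?g y\<bar> \<le> 1" "\<bar>?g1 y\<bar> \<le> 1" "\<bar>?g2 y\<bar> \<le> 1" if "c \<le> y" for y
  proof -
    have t: "0 \<le> y - c" using that by simp
    have nn: "0 \<le> (1 + (y - c)) * exp (- (y - c))" using t by simp
    show "\<bar>?g y\<bar> \<le> 1" using e[OF t] nn by linarith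
    have "\<bar>(y - c) * exp (- (y - c))\<bar> \<le> (1 + (y - c)) * exp (- (y - c))"
      unfolding abs_mult using t by (intro mult_mono) auto
    then show "\<bar>?g1 y\<bar> \<le> 1" using e[OF t] by linarith
    have "\<bar>(1 - (y - c)) * exp (- (y - c))\<bar> \<le> (1 + (y - c)) * exp (- (y - c))"
      unfolding abs_mult using t by (intro mult_mono) auto
    then show "\<bar>?g2 y\<bar> \<le> 1" using e[OF t] by linarith
  qed
  have b: "\<bar>?v y\<bar> \<le> 1" "\<bar>?v1 y\<bar> \<le> 1" for y using gb[of y] by auto
  have lip: "\<bar>?v1 y - ?v1 z\<bar> \<le> 1 * \<bar>y - z\<bar>" for y z
  proof (rule Lipschitz_If_le[of UNIV])
    show "\<bar>?g1 y - ?g1 z\<bar> \<le> 1 * \<bar>y - z\<bar>" if "c \<le> y" "c \<le> z" for y z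
      by (rule bounded_derivative_Lipschitz_on[of "{c..}", OF _ g1 gb(3)]) (use that in auto)
  qed auto
  let ?h = "\<lambda>n. 1 / real (Suc n)"
  have h: "?h \<longlonglongrightarrow> 0" by (rule lim_inverse_n'[THEN LIMSEQ_Suc])
  then have h': "(\<lambda>n. - ?h n) \<longlonglongrightarrow> 0" using tendsto_minus by fastforce
  \<comment> \<open>Left and right second derivatives of \<open>?v\<close>; they differ at
    \<open>c\<close> only, where they are 0 and 1.\<close>
  let ?l = "\<lambda>y. if y \<le> c then 0 else ?g2 y" and ?r = "\<lambda>y. if y < c then 0 else ?g2 y"
  have nz: "- ?h n \<noteq> 0" "?h n \<noteq> 0" "- ?h n < 0" for n by auto
  have L: "(\<lambda>n. (?v1 (y + - ?h n) - ?v1 y) / - ?h n) \<longlonglongrightarrow> ?l y" for y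
    by (rule left_quotient_If_le[where f = "\<lambda>_. 0" and f' = "\<lambda>_. 0" and g = ?g1 and g' = ?g2,
          OF h' nz(3) _ DERIV_difference_quotient_sequence[OF g1 h' nz(1)]]) simp
  have R: "(\<lambda>n. (?v1 (y + ?h n) - ?v1 y) / ?h n) \<longlonglongrightarrow> ?r y" for y
  proof (cases "y < c")
    case True
    then have "\<forall>\<^sub>F n in sequentially. ?h n < c - y" using order_tendstoD(2)[OF h, of "c - y"] by simp
    then have "\<forall>\<^sub>F n in sequentially. (?v1 (y + ?h n) - ?v1 y) / ?h n = ?r y"
      by eventually_elim (use True in auto)
    then show ?thesis by (rule tendsto_eventually)
  next
    case False
    have "?v1 (y + ?h n) = ?g1 (y + ?h n)" for n
    proof -
      have "0 < ?h n" by simp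
      then have "c < y + ?h n" using False by linarith
      then show ?thesis by simp
    qed
    moreover have "?v1 y = ?g1 y" using False by (cases "y = c") auto
    ultimately show ?thesis using DERIV_difference_quotient_sequence[OF g1 h nz(2), of y] False by (simp only: if_False)
  qed
  note RL = resolvent_equation[OF v b lip h' nz(1) L]
  note RR = resolvent_equation[OF v b lip h nz(2) R]
  have "(\<integral>\<omega>. (q * ?v (Z \<omega>) - generator ?v1 ?l (Z \<omega>)) - (q * ?v (Z \<omega>) - generator ?v1 ?r (Z \<omega>)) \<partial>M) = 0"
    using RL RR by (subst Bochner_Integration.integral_diff) auto
  moreover have "(q * ?v y - generator ?v1 ?l y) - (q * ?v y - generator ?v1 ?r y) = (\<sigma> c)\<^sup>2 / 2 * indicator {c} y" for y
    by (auto simp: generator_def indicator_def)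
  ultimately have "(\<integral>\<omega>. (\<sigma> c)\<^sup>2 / 2 * indicator {c} (Z \<omega>) \<partial>M) = 0" by simp
  then have "(\<integral>\<omega>. indicator {c} (Z \<omega>) \<partial>M) = (0 :: real)" using s by simp
  moreover have "(\<integral>\<omega>. indicator {c} (Z \<omega>) \<partial>M) = (\<integral>\<omega>. indicator {\<omega>\<in>space M. Z \<omega> = c} \<omega> \<partial>M :: real)"
    by (rule Bochner_Integration.integral_cong) (auto simp: indicator_def)
  ultimately show ?thesis by simp
qed

end

text \<open>
  The bounded \<open>C\<^sup>1\<close> solution \<open>v\<close> of \<open>q v - L v = q 1\<^bsub>(z, \<infinity>)\<^esub>\<close>: exponential on each of the three
  pieces, with \<open>\<kappa>\<close> determined by matching the derivatives at \<open>a\<close>.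
\<close>
definition tail_probability :: "real \<Rightarrow> real \<Rightarrow> real \<Rightarrow> real \<Rightarrow> real \<Rightarrow> real \<Rightarrow> real \<Rightarrow> real \<Rightarrow> real \<Rightarrow> real" where
  "tail_probability q W p m d \<kappa> a z y =
    (if y \<le> a then q * exp (- p * (z - a)) / (W * p) * (1 + \<kappa>) * exp (d * (y - a))
     else if y \<le> z then q * exp (- p * (z - a)) / (W * p) * (exp (p * (y - a)) + \<kappa> * exp (- m * (y - a)))
     else 1 - q / W * (exp (m * (z - a)) / m - \<kappa> * exp (- p * (z - a)) / p) * exp (- m * (y - a)))"

text \<open>\<open>d\<close> and \<open>p\<close> are positive roots and \<open>- m\<close> is a
  negative root of the characteristic equations on the two sides of \<open>a\<close>, so each piece
  solves its linear equation; the exponentials kept on the outer pieces are the bounded ones. The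
  values at \<open>z\<close> match by the condition \<open>W\<close>, and
  \<open>resolvent_equation\<close> then turns the source q 1_(z,inf) into the probability.\<close>

lemma (in exponential_sde) tail_probability:
  assumes reg1: "\<And>y. y \<le> a \<Longrightarrow> b y = \<mu>1 \<and> \<sigma> y = \<sigma>1" and reg2: "\<And>y. a < y \<Longrightarrow> b y = \<mu>2 \<and> \<sigma> y = \<sigma>2"
    and pos: "0 < p" "0 < m" "0 < d" "0 < W" and az: "a \<le> z"
    and d: "\<sigma>1\<^sup>2 / 2 * d\<^sup>2 + \<mu>1 * d = q" and p: "\<sigma>2\<^sup>2 / 2 * p\<^sup>2 + \<mu>2 * p = q" and m: "\<sigma>2\<^sup>2 / 2 * m\<^sup>2 - \<mu>2 * m = q"
    and W: "q * (p + m) = p * m * W" and \<kappa>: "\<kappa> * (m + d) = p - d"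
  shows "prob {\<omega>\<in>space M. z < Z \<omega>} = tail_probability q W p m d \<kappa> a z x"
proof -
  define A where "A = q * exp (- p * (z - a)) / (W * p)"
  define C where "C = q / W * (exp (m * (z - a)) / m - \<kappa> * exp (- p * (z - a)) / p)"
  let ?f = "\<lambda>y. A * (1 + \<kappa>) * exp (d * (y - a))" and ?f1 = "\<lambda>y. A * (1 + \<kappa>) * d * exp (d * (y - a))"
    and ?f2 = "\<lambda>y. A * (1 + \<kappa>) * d\<^sup>2 * exp (d * (y - a))"
  let ?g = "\<lambda>y. A * exp (p * (y - a)) + A * \<kappa> * exp (- m * (y - a))"
    and ?g1 = "\<lambda>y. A * p * exp (p * (y - a)) + (- A * \<kappa> * m) * exp (- m * (y - a))"
    and ?g2 = "\<lambda>y. A * p\<^sup>2 * exp (p * (y - a)) + A * \<kappa> * m\<^sup>2 * exp (- m * (y - a))"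
  let ?k = "\<lambda>y. 1 + - C * exp (- m * (y - a))" and ?k1 = "\<lambda>y. C * m * exp (- m * (y - a))"
    and ?k2 = "\<lambda>y. - C * m\<^sup>2 * exp (- m * (y - a))"
  let ?gk = "\<lambda>y. if y \<le> z then ?g y else ?k y" and ?gk1 = "\<lambda>y. if y \<le> z then ?g1 y else ?k1 y"
    and ?gk2 = "\<lambda>y. if y \<le> z then ?g2 y else ?k2 y"
  let ?v = "\<lambda>y. if y \<le> a then ?f y else ?gk y" and ?v1 = "\<lambda>y. if y \<le> a then ?f1 y else ?gk1 y"
    and ?v2 = "\<lambda>y. if y \<le> a then ?f2 y else ?gk2 y"
  have fD: "(?f has_real_derivative ?f1 y) (at y)" "(?f1 has_real_derivative ?f2 y) (at y)" for y
    by (auto intro!: derivative_eq_intros simp: power2_eq_square)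
  have gD: "(?g has_real_derivative ?g1 y) (at y)" "(?g1 has_real_derivative ?g2 y) (at y)" for y
    by (auto intro!: derivative_eq_intros simp: power2_eq_square algebra_simps)
  have kD: "(?k has_real_derivative ?k1 y) (at y)" "(?k1 has_real_derivative ?k2 y) (at y)" for y
    by (auto intro!: derivative_eq_intros simp: power2_eq_square)
  have Ep: "exp (- p * (z - a)) * exp (p * (z - a)) = 1" by (simp add: exp_add[symmetric])
  have Em: "exp (m * (z - a)) * exp (- m * (z - a)) = 1" by (simp add: exp_add[symmetric])
  have z0: "?g z = ?k z"
  proof -
    have "q / (W * p) + q / (W * m) = 1" using W pos by (simp add: field_simps)
    moreover have "A * exp (p * (z - a)) = q / (W * p)" using Ep by (simp add: A_def)
    moreover have "C * exp (- m * (z - a)) = q / (W * m) - A * \<kappa> * exp (- m * (z - a))"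
    proof -
      have "C * exp (- m * (z - a)) = q / (W * m) * (exp (m * (z - a)) * exp (- m * (z - a))) - A * \<kappa> * exp (- m * (z - a))"
        unfolding C_def A_def using pos by (simp add: field_simps)
      then show ?thesis unfolding Em by simp
    qed
    ultimately show ?thesis by simp
  qed
  have z1: "?g1 z = ?k1 z"
  proof -
    have "A * p * exp (p * (z - a)) = q / W" using Ep pos by (simp add: A_def)
    moreover have "C * m * exp (- m * (z - a)) = q / W * (exp (m * (z - a)) * exp (- m * (z - a))) - A * \<kappa> * m * exp (- m * (z - a))"
      unfolding C_def A_def using pos by (simp add: field_simps)
    ultimately show ?thesis unfolding Em by simp
  qed
  have a0: "?f a = ?gk a" using az by (simp add: algebra_simps)
  have a1: "?f1 a = ?gk1 a"
  proof -
    have "A * (1 + \<kappa>) * d = A * p - A * \<kappa> * m" using \<kappa> by (simp add: algebra_simps) (metis distrib_left mult.commute)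
    then show ?thesis using az by simp
  qed
  have gkD: "(?gk has_real_derivative ?gk1 y) (at y)" for y by (rule DERIV_If_le[OF gD(1) kD(1) z0 z1])
  have v: "(?v has_real_derivative ?v1 y) (at y)" for y by (rule DERIV_If_le[OF fD(1) gkD a0 a1])
  \<comment> \<open>One bound for the function and both derivatives on all three pieces; the bounds
    on the second derivatives become the Lipschitz constant of \<open>?v1\<close>.\<close>
  have "bounded (?f ` {..a} \<union> ?f1 ` {..a} \<union> ?f2 ` {..a} \<union> ?g ` {a..z} \<union> ?g1 ` {a..z} \<union> ?g2 ` {a..z}
      \<union> ?k ` {z..} \<union> ?k1 ` {z..} \<union> ?k2 ` {z..})"
  proof -
    have r1: "d * (y - a) \<le> 0" if "y \<in> {..a}" for y using that pos by (simp add: mult_le_0_iff)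
    have r2: "p * (y - a) \<le> p * (z - a)" if "y \<in> {a..z}" for y using that pos by simp
    have r3: "- m * (y - a) \<le> 0" if "y \<in> {a..z}" for y using that pos by simp
    have r4: "- m * (y - a) \<le> 0" if "y \<in> {z..}" for y using that pos az by simp
    have one: "bounded ((\<lambda>_. 1 :: real) ` S)" for S :: "real set" by (rule bounded_subset[of "{1}"]) auto
    have B1: "bounded ((\<lambda>y. c * exp (d * (y - a))) ` {..a})" for c by (rule bounded_exp_image[OF r1])
    have B2: "bounded ((\<lambda>y. c * exp (p * (y - a)) + c' * exp (- m * (y - a))) ` {a..z})" for c c'
      by (rule bounded_plus_comp[OF bounded_exp_image[OF r2] bounded_exp_image[OF r3]])
    have B3: "bounded ((\<lambda>y. c * exp (- m * (y - a))) ` {z..})" for c by (rule bounded_exp_image[OF r4])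
    have B4: "bounded ((\<lambda>y. 1 + c * exp (- m * (y - a))) ` {z..})" for c by (rule bounded_plus_comp[OF one B3])
    show ?thesis unfolding bounded_Un by (intro conjI) (rule B1 B2 B3 B4)+
  qed
  then obtain L where L: "\<And>u. u \<in> ?f ` {..a} \<union> ?f1 ` {..a} \<union> ?f2 ` {..a} \<union> ?g ` {a..z} \<union> ?g1 ` {a..z} \<union> ?g2 ` {a..z}
      \<union> ?k ` {z..} \<union> ?k1 ` {z..} \<union> ?k2 ` {z..} \<Longrightarrow> \<bar>u\<bar> \<le> L"
    unfolding bounded_iff real_norm_def by (elim exE) (rule that, erule bspec, assumption)
  have Lf: "\<bar>?f y\<bar> \<le> L" "\<bar>?f1 y\<bar> \<le> L" "\<bar>?f2 y\<bar> \<le> L" if "y \<in> {..a}" for y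
    by (rule L, use imageI[OF that, of ?f] imageI[OF that, of ?f1] imageI[OF that, of ?f2] in \<open>simp only: Un_iff simp_thms\<close>)+
  have Lg: "\<bar>?g y\<bar> \<le> L" "\<bar>?g1 y\<bar> \<le> L" "\<bar>?g2 y\<bar> \<le> L" if "y \<in> {a..z}" for y
    by (rule L, use imageI[OF that, of ?g] imageI[OF that, of ?g1] imageI[OF that, of ?g2] in \<open>simp only: Un_iff simp_thms\<close>)+
  have Lk: "\<bar>?k y\<bar> \<le> L" "\<bar>?k1 y\<bar> \<le> L" "\<bar>?k2 y\<bar> \<le> L" if "y \<in> {z..}" for y
    by (rule L, use imageI[OF that, of ?k] imageI[OF that, of ?k1] imageI[OF that, of ?k2] in \<open>simp only: Un_iff simp_thms\<close>)+
  have b: "\<bar>?v y\<bar> \<le> L" "\<bar>?v1 y\<bar> \<le> L" for y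
    using Lf[of y] Lg[of y] Lk[of y] by (cases "y \<le> a"; cases "y \<le> z"; simp)+
  have lipgk: "\<bar>?gk1 y - ?gk1 w\<bar> \<le> L * \<bar>y - w\<bar>" if "a \<le> y" "a \<le> w" for y w
  proof (rule Lipschitz_If_le[of "{a..}"])
    show "\<bar>?g1 y - ?g1 w\<bar> \<le> L * \<bar>y - w\<bar>" if "y \<in> {a..}" "w \<in> {a..}" "y \<le> z" "w \<le> z" for y w
      by (rule bounded_derivative_Lipschitz_on[of "{a..z}", OF _ gD(2) Lg(3)]) (use that in auto)
    show "\<bar>?k1 y - ?k1 w\<bar> \<le> L * \<bar>y - w\<bar>" if "y \<in> {a..}" "w \<in> {a..}" "z \<le> y" "z \<le> w" for y w
      by (rule bounded_derivative_Lipschitz_on[of "{z..}", OF _ kD(2) Lk(3)]) (use that in auto)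
  qed (use z1 az that in auto)
  have lip: "\<bar>?v1 y - ?v1 w\<bar> \<le> L * \<bar>y - w\<bar>" for y w
  proof (rule Lipschitz_If_le[of UNIV])
    show "\<bar>?f1 y - ?f1 w\<bar> \<le> L * \<bar>y - w\<bar>" if "y \<le> a" "w \<le> a" for y w
      by (rule bounded_derivative_Lipschitz_on[of "{..a}", OF _ fD(2) Lf(3)]) (use that in auto)
  qed (use a1 lipgk in auto)
  \<comment> \<open>Negative steps: at \<open>a\<close> and \<open>z\<close> the left second
    derivatives enter, fitting the coefficients at \<open>a\<close> and the value 0 of
    \<open>indicator {z<..}\<close> at \<open>z\<close>.\<close>
  let ?h = "\<lambda>n. - (1 / real (Suc n))"
  have h: "?h \<longlonglongrightarrow> 0" using tendsto_minus[OF lim_inverse_n'[THEN LIMSEQ_Suc]] by simp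
  have hneg: "?h n < 0" and hnz: "?h n \<noteq> 0" for n by auto
  have Lgk: "(\<lambda>n. (?gk1 (y + ?h n) - ?gk1 y) / ?h n) \<longlonglongrightarrow> ?gk2 y" for y
    by (rule left_quotient_If_le[where f = ?g1 and f' = ?g2 and g = ?k1 and g' = ?k2, OF h hneg
          DERIV_difference_quotient_sequence[OF gD(2) h hnz] DERIV_difference_quotient_sequence[OF kD(2) h hnz]])
  have v2: "(\<lambda>n. (?v1 (y + ?h n) - ?v1 y) / ?h n) \<longlonglongrightarrow> ?v2 y" for y
    by (rule left_quotient_If_le[where f = ?f1 and f' = ?f2 and g = ?gk1 and g' = ?gk2, OF h hneg
          DERIV_difference_quotient_sequence[OF fD(2) h hnz] Lgk])
  \<comment> \<open>On each piece the characteristic polynomial factors out and vanishes; only the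
    constant 1 above \<open>z\<close> survives and contributes \<open>q\<close>.\<close>
  have gen: "q * ?v y - generator ?v1 ?v2 y = q * indicator {z<..} y" for y
  proof -
    consider "y \<le> a" | "a < y" "y \<le> z" | "z < y" by linarith
    then show ?thesis
    proof cases
      case 1
      then have "q * ?v y - generator ?v1 ?v2 y = A * (1 + \<kappa>) * exp (d * (y - a)) * (q - (\<sigma>1\<^sup>2 / 2 * d\<^sup>2 + \<mu>1 * d))"
        using reg1[OF 1] by (simp add: generator_def algebra_simps)
      then show ?thesis using 1 az d by simp
    next
      case 2
      then have "q * ?v y - generator ?v1 ?v2 y = A * exp (p * (y - a)) * (q - (\<sigma>2\<^sup>2 / 2 * p\<^sup>2 + \<mu>2 * p))
        + A * \<kappa> * exp (- m * (y - a)) * (q - (\<sigma>2\<^sup>2 / 2 * m\<^sup>2 - \<mu>2 * m))"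
        using reg2[OF 2(1)] by (simp add: generator_def algebra_simps)
      then show ?thesis using 2 p m by simp
    next
      case 3
      then have "a < y" using az by simp
      then have "q * ?v y - generator ?v1 ?v2 y = q - C * exp (- m * (y - a)) * (q - (\<sigma>2\<^sup>2 / 2 * m\<^sup>2 - \<mu>2 * m))"
        using reg2[of y] 3 by (simp add: generator_def algebra_simps)
      then show ?thesis using 3 m by simp
    qed
  qed
  have "(\<integral>\<omega>. q * indicator {z<..} (Z \<omega>) \<partial>M) = q * ?v x"
    using resolvent_equation(1)[OF v b lip h hnz v2] unfolding gen .
  moreover have "(\<integral>\<omega>. indicator {z<..} (Z \<omega>) \<partial>M) = (\<integral>\<omega>. indicator {\<omega>\<in>space M. z < Z \<omega>} \<omega> \<partial>M :: real)"
    by (rule Bochner_Integration.integral_cong) (auto simp: indicator_def)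
  ultimately have "prob {\<omega>\<in>space M. z < Z \<omega>} = ?v x" using q by simp
  also have "\<dots> = tail_probability q W p m d \<kappa> a z x"
    unfolding tail_probability_def A_def[symmetric] C_def[symmetric] by (simp add: algebra_simps)
  finally show ?thesis .
qed

text \<open>Minus the derivative of \<open>tail_probability\<close> in \<open>z\<close>, for the
  starting point \<open>x\<close>. In the theorem p and m are \<delta>^- and \<delta>^+ of the upper
  side, d is \<delta>^- of the lower side, W is the square root, and \<kappa> is (p - d) / (m +
  d).\<close>

definition resolvent_density :: "real \<Rightarrow> real \<Rightarrow> real \<Rightarrow> real \<Rightarrow> real \<Rightarrow> real \<Rightarrow> real \<Rightarrow> real \<Rightarrow> real \<Rightarrow> real" where
  "resolvent_density q W p m d \<kappa> a x z =
    (if x \<le> z then q * exp (- p * (z - a)) / W * (exp (p * (x - a)) + \<kappa> * exp (- m * (x - a)))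
     else q * exp (- m * (x - a)) / W * (exp (m * (z - a)) + \<kappa> * exp (- p * (z - a))))"

text \<open>The coefficient \<open>\<kappa>\<close> may be negative, but it is at least -1 because p
  + m > 0, and the growing exponential is at least 1 while the decaying one is at most 1.\<close>

lemma resolvent_density_nonneg:
  assumes "0 < q" "0 < W" "0 < p" "0 < m" "0 < d" and \<kappa>: "\<kappa> * (m + d) = p - d" and "a \<le> x" "a \<le> z"
  shows "0 \<le> resolvent_density q W p m d \<kappa> a x z"
proof -
  have "- 1 * (m + d) \<le> \<kappa> * (m + d)" unfolding \<kappa> using assms by simp
  then have k: "- 1 \<le> \<kappa>" using assms by (subst (asm) mult_le_cancel_right) auto
  have *: "0 \<le> exp u + \<kappa> * exp (- w)" if "0 \<le> u" "0 \<le> w" for u w :: real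
  proof -
    have "- 1 * exp (- w) \<le> \<kappa> * exp (- w)" using k by (intro mult_right_mono) auto
    moreover have "exp (- w) \<le> 1" "1 \<le> exp u" using that by auto
    ultimately show ?thesis by linarith
  qed
  show ?thesis
    using *[of "p * (x - a)" "m * (x - a)"] *[of "m * (z - a)" "p * (z - a)"] assms
    by (simp add: resolvent_density_def)
qed

lemma resolvent_density_measurable: "resolvent_density q W p m d \<kappa> a x \<in> borel_measurable borel"
  unfolding resolvent_density_def[abs_def] by measurable

text \<open>Fundamental theorem of calculus on [z, inf): minus the tail probability, as a function
  of its threshold, is an antiderivative tending to 0. Its two branches agree at u = x because q /
  (W p) + q / (W m) = 1, which is the condition \<open>W\<close>.\<close>

lemma nn_integral_resolvent_density:
  assumes q: "0 < q" and pos: "0 < p" "0 < m" "0 < d" "0 < W"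
    and W: "q * (p + m) = p * m * W" and \<kappa>: "\<kappa> * (m + d) = p - d" and ax: "a \<le> x" and az: "a \<le> z"
  shows "(\<integral>\<^sup>+u. ennreal (resolvent_density q W p m d \<kappa> a x u) * indicator {z..} u \<partial>lborel)
    = ennreal (tail_probability q W p m d \<kappa> a z x)"
proof -
  define P where "P = exp (p * (x - a)) + \<kappa> * exp (- m * (x - a))"
  define Q where "Q = exp (- m * (x - a))"
  let ?F = "\<lambda>u. - (1 - q / W * (exp (m * (u - a)) / m - \<kappa> * exp (- p * (u - a)) / p) * Q)"
  let ?G = "\<lambda>u. - (q * exp (- p * (u - a)) / (W * p) * P)"
  let ?f = "\<lambda>u. q * Q / W * (exp (m * (u - a)) + \<kappa> * exp (- p * (u - a)))"
  let ?g = "\<lambda>u. q * exp (- p * (u - a)) / W * P"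
  have F: "(?F has_real_derivative ?f u) (at u)" for u
    using pos by (auto intro!: derivative_eq_intros simp: field_simps)
  have G: "(?G has_real_derivative ?g u) (at u)" for u
    using pos by (auto intro!: derivative_eq_intros simp: field_simps)
  have Ep: "exp (- p * (x - a)) * exp (p * (x - a)) = 1" by (simp add: exp_add[symmetric])
  have Em: "exp (m * (x - a)) * Q = 1" unfolding Q_def by (simp add: exp_add[symmetric])
  have FG: "?F x = ?G x"
  proof -
    have "q / (W * p) + q / (W * m) = 1" using W pos by (simp add: field_simps)
    moreover have "q * exp (- p * (x - a)) / (W * p) * P = q / (W * p) * (exp (- p * (x - a)) * exp (p * (x - a)))
        + q / (W * p) * \<kappa> * exp (- p * (x - a)) * Q"
      unfolding P_def Q_def by (simp add: algebra_simps)
    moreover have "q / W * (exp (m * (x - a)) / m - \<kappa> * exp (- p * (x - a)) / p) * Q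
       = q / (W * m) * (exp (m * (x - a)) * Q) - q / (W * p) * \<kappa> * exp (- p * (x - a)) * Q"
      using pos by (simp add: field_simps)
    ultimately show ?thesis unfolding Ep Em by simp
  qed
  have fg: "?f x = ?g x"
  proof -
    have "?f x = q / W * (exp (m * (x - a)) * Q) + q / W * \<kappa> * exp (- p * (x - a)) * Q"
      by (simp add: algebra_simps add_divide_distrib)
    moreover have "?g x = q / W * (exp (- p * (x - a)) * exp (p * (x - a))) + q / W * \<kappa> * exp (- p * (x - a)) * Q"
      unfolding P_def Q_def by (simp add: algebra_simps add_divide_distrib)
    ultimately show ?thesis unfolding Ep Em by simp
  qed
  let ?T = "\<lambda>u. if u \<le> x then ?F u else ?G u"
  \<comment> \<open>Here u = x falls into the lower branch, in \<open>resolvent_density\<close> into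
    the upper one; by \<open>fg\<close> both give the same value.\<close>
  have dens: "(if u \<le> x then ?f u else ?g u) = resolvent_density q W p m d \<kappa> a x u" for u
    using fg by (cases "u = x") (auto simp: resolvent_density_def P_def Q_def)
  have D: "(?T has_real_derivative resolvent_density q W p m d \<kappa> a x u) (at u)" for u
    unfolding dens[symmetric] by (rule DERIV_If_le[OF F G FG fg])
  have lim: "(?T \<longlongrightarrow> 0) at_top"
  proof -
    have "filterlim (\<lambda>u. - a + u) at_top at_top" by (rule filterlim_tendsto_add_at_top[OF tendsto_const filterlim_ident])
    then have "filterlim (\<lambda>u. p * (- a + u)) at_top at_top"
      by (rule filterlim_tendsto_pos_mult_at_top[OF tendsto_const pos(1)])
    then have "filterlim (\<lambda>u. - (p * (- a + u))) at_bot at_top" by (simp add: filterlim_uminus_at_bot)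
    then have "((\<lambda>u. exp (- (p * (- a + u)))) \<longlongrightarrow> 0) at_top" by (rule filterlim_compose[OF exp_at_bot])
    then have "((\<lambda>u. exp (- p * (u - a))) \<longlongrightarrow> 0) at_top" by (simp add: algebra_simps)
    then have "((\<lambda>u. - (q * exp (- p * (u - a)) / (W * p) * P)) \<longlongrightarrow> - (q * 0 / (W * p) * P)) at_top"
      using pos by (intro tendsto_intros) auto
    then have g0: "(?G \<longlongrightarrow> 0) at_top" by simp
    have "\<forall>\<^sub>F u in at_top. ?G u = ?T u" using eventually_gt_at_top[of x] by eventually_elim auto
    from Lim_transform_eventually[OF g0 this] show ?thesis .
  qed
  have "(\<integral>\<^sup>+u. ennreal (resolvent_density q W p m d \<kappa> a x u) * indicator {z..} u \<partial>lborel) = ennreal (0 - ?T z)"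
    by (rule nn_integral_FTC_atLeast)
      (use D lim az resolvent_density_nonneg[OF q pos(4,1,2,3) \<kappa> ax] resolvent_density_measurable in auto)
  also have "0 - ?T z = tail_probability q W p m d \<kappa> a z x"
  proof -
    have "0 - ?T z = - ?G z" if "x \<le> z" using that FG by (cases "x = z") auto
    moreover have "0 - ?T z = - ?F z" if "z < x" using that by simp
    \<comment> \<open>The start x = a is a separate case because \<open>tail_probability\<close>
      puts it into its lowest branch.\<close>
    ultimately show ?thesis
      using ax az by (cases "x \<le> z"; cases "x = a") (auto simp: tail_probability_def P_def Q_def)
  qed
  finally show ?thesis .
qed

section \<open>The law at the exponential time\<close>

context exponential_sde begin

text \<open>Both measures live on [a, inf) and are compared on half-lines (z, inf), so a threshold
  below \<open>a\<close> acts like \<open>a\<close> itself. Such a half-line also contains the point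
  \<open>a\<close>, whose mass is zero by \<open>no_atom\<close>.\<close>

lemma density_of_Z:
  assumes reg1: "\<And>y. y \<le> a \<Longrightarrow> b y = \<mu>1 \<and> \<sigma> y = \<sigma>1" and reg2: "\<And>y. a < y \<Longrightarrow> b y = \<mu>2 \<and> \<sigma> y = \<sigma>2"
    and pos: "0 < p" "0 < m" "0 < d" "0 < W" and \<sigma>1: "\<sigma>1 \<noteq> 0"
    and d: "\<sigma>1\<^sup>2 / 2 * d\<^sup>2 + \<mu>1 * d = q" and p: "\<sigma>2\<^sup>2 / 2 * p\<^sup>2 + \<mu>2 * p = q" and m: "\<sigma>2\<^sup>2 / 2 * m\<^sup>2 - \<mu>2 * m = q"
    and W: "q * (p + m) = p * m * W" and \<kappa>: "\<kappa> * (m + d) = p - d" and ax: "a \<le> x"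
  shows "density (distr M borel Z) (indicator {a..})
    = density lborel (\<lambda>z. ennreal (resolvent_density q W p m d \<kappa> a x z) * indicator {a..} z)"
proof (rule measure_eqI_lessThan)
  let ?f = "resolvent_density q W p m d \<kappa> a x"
  note [measurable] = resolvent_density_measurable
  have tail: "emeasure (distr M borel Z) {z<..} = ennreal (tail_probability q W p m d \<kappa> a z x)" if "a \<le> z" for z
  proof -
    have "emeasure (distr M borel Z) {z<..} = emeasure M {\<omega>\<in>space M. z < Z \<omega>}"
      by (subst emeasure_distr) (auto intro!: arg_cong[of _ _ "emeasure M"])
    also have "\<dots> = ennreal (prob {\<omega>\<in>space M. z < Z \<omega>})" by (rule emeasure_eq_measure)
    also have "prob {\<omega>\<in>space M. z < Z \<omega>} = tail_probability q W p m d \<kappa> a z x"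
      by (rule tail_probability[OF reg1 reg2 pos that d p m W \<kappa>])
    finally show ?thesis .
  qed
  have atom: "emeasure (distr M borel Z) {a} = 0"
  proof -
    have "emeasure (distr M borel Z) {a} = emeasure M {\<omega>\<in>space M. Z \<omega> = a}"
      by (subst emeasure_distr) (auto intro!: arg_cong[of _ _ "emeasure M"])
    then show ?thesis using no_atom[of a] reg1[of a] \<sigma>1 by (simp add: emeasure_eq_measure)
  qed
  have lhs: "emeasure (density (distr M borel Z) (indicator {a..})) {z<..} = ennreal (tail_probability q W p m d \<kappa> a (max a z) x)" for z
  proof -
    have "emeasure (density (distr M borel Z) (indicator {a..})) {z<..} = (\<integral>\<^sup>+u. indicator {a..} u * indicator {z<..} u \<partial>distr M borel Z)"
      by (subst emeasure_density) auto
    also have "\<dots> = (\<integral>\<^sup>+u. indicator ({a..} \<inter> {z<..}) u \<partial>distr M borel Z)"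
      by (simp only: indicator_inter_arith)
    also have "\<dots> = emeasure (distr M borel Z) ({a..} \<inter> {z<..})" by (rule nn_integral_indicator) simp
    also have "\<dots> = emeasure (distr M borel Z) {max a z<..}"
    proof (cases "a \<le> z")
      case True
      then have "{a..} \<inter> {z<..} = {max a z<..}" by auto
      then show ?thesis by simp
    next
      case False
      then have "{a..} \<inter> {z<..} = {a} \<union> {max a z<..}" by auto
      then have "emeasure (distr M borel Z) ({a..} \<inter> {z<..}) = emeasure (distr M borel Z) {a} + emeasure (distr M borel Z) {max a z<..}"
        by (simp only:) (rule plus_emeasure[symmetric], auto)
      then show ?thesis using atom by simp
    qed
    also have "\<dots> = ennreal (tail_probability q W p m d \<kappa> a (max a z) x)" by (rule tail) simp
    finally show ?thesis .
  qed
  fix z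
  show "emeasure (density (distr M borel Z) (indicator {a..})) {z<..} < \<infinity>" unfolding lhs by simp
  have "emeasure (density lborel (\<lambda>z. ennreal (?f z) * indicator {a..} z)) {z<..}
      = (\<integral>\<^sup>+u. ennreal (?f u) * indicator {a..} u * indicator {z<..} u \<partial>lborel)"
    by (subst emeasure_density) auto
  also have "\<dots> = (\<integral>\<^sup>+u. ennreal (?f u) * indicator {max a z..} u \<partial>lborel)"
  proof (rule nn_integral_cong_AE)
    show "AE u in lborel. ennreal (?f u) * indicator {a..} u * indicator {z<..} u = ennreal (?f u) * indicator {max a z..} u"
      using AE_lborel_singleton[of z] by eventually_elim (auto simp: indicator_def)
  qed
  also have "\<dots> = ennreal (tail_probability q W p m d \<kappa> a (max a z) x)"
    by (rule nn_integral_resolvent_density[OF q pos W \<kappa> ax]) simp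
  finally show "emeasure (density (distr M borel Z) (indicator {a..})) {z<..}
      = emeasure (density lborel (\<lambda>z. ennreal (?f z) * indicator {a..} z)) {z<..}"
    unfolding lhs ..
qed simp_all

lemma X_e_eq_Z: "AE \<omega> in M. X (e \<omega>) \<omega> = Z \<omega>"
proof -
  have "prob {\<omega>\<in>space M. 0 < e \<omega>} = 1" using exponential_distributedD_gt[OF e_dist order_refl q] by simp
  then have "AE \<omega> in M. 0 < e \<omega>" by (subst (asm) prob_Collect_eq_1) auto
  then show ?thesis by eventually_elim (simp add: Z_def Y_def max_def)
qed

text \<open>\<open>X\<close> is unconstrained at negative times, so
  \<open>X (e \<omega>) \<omega>\<close> equals the measurable \<open>Z\<close> only almost surely;
  completeness of \<open>M\<close> transfers measurability.\<close>

lemma X_e_measurable: "(\<lambda>\<omega>. X (e \<omega>) \<omega>) \<in> borel_measurable M"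
proof (rule measurableI)
  fix A :: "real set" assume A: "A \<in> sets borel"
  show "(\<lambda>\<omega>. X (e \<omega>) \<omega>) -` A \<inter> space M \<in> sets M"
  proof (rule in_sets_AE)
    show "AE \<omega> in M. \<omega> \<in> Z -` A \<inter> space M \<longleftrightarrow> \<omega> \<in> (\<lambda>\<omega>. X (e \<omega>) \<omega>) -` A \<inter> space M"
      using X_e_eq_Z by eventually_elim auto
    show "Z -` A \<inter> space M \<in> sets M" using A by measurable
  qed auto
qed simp

text \<open>Translates the cut-off by the factor \<open>indicator {a..}\<close> into the restricted
  spaces of \<open>has_density_on\<close>, and replaces \<open>Z\<close> by the almost surely equal
  X at time e.\<close>

lemma has_density_X_e:
  assumes f: "f \<in> borel_measurable borel" "\<And>z. a \<le> z \<Longrightarrow> 0 \<le> f z"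
    and dens: "density (distr M borel Z) (indicator {a..}) = density lborel (\<lambda>z. ennreal (f z) * indicator {a..} z)"
  shows "has_density_on M (\<lambda>\<omega>. X (e \<omega>) \<omega>) {a..} f"
  unfolding has_density_on_def
proof (intro conjI ballI)
  let ?V = "\<lambda>\<omega>. X (e \<omega>) \<omega>"
  note [measurable] = f(1)
  show "?V \<in> borel_measurable M" by (rule X_e_measurable)
  show "f \<in> borel_measurable (restrict_space lborel {a..})" by (rule measurable_restrict_space1) simp
  show "0 \<le> f z" if "z \<in> {a..}" for z using f(2) that by simp
  show "restrict_space (distr M lborel ?V) {a..} = density (restrict_space lborel {a..}) (\<lambda>z. ennreal (f z))"
  proof (rule measure_eqI)
    show s: "sets (restrict_space (distr M lborel ?V) {a..}) = sets (density (restrict_space lborel {a..}) (\<lambda>z. ennreal (f z)))"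
      by (simp add: sets_restrict_space)
    fix A assume "A \<in> sets (restrict_space (distr M lborel ?V) {a..})"
    then have A: "A \<in> sets borel" "A \<subseteq> {a..}" by (auto simp: sets_restrict_space)
    have fr: "(\<lambda>z. ennreal (f z)) \<in> borel_measurable (restrict_space lborel {a..})"
      by (rule measurable_restrict_space1) simp
    have "emeasure (restrict_space (distr M lborel ?V) {a..}) A = emeasure (distr M lborel ?V) A"
      using A by (intro emeasure_restrict_space) auto
    also have "\<dots> = emeasure (distr M borel ?V) A"
      using A X_e_measurable by (simp add: emeasure_distr)
    also have "distr M borel ?V = distr M borel Z"
      using X_e_eq_Z X_e_measurable by (intro distr_cong_AE) auto
    also have "emeasure (distr M borel Z) A = (\<integral>\<^sup>+z. indicator {a..} z * indicator A z \<partial>distr M borel Z)"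
    proof -
      have "indicator {a..} z * indicator A z = (indicator A z :: ennreal)" for z using A(2) by (auto simp: indicator_def)
      then show ?thesis using A by simp
    qed
    also have "\<dots> = emeasure (density (distr M borel Z) (indicator {a..})) A"
      using A by (subst emeasure_density) auto
    also have "\<dots> = (\<integral>\<^sup>+z. ennreal (f z) * indicator {a..} z * indicator A z \<partial>lborel)"
      unfolding dens using A by (subst emeasure_density) auto
    also have "\<dots> = (\<integral>\<^sup>+z. ennreal (f z) * indicator A z * indicator {a..} z \<partial>lborel)"
      by (simp only: mult.assoc mult.commute[of "indicator A _"])
    also have "\<dots> = (\<integral>\<^sup>+z. ennreal (f z) * indicator A z \<partial>restrict_space lborel {a..})"
      by (subst nn_integral_restrict_space) auto
    also have "\<dots> = emeasure (density (restrict_space lborel {a..}) (\<lambda>z. ennreal (f z))) A"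
      using A fr by (subst emeasure_density) (auto simp: sets_restrict_space)
    finally show "emeasure (restrict_space (distr M lborel ?V) {a..}) A
        = emeasure (density (restrict_space lborel {a..}) (\<lambda>z. ennreal (f z))) A" .
  qed
qed

end

text \<open>\<delta>^- and - \<delta>^+ are the two roots of \<sigma>^2 y^2 / 2 + \<mu> y = q. With
  s the square root, \<delta>^- + \<delta>^+ = 2 s / \<sigma>^2 and \<delta>^- \<delta>^+ = 2 q /
  \<sigma>^2, which gives the last identity.\<close>

lemma delta_root:
  assumes "0 < q" "0 < \<sigma>"
  shows "0 < delta_minus q \<mu> \<sigma>" "0 < delta_plus q \<mu> \<sigma>" "0 < sqrt (2 * q * \<sigma>\<^sup>2 + \<mu>\<^sup>2)"
    "\<sigma>\<^sup>2 / 2 * (delta_minus q \<mu> \<sigma>)\<^sup>2 + \<mu> * delta_minus q \<mu> \<sigma> = q"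
    "\<sigma>\<^sup>2 / 2 * (delta_plus q \<mu> \<sigma>)\<^sup>2 - \<mu> * delta_plus q \<mu> \<sigma> = q"
    "q * (delta_minus q \<mu> \<sigma> + delta_plus q \<mu> \<sigma>)
      = delta_minus q \<mu> \<sigma> * delta_plus q \<mu> \<sigma> * sqrt (2 * q * \<sigma>\<^sup>2 + \<mu>\<^sup>2)"
proof -
  define s where "s = sqrt (2 * q * \<sigma>\<^sup>2 + \<mu>\<^sup>2)"
  have "\<bar>\<mu>\<bar> < s" unfolding s_def using assms by (intro real_less_rsqrt) auto
  then have s: "0 < s" "- s < \<mu>" "\<mu> < s" by auto
  have s2: "s\<^sup>2 = 2 * q * \<sigma>\<^sup>2 + \<mu>\<^sup>2" unfolding s_def using assms by simp
  have \<sigma>: "\<sigma>\<^sup>2 \<noteq> 0" "0 < \<sigma>\<^sup>2" using assms by auto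
  show "0 < sqrt (2 * q * \<sigma>\<^sup>2 + \<mu>\<^sup>2)" using s(1) unfolding s_def .
  show "0 < delta_minus q \<mu> \<sigma>" "0 < delta_plus q \<mu> \<sigma>"
    unfolding delta_minus_def delta_plus_def s_def[symmetric] using s \<sigma> by (auto intro!: divide_pos_pos)
  have "\<sigma>\<^sup>2 / 2 * ((s - \<mu>) / \<sigma>\<^sup>2)\<^sup>2 + \<mu> * ((s - \<mu>) / \<sigma>\<^sup>2) = (s\<^sup>2 - \<mu>\<^sup>2) / (2 * \<sigma>\<^sup>2)"
    using \<sigma> by (simp add: power_divide power2_eq_square field_simps)
  then show "\<sigma>\<^sup>2 / 2 * (delta_minus q \<mu> \<sigma>)\<^sup>2 + \<mu> * delta_minus q \<mu> \<sigma> = q"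
    unfolding delta_minus_def s_def[symmetric] s2 using \<sigma> by simp
  have "\<sigma>\<^sup>2 / 2 * ((s + \<mu>) / \<sigma>\<^sup>2)\<^sup>2 - \<mu> * ((s + \<mu>) / \<sigma>\<^sup>2) = (s\<^sup>2 - \<mu>\<^sup>2) / (2 * \<sigma>\<^sup>2)"
    using \<sigma> by (simp add: power_divide power2_eq_square field_simps)
  then show "\<sigma>\<^sup>2 / 2 * (delta_plus q \<mu> \<sigma>)\<^sup>2 - \<mu> * delta_plus q \<mu> \<sigma> = q"
    unfolding delta_plus_def s_def[symmetric] s2 using \<sigma> by simp
  have "(s - \<mu>) * (s + \<mu>) = s\<^sup>2 - \<mu>\<^sup>2" by (simp add: power2_eq_square algebra_simps)
  then have "(s - \<mu>) / \<sigma>\<^sup>2 * ((s + \<mu>) / \<sigma>\<^sup>2) * s = (s\<^sup>2 - \<mu>\<^sup>2) / \<sigma>\<^sup>2 * (s / \<sigma>\<^sup>2)"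
    by simp
  also have "(s\<^sup>2 - \<mu>\<^sup>2) / \<sigma>\<^sup>2 = 2 * q" unfolding s2 using \<sigma> by simp
  also have "2 * q * (s / \<sigma>\<^sup>2) = q * ((s - \<mu>) / \<sigma>\<^sup>2 + (s + \<mu>) / \<sigma>\<^sup>2)"
    by (simp add: add_divide_distrib[symmetric])
  finally show "q * (delta_minus q \<mu> \<sigma> + delta_plus q \<mu> \<sigma>)
      = delta_minus q \<mu> \<sigma> * delta_plus q \<mu> \<sigma> * sqrt (2 * q * \<sigma>\<^sup>2 + \<mu>\<^sup>2)"
    unfolding delta_minus_def delta_plus_def s_def[symmetric] ..
qed

theorem theorem3p1:
  fixes M :: "'a measure" and F :: "real \<Rightarrow> 'a measure"
    and B X :: "real \<Rightarrow> 'a \<Rightarrow> real" and e :: "'a \<Rightarrow> real"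
    and a \<mu>1 \<mu>2 \<sigma>1 \<sigma>2 q x :: real
  assumes "\<sigma>1 > 0" and "\<sigma>2 > 0" and "q > 0"
    and "usual_filtered_prob_space M F"
    and "brownian_motion M F B"
    and "strong_sde_solution M F B
          (\<lambda>y. \<mu>1 * indicator {..a} y + \<mu>2 * indicator {a<..} y)
          (\<lambda>y. \<sigma>1 * indicator {..a} y + \<sigma>2 * indicator {a<..} y) x X"
    and "distributed M lborel e (exponential_density q)"
    and "prob_space.indep_set M
          (sets (vimage_algebra (space M) (\<lambda>\<omega>. \<lambda>t\<in>{0..}. X t \<omega>) (\<Pi>\<^sub>M t\<in>{0..}. borel)))
          (sets (vimage_algebra (space M) e borel))"
    and "x \<ge> a"
  shows "has_density_on M (\<lambda>\<omega>. X (e \<omega>) \<omega>) {a..}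
    (\<lambda>z. if z \<ge> x
      then q * exp (- delta_minus q \<mu>2 \<sigma>2 * (z - a)) / sqrt (2 * q * \<sigma>2\<^sup>2 + \<mu>2\<^sup>2) *
        (exp (delta_minus q \<mu>2 \<sigma>2 * (x - a)) +
          (delta_minus q \<mu>2 \<sigma>2 - delta_minus q \<mu>1 \<sigma>1) * exp (- delta_plus q \<mu>2 \<sigma>2 * (x - a)) /
          (delta_plus q \<mu>2 \<sigma>2 + delta_minus q \<mu>1 \<sigma>1))
      else q * exp (- delta_plus q \<mu>2 \<sigma>2 * (x - a)) / sqrt (2 * q * \<sigma>2\<^sup>2 + \<mu>2\<^sup>2) *
        (exp (delta_plus q \<mu>2 \<sigma>2 * (z - a)) +
          (delta_minus q \<mu>2 \<sigma>2 - delta_minus q \<mu>1 \<sigma>1) * exp (- delta_minus q \<mu>2 \<sigma>2 * (z - a)) /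
          (delta_plus q \<mu>2 \<sigma>2 + delta_minus q \<mu>1 \<sigma>1)))"
proof -
  let ?b = "\<lambda>y. \<mu>1 * indicator {..a} y + \<mu>2 * indicator {a<..} y :: real"
  let ?\<sigma> = "\<lambda>y. \<sigma>1 * indicator {..a} y + \<sigma>2 * indicator {a<..} y :: real"
  interpret usual_filtered_prob_space M F by fact
  interpret exponential_sde M F B ?b ?\<sigma> x X "\<bar>\<mu>1\<bar> + \<bar>\<mu>2\<bar> + \<bar>\<sigma>1\<bar> + \<bar>\<sigma>2\<bar>" e q
  proof
    show "\<bar>?b y\<bar> \<le> \<bar>\<mu>1\<bar> + \<bar>\<mu>2\<bar> + \<bar>\<sigma>1\<bar> + \<bar>\<sigma>2\<bar>" "\<bar>?\<sigma> y\<bar> \<le> \<bar>\<mu>1\<bar> + \<bar>\<mu>2\<bar> + \<bar>\<sigma>1\<bar> + \<bar>\<sigma>2\<bar>" for y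
      by (auto simp: indicator_def)
  qed (use assms in \<open>auto simp: strong_sde_solution_def\<close>)
  note r1 = delta_root[OF assms(3,1), of \<mu>1] and r2 = delta_root[OF assms(3,2), of \<mu>2]
  \<comment> \<open>\<open>exp (p * y)\<close> and \<open>exp (- m * y)\<close> solve the
    homogeneous equation above \<open>a\<close>; \<open>exp (d * y)\<close> solves it below and is
    the solution bounded at minus infinity.\<close>
  define p where "p = delta_minus q \<mu>2 \<sigma>2"
  define m where "m = delta_plus q \<mu>2 \<sigma>2"
  define d where "d = delta_minus q \<mu>1 \<sigma>1"
  define W where "W = sqrt (2 * q * \<sigma>2\<^sup>2 + \<mu>2\<^sup>2)"
  define \<kappa> where "\<kappa> = (p - d) / (m + d)"
  have pos: "0 < p" "0 < m" "0 < d" "0 < W" using r1 r2 by (simp_all add: p_def m_def d_def W_def)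
  have \<kappa>: "\<kappa> * (m + d) = p - d" using pos by (simp add: \<kappa>_def)
  let ?f = "resolvent_density q W p m d \<kappa> a x"
  have "has_density_on M (\<lambda>\<omega>. X (e \<omega>) \<omega>) {a..} ?f"
  proof (rule has_density_X_e)
    show "0 \<le> ?f z" if "a \<le> z" for z
      by (rule resolvent_density_nonneg[OF assms(3) pos(4,1,2,3) \<kappa> assms(9) that])
    show "density (distr M borel Z) (indicator {a..}) = density lborel (\<lambda>z. ennreal (?f z) * indicator {a..} z)"
    proof (rule density_of_Z[OF _ _ pos])
      show "?b y = \<mu>1 \<and> ?\<sigma> y = \<sigma>1" if "y \<le> a" for y using that by simp
      show "?b y = \<mu>2 \<and> ?\<sigma> y = \<sigma>2" if "a < y" for y using that by simp
    qed (use r1 r2 \<kappa> assms in \<open>simp_all add: p_def m_def d_def W_def\<close>)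
  qed (rule resolvent_density_measurable)
  moreover have "?f = (\<lambda>z. if z \<ge> x
      then q * exp (- p * (z - a)) / W * (exp (p * (x - a)) + (p - d) * exp (- m * (x - a)) / (m + d))
      else q * exp (- m * (x - a)) / W * (exp (m * (z - a)) + (p - d) * exp (- p * (z - a)) / (m + d)))"
    by (auto simp: resolvent_density_def \<kappa>_def fun_eq_iff)
  ultimately show ?thesis unfolding p_def m_def d_def W_def by simp
qed

end
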